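(* Let $n\ge1$, $\epsilon>0$ and $C>0$. Let $\{f_k\,d\gamma\}_{k\ge1}$ be centered probability measures on $\mathbb{R}^n$ with $\sqrt{f_k}\in W^{1,2}(\mathbb{R}^n,d\gamma)$ and suppose that $$\int_{\mathbb{R}^n} f_k\,e^{-\left(\frac12-\frac{\epsilon}{4\pi}\right)|x|^2}\,dx\le C\quad\text{for all }k.$$ If $\delta(f_k)\to0$ as $k\to\infty$, then $f_k\to1$ in $L^1(d\gamma)$.
   Context: On $\mathbb{R}^n$, $d\gamma=(2\pi)^{-n/2}e^{-|x|^2/2}dx$ is the standard Gaussian measure. For a probability measure $f\,d\gamma$ with $\sqrt f\in W^{1,2}(\mathbb{R}^n,d\gamma)$, the Fisher information is $\mathrm{I}(f)=\int \frac{|\nabla f|^2}{f}\,d\gamma$, the relative entropy is $\mathrm{H}(f)=\int f\log f\,d\gamma$, and the log-Sobolev deficit is $\delta(f)=\frac12 \mathrm{I}(f)-\mathrm{H}(f)\ge 0$. A probability measure $\mu$ is centered if $\int x\,d\mu=0$. *)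

theory Defs
  imports "HOL-Probability.Probability"
begin

definition gauss_measure :: "(real ^ 'n) measure" where
  "gauss_measure =
     density lborel (\<lambda>x. ennreal ((2 * pi) powr (- real CARD('n) / 2) * exp (- (norm x)\<^sup>2 / 2)))"

abbreviation partial_deriv :: "'n \<Rightarrow> (real ^ 'n \<Rightarrow> real) \<Rightarrow> real ^ 'n \<Rightarrow> real" where
  "partial_deriv i \<phi> x \<equiv> frechet_derivative \<phi> (at x) (axis i 1)"

primrec C_k :: "nat \<Rightarrow> (real ^ 'n \<Rightarrow> real) \<Rightarrow> bool" where
  "C_k 0 \<phi> \<longleftrightarrow> continuous_on UNIV \<phi>"
| "C_k (Suc k) \<phi> \<longleftrightarrow> (\<forall>x. \<phi> differentiable at x) \<and> (\<forall>i. C_k k (partial_deriv i \<phi>))"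

definition test_functions :: "(real ^ 'n \<Rightarrow> real) set" where
  "test_functions = {\<phi>. (\<forall>k. C_k k \<phi>) \<and> compact (closure {x. \<phi> x \<noteq> 0})}"

definition locally_integrable :: "(real ^ 'n \<Rightarrow> 'b::{banach, second_countable_topology}) \<Rightarrow> bool" where
  "locally_integrable u \<longleftrightarrow> (\<forall>K. compact K \<longrightarrow> set_integrable lborel K u)"

text \<open>Weak derivatives are taken in the sense of distributions, that is, tested against Lebesgue
  measure, also for the Gaussian Sobolev space.\<close>

definition has_weak_gradient :: "(real ^ 'n \<Rightarrow> real) \<Rightarrow> (real ^ 'n \<Rightarrow> real ^ 'n) \<Rightarrow> bool" where
  "has_weak_gradient u g \<longleftrightarrow> locally_integrable u \<and> locally_integrable g \<and>
     (\<forall>\<phi>\<in>test_functions. \<forall>i.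
        (LINT x|lborel. u x * partial_deriv i \<phi> x) = - (LINT x|lborel. g x $ i * \<phi> x))"

text \<open>The weak gradient is unique up to a null set, so the choice below does not affect integrals.\<close>

definition weak_gradient :: "(real ^ 'n \<Rightarrow> real) \<Rightarrow> real ^ 'n \<Rightarrow> real ^ 'n" where
  "weak_gradient u = (SOME g. has_weak_gradient u g)"

definition L2_gauss :: "(real ^ 'n \<Rightarrow> 'b::euclidean_space) set" where
  "L2_gauss = {u \<in> borel_measurable gauss_measure. integrable gauss_measure (\<lambda>x. (norm (u x))\<^sup>2)}"

definition W12_gauss :: "(real ^ 'n \<Rightarrow> real) set" where
  "W12_gauss = {u \<in> L2_gauss. \<exists>g\<in>L2_gauss. has_weak_gradient u g}"

definition gauss_prob_density :: "(real ^ 'n \<Rightarrow> real) \<Rightarrow> bool" where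
  "gauss_prob_density f \<longleftrightarrow>
     f \<in> borel_measurable gauss_measure \<and> (AE x in gauss_measure. 0 \<le> f x) \<and>
     prob_space (density gauss_measure (\<lambda>x. ennreal (f x)))"

definition centered :: "(real ^ 'n) measure \<Rightarrow> bool" where
  "centered \<mu> \<longleftrightarrow> integrable \<mu> (\<lambda>x. x) \<and> (LINT x|\<mu>. x) = 0"

text \<open>The functionals below are meant for probability densities \<open>f\<close> with \<open>sqrt f\<close> in
  \<^const>\<open>W12_gauss\<close>. For these, \<open>f\<close> has the weak gradient \<open>2 sqrt f \<nabla>(sqrt f)\<close>, which vanishes
  almost everywhere on \<open>{f = 0}\<close>, so that the convention \<open>a / 0 = 0\<close> is harmless; the integrand
  of the Fisher information is \<open>4 |\<nabla>(sqrt f)|\<^sup>2\<close> almost everywhere, hence integrable, and \<open>f ln f\<close>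
  (zero where \<open>f = 0\<close>) is integrable by the logarithmic Sobolev inequality. So both real-valued
  integrals are the true ones.\<close>

definition fisher_information :: "(real ^ 'n \<Rightarrow> real) \<Rightarrow> real" where
  "fisher_information f = (LINT x|gauss_measure. (norm (weak_gradient f x))\<^sup>2 / f x)"

definition relative_entropy :: "(real ^ 'n \<Rightarrow> real) \<Rightarrow> real" where
  "relative_entropy f = (LINT x|gauss_measure. f x * ln (f x))"

definition lsi_deficit :: "(real ^ 'n \<Rightarrow> real) \<Rightarrow> real" where
  "lsi_deficit f = fisher_information f / 2 - relative_entropy f"

end

theory Submission
  imports Defs "HOL-Computational_Algebra.Polynomial" "HOL-Real_Asymp.Real_Asymp"
begin

text \<open>Let \<open>X\<close> and \<open>Z\<close> be independent standard Gaussian vectors and put \<open>U = cos t X + sin t Z\<close>.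
  For a regular density \<open>g\<close> with score \<open>\<rho> = \<nabla>g / g\<close>, Gaussian integration by parts gives
  \<open>d/dt H(Q\<^sub>t g) = - sin t cos t E[|Q\<^sub>t \<nabla>g|\<^sup>2 / Q\<^sub>t g]\<close>, where \<open>Q\<^sub>t g(x) = E[g(cos t x + sin t Z)]\<close>.
  Hence \<open>\<delta>(g)\<close> is the integral over \<open>[0, pi/2]\<close> of \<open>sin t cos t D(t)\<close> with
  \<open>D(t) = E[g(U) |\<rho>(U) - m\<^sub>t(X)|\<^sup>2]\<close> and \<open>m\<^sub>t = Q\<^sub>t \<nabla>g / Q\<^sub>t g\<close>. So a small deficit makes \<open>D(t)\<close> small
  for some \<open>t\<close> in \<open>(pi/6, pi/3)\<close>. There the law of \<open>X\<close> given \<open>U = u\<close> has a density bounded below on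
  the unit ball, uniformly for \<open>u\<close> in a ball \<open>B\<close>; freezing a good value of \<open>X\<close> shows that \<open>\<rho>\<close> is
  close to a constant vector in \<open>L\<^sup>2(B, g d\<gamma>)\<close>. The second moment bounds the Fisher information in
  terms of the deficit and controls the mass outside \<open>B\<close>, and centering, i.e. \<open>E[\<rho> g] = 0\<close>, forces
  the constant to be small. Therefore \<open>\<integral> |\<nabla>g| d\<gamma>\<close> is small, and the \<open>L\<^sup>1\<close> Poincare inequality
  concludes. A general density is replaced by \<open>(Q\<^sub>t(f \<xi>\<^sup>2) + \<kappa>) / Z\<close> with a cutoff \<open>\<xi>\<close>: by convexity
  its Fisher information is asymptotically at most that of \<open>f\<close>, and by Fatou's lemma its entropy is
  asymptotically at least that of \<open>f\<close>, so the deficit does not increase in the limit.\<close>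

section \<open>Gaussian measure and differentiation under the integral\<close>

text \<open>The exponential integral condition enters only through the second moment it bounds. The
  obstacle is uniformity: the derivative formulas need a density that is bounded, bounded away from
  0 and of bounded gradient, and these bounds degenerate in the approximation. They therefore serve
  for integrability alone, and the \<open>d\<close> of \<open>nice_density_L1\<close> is chosen from
  the error and the second moment before any density is given. The angle \<open>t\<close> replaces
  the time \<open>- ln (cos t)\<close> of the Ornstein-Uhlenbeck semigroup. The law of (X, Z) is
  invariant under rotations, so U and V = cos t Z - sin t X are again independent standard
  Gaussians, and each identity is Fubini in one pair of coordinates followed by Fubini in the other.
  An angle in (pi/6, pi/3) keeps both the weight sin t cos t and the noise sin t Z from
  degenerating. The same semigroup is the mollifier: its kernel is smooth, and its gradients in the
  two variables are proportional, so that a kernel times a cutoff is a test function through which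
  the weak gradient passes.\<close>

abbreviation gauss :: "(real ^ 'n) measure" where "gauss \<equiv> gauss_measure"

definition gauss_pdf :: "real ^ 'n \<Rightarrow> real" where
  "gauss_pdf x = (2 * pi) powr (- real CARD('n) / 2) * exp (- (norm x)\<^sup>2 / 2)"

lemma gauss_measure_eq: "gauss_measure = density lborel (\<lambda>x. ennreal (gauss_pdf x))"
  by (simp add: gauss_measure_def gauss_pdf_def)

lemma gauss_pdf_pos: "0 < gauss_pdf x"
  by (simp add: gauss_pdf_def)

lemma gauss_pdf_measurable [measurable]: "gauss_pdf \<in> borel_measurable borel"
  unfolding gauss_pdf_def by measurable

lemma sets_gauss [simp, measurable_cong]: "sets gauss = sets borel"
  by (simp add: gauss_measure_def)

lemma space_gauss [simp]: "space gauss = UNIV"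
  by (simp add: gauss_measure_def)

lemma AE_gauss_iff: "(AE x in gauss. P x) \<longleftrightarrow> (AE x in lborel. P x)"
  unfolding gauss_measure_eq by (subst AE_density) (auto simp: gauss_pdf_pos)

lemma integrable_gauss_iff:
  fixes f :: "real ^ 'n \<Rightarrow> 'b::{banach, second_countable_topology}"
  assumes "f \<in> borel_measurable borel"
  shows "integrable gauss f \<longleftrightarrow> integrable lborel (\<lambda>x. gauss_pdf x *\<^sub>R f x)"
  unfolding gauss_measure_eq using assms
  by (subst integrable_density) (auto simp: less_imp_le[OF gauss_pdf_pos])

lemma integral_gauss:
  fixes f :: "real ^ 'n \<Rightarrow> 'b::{banach, second_countable_topology}"
  assumes "f \<in> borel_measurable borel"
  shows "(LINT x|gauss. f x) = (LINT x|lborel. gauss_pdf x *\<^sub>R f x)"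
  unfolding gauss_measure_eq using assms
  by (subst integral_density) (auto simp: less_imp_le[OF gauss_pdf_pos])

lemma nn_integral_gauss:
  assumes "f \<in> borel_measurable borel"
  shows "(\<integral>\<^sup>+x. f x \<partial>gauss) = (\<integral>\<^sup>+x. ennreal (gauss_pdf x) * f x \<partial>lborel)"
  unfolding gauss_measure_eq using assms by (subst nn_integral_density) auto

lemma nn_integral_normal_density:
  assumes "\<sigma> > 0"
  shows "(\<integral>\<^sup>+x. ennreal (normal_density \<mu> \<sigma> x) \<partial>lborel) = 1"
  by (subst nn_integral_eq_integral) (use assms in auto)

lemma norm_eq_sum_Basis: "(norm (x::'a::euclidean_space))\<^sup>2 = (\<Sum>b\<in>Basis. (x \<bullet> b)\<^sup>2)"
  unfolding dot_square_norm[symmetric] by (subst euclidean_inner) (simp add: power2_eq_square)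

lemma nn_integral_exp_norm_sq:
  assumes "\<sigma> > 0"
  shows "(\<integral>\<^sup>+x. ennreal (exp (- (norm (x::'a::euclidean_space))\<^sup>2 / (2 * \<sigma>\<^sup>2))) \<partial>lborel)
    = ennreal (sqrt (2 * pi * \<sigma>\<^sup>2) ^ DIM('a))"
proof -
  let ?c = "sqrt (2 * pi * \<sigma>\<^sup>2)"
  have c: "?c > 0" using assms by simp
  have *: "exp (- (norm (x::'a))\<^sup>2 / (2 * \<sigma>\<^sup>2)) = (\<Prod>b\<in>Basis. ?c * normal_density 0 \<sigma> (x \<bullet> b))" for x
  proof -
    have "(\<Prod>b\<in>(Basis::'a set). ?c * normal_density 0 \<sigma> (x \<bullet> b))
      = (\<Prod>b\<in>(Basis::'a set). exp (- (x \<bullet> b)\<^sup>2 / (2 * \<sigma>\<^sup>2)))"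
      using c by (intro prod.cong) (auto simp: normal_density_def)
    also have "\<dots> = exp (\<Sum>b\<in>(Basis::'a set). - (x \<bullet> b)\<^sup>2 / (2 * \<sigma>\<^sup>2))"
      by (simp add: exp_sum)
    also have "(\<Sum>b\<in>(Basis::'a set). - (x \<bullet> b)\<^sup>2 / (2 * \<sigma>\<^sup>2)) = - (norm x)\<^sup>2 / (2 * \<sigma>\<^sup>2)"
      by (simp add: norm_eq_sum_Basis sum_divide_distrib sum_negf)
    finally show ?thesis by simp
  qed
  have "(\<integral>\<^sup>+x. ennreal (exp (- (norm (x::'a))\<^sup>2 / (2 * \<sigma>\<^sup>2))) \<partial>lborel)
     = (\<integral>\<^sup>+x. (\<Prod>b\<in>(Basis::'a set). ennreal (?c * normal_density 0 \<sigma> (x \<bullet> b))) \<partial>lborel)"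
    unfolding * using c by (subst prod_ennreal) (auto intro!: mult_nonneg_nonneg)
  also have "\<dots> = (\<Prod>b\<in>(Basis::'a set). (\<integral>\<^sup>+x. ennreal (?c * normal_density 0 \<sigma> x) \<partial>lborel))"
    by (subst nn_integral_lborel_prod) auto
  also have "(\<integral>\<^sup>+x. ennreal (?c * normal_density 0 \<sigma> x) \<partial>lborel) = ennreal ?c"
    using c assms by (subst ennreal_mult) (auto simp: nn_integral_cmult nn_integral_normal_density)
  finally show ?thesis using c by (simp add: ennreal_power)
qed

lemma prob_space_gauss: "prob_space (gauss :: (real ^ 'n) measure)"
proof
  have "emeasure (gauss :: (real ^ 'n) measure) (space gauss) = (\<integral>\<^sup>+x. 1 \<partial>(gauss :: (real ^ 'n) measure))"
    by simp
  also have "\<dots> = (\<integral>\<^sup>+x. ennreal ((2 * pi) powr (- real CARD('n) / 2))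
      * ennreal (exp (- (norm (x :: real ^ 'n))\<^sup>2 / (2 * 1\<^sup>2))) \<partial>lborel)"
    by (subst nn_integral_gauss) (auto simp: gauss_pdf_def ennreal_mult[symmetric])
  also have "\<dots> = ennreal ((2 * pi) powr (- real CARD('n) / 2)) * ennreal (sqrt (2 * pi * 1\<^sup>2) ^ DIM(real ^ 'n))"
    by (subst nn_integral_cmult) (simp_all only: nn_integral_exp_norm_sq[OF zero_less_one], measurable)
  also have "\<dots> = ennreal ((2 * pi) powr (- real CARD('n) / 2) * (2 * pi) powr (real CARD('n) / 2))"
    by (subst ennreal_mult[symmetric])
      (auto simp: powr_half_sqrt[symmetric] powr_power)
  also have "\<dots> = 1" by (simp add: powr_add[symmetric])
  finally show "emeasure (gauss :: (real ^ 'n) measure) (space gauss) = 1" .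
qed

interpretation gauss: prob_space "gauss_measure :: (real ^ 'n) measure"
  by (rule prob_space_gauss)

interpretation gauss_pair: pair_sigma_finite "gauss_measure :: (real ^ 'n) measure" "gauss_measure :: (real ^ 'n) measure" ..

interpretation gauss_pair: pair_prob_space "gauss_measure :: (real ^ 'n) measure" "gauss_measure :: (real ^ 'n) measure" ..

lemma integrable_exp_norm_sq:
  assumes "a > 0"
  shows "integrable lborel (\<lambda>x::'a::euclidean_space. exp (- a * (norm x)\<^sup>2))"
proof (rule integrableI_nonneg)
  define s where "s = 1 / sqrt (2 * a)"
  have s: "s > 0" "1 / (2 * s\<^sup>2) = a" using assms by (auto simp: s_def power_divide)
  have "(\<integral>\<^sup>+x. ennreal (exp (- a * (norm (x::'a))\<^sup>2)) \<partial>lborel)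
    = (\<integral>\<^sup>+x. ennreal (exp (- (norm (x::'a))\<^sup>2 / (2 * s\<^sup>2))) \<partial>lborel)"
    unfolding s(2)[symmetric] by (simp add: field_simps)
  also have "\<dots> < \<infinity>" unfolding nn_integral_exp_norm_sq[OF s(1)] by simp
  finally show "(\<integral>\<^sup>+x. ennreal (exp (- a * (norm (x::'a))\<^sup>2)) \<partial>lborel) < \<infinity>" .
qed auto

text \<open>Half of the Gaussian exponent is spent on this weight. It dominates every quadratic
  polynomial and is the majorant behind \<open>integrable_gauss_quadratic\<close>.\<close>

lemma integrable_gauss_exp: "integrable gauss (\<lambda>x. exp ((norm x)\<^sup>2 / 4))"
proof -
  have "integrable lborel (\<lambda>x::real^'n. (2 * pi) powr (- real CARD('n) / 2) * exp (- (1/4) * (norm x)\<^sup>2))"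
    by (intro integrable_mult_right integrable_exp_norm_sq) auto
  then show ?thesis
    by (subst integrable_gauss_iff)
      (auto simp: gauss_pdf_def mult.assoc exp_add[symmetric])
qed

text \<open>Absorb \<open>a * t\<close> into \<open>a^2 + t^2 / 4\<close> and use
  \<open>1 + s \<le> exp s\<close> at \<open>s = t^2 / 4\<close>. The factor must then dominate
  \<open>a^2 + d\<close> at order zero and \<open>4 * \<bar>b\<bar> + 1\<close> at order
  two.\<close>

lemma quadratic_le_exp: "a * t + b * t\<^sup>2 + d \<le> (a\<^sup>2 + 8 * \<bar>b\<bar> + \<bar>d\<bar> + 1) * exp (t\<^sup>2 / 4)" for t :: real
proof -
  have e: "1 + t\<^sup>2 / 4 \<le> exp (t\<^sup>2 / 4)" by (rule exp_ge_add_one_self)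
  have "a * t \<le> a\<^sup>2 + t\<^sup>2 / 4"
    using zero_le_power2[of "a - t/2"] by (simp add: power2_eq_square algebra_simps)
  moreover have "b * t\<^sup>2 \<le> \<bar>b\<bar> * t\<^sup>2" by (intro mult_right_mono) auto
  ultimately have "a * t + b * t\<^sup>2 + d \<le> (a\<^sup>2 + 8 * \<bar>b\<bar> + \<bar>d\<bar> + 1) * (1 + t\<^sup>2 / 4)"
  proof -
    have "0 \<le> a\<^sup>2 * t\<^sup>2" "0 \<le> \<bar>d\<bar> * t\<^sup>2" by simp_all
    moreover have "\<bar>b\<bar> * t\<^sup>2 \<ge> 0" by simp
    moreover have "d \<le> \<bar>d\<bar>" by simp
    ultimately show ?thesis
      using \<open>a * t \<le> _\<close> \<open>b * t\<^sup>2 \<le> _\<close> unfolding distrib_left distrib_right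
      by linarith
  qed
  also have "\<dots> \<le> (a\<^sup>2 + 8 * \<bar>b\<bar> + \<bar>d\<bar> + 1) * exp (t\<^sup>2 / 4)"
    by (intro mult_left_mono e) (auto intro!: add_nonneg_nonneg)
  finally show ?thesis .
qed

lemma integrable_gauss_quadratic:
  fixes F :: "real ^ 'n \<Rightarrow> 'b::{banach, second_countable_topology}"
  assumes [measurable]: "F \<in> borel_measurable borel"
    and bd: "\<And>x. norm (F x) \<le> a * norm x + b * (norm x)\<^sup>2 + d"
  shows "integrable gauss F"
proof (rule Bochner_Integration.integrable_bound)
  show "integrable gauss (\<lambda>x::real^'n. (a\<^sup>2 + 8 * \<bar>b\<bar> + \<bar>d\<bar> + 1) * exp ((norm x)\<^sup>2 / 4))"
    by (intro integrable_mult_right integrable_gauss_exp)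
  show "AE x in gauss. norm (F x) \<le> norm ((a\<^sup>2 + 8 * \<bar>b\<bar> + \<bar>d\<bar> + 1) * exp ((norm x)\<^sup>2 / 4))"
    using order_trans[OF bd quadratic_le_exp] by (intro AE_I2) (auto simp: abs_mult)
qed auto

text \<open>The difference quotient minus its linear part is dominated by \<open>2 * B\<close>: one
  \<open>B\<close> comes from the Lipschitz bound at \<open>x0\<close>, the other from the bound on
  \<open>A\<close>. Dominated convergence is about sequences, so the limit is tested along
  them.\<close>

lemma has_derivative_integral:
  fixes K :: "'a::euclidean_space \<Rightarrow> 'y \<Rightarrow> real"
  assumes r: "r > 0"
    and int: "\<And>x. x \<in> ball x0 r \<Longrightarrow> integrable M (K x)"
    and der: "\<And>y. y \<in> space M \<Longrightarrow> ((\<lambda>x. K x y) has_derivative (\<lambda>h. A y \<bullet> h)) (at x0)"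
    and A: "A \<in> borel_measurable M"
    and bdA: "\<And>y. y \<in> space M \<Longrightarrow> norm (A y) \<le> B y"
    and bd: "\<And>x y. x \<in> ball x0 r \<Longrightarrow> y \<in> space M \<Longrightarrow> \<bar>K x y - K x0 y\<bar> \<le> B y * norm (x - x0)"
    and B: "integrable M B"
  shows "integrable M A"
    and "((\<lambda>x. LINT y|M. K x y) has_derivative (\<lambda>h. (LINT y|M. A y) \<bullet> h)) (at x0)"
proof -
  show iA: "integrable M A"
    using bdA by (intro Bochner_Integration.integrable_bound[OF B A] AE_I2) (fastforce intro: order_trans)
  show "((\<lambda>x. LINT y|M. K x y) has_derivative (\<lambda>h. (LINT y|M. A y) \<bullet> h)) (at x0)"
    unfolding has_derivative_iff_norm
  proof (intro conjI bounded_linear_inner_right tendsto_at_iff_sequentially[THEN iffD2] allI impI)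
    fix X :: "nat \<Rightarrow> 'a" assume X: "\<forall>i. X i \<in> UNIV - {x0}" "X \<longlonglongrightarrow> x0"
    from X(2) r obtain N where N: "\<And>i. i \<ge> N \<Longrightarrow> X i \<in> ball x0 r"
      unfolding LIMSEQ_def mem_ball by (auto simp: dist_commute)
    \<comment> \<open>Drop the first terms so that the whole sequence lies in the ball where
      \<open>K x\<close> is integrable.\<close>
    define Y where "Y i = X (i + N)" for i
    have Y: "Y i \<in> ball x0 r" "Y i \<noteq> x0" for i using N X by (auto simp: Y_def)
    have Ylim: "Y \<longlonglongrightarrow> x0" unfolding Y_def using X(2) by (rule LIMSEQ_ignore_initial_segment)
    let ?q = "\<lambda>i y. norm (K (Y i) y - K x0 y - A y \<bullet> (Y i - x0)) / norm (Y i - x0)"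
    have x0: "integrable M (K x0)" using int[of x0] r by simp
    \<comment> \<open>The signed quotient is linear in \<open>K\<close>, so its integral splits; the
      norm is taken only after integrating.\<close>
    let ?q' = "\<lambda>i y. (K (Y i) y - K x0 y - A y \<bullet> (Y i - x0)) / norm (Y i - x0)"
    have "(\<lambda>i. LINT y|M. ?q' i y) \<longlonglongrightarrow> (LINT y|M. 0)"
    proof (rule integral_dominated_convergence[where w = "\<lambda>y. 2 * B y"])
      show "(\<lambda>y. ?q' i y) \<in> borel_measurable M" for i
        using borel_measurable_integrable[OF int[OF Y(1)]] borel_measurable_integrable[OF x0] A by measurable
      show "integrable M (\<lambda>y. 2 * B y)" using B by simp
      show "AE y in M. (\<lambda>i. ?q' i y) \<longlonglongrightarrow> 0"
      proof (rule AE_I2)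
        fix y assume "y \<in> space M"
        from der[OF this] have "((\<lambda>x. norm (K x y - K x0 y - A y \<bullet> (x - x0)) / norm (x - x0)) \<longlongrightarrow> 0) (at x0)"
          unfolding has_derivative_iff_norm by simp
        then have "((\<lambda>x. norm (K x y - K x0 y - A y \<bullet> (x - x0)) / norm (x - x0)) \<circ> Y) \<longlonglongrightarrow> 0"
          unfolding tendsto_at_iff_sequentially using Y(2) Ylim by auto
        then have "(\<lambda>i. norm (?q' i y)) \<longlonglongrightarrow> 0" by (simp add: o_def)
        then show "(\<lambda>i. ?q' i y) \<longlonglongrightarrow> 0" by (rule tendsto_norm_zero_cancel)
      qed
      show "AE y in M. norm (?q' i y) \<le> 2 * B y" for i
      proof (rule AE_I2)
        fix y assume y: "y \<in> space M"
        have n: "norm (Y i - x0) > 0" using Y(2)[of i] by simp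
        have "\<bar>K (Y i) y - K x0 y - A y \<bullet> (Y i - x0)\<bar> \<le> B y * norm (Y i - x0) + norm (A y) * norm (Y i - x0)"
          using bd[OF Y(1) y, of i] Cauchy_Schwarz_ineq2[of "A y" "Y i - x0"] by linarith
        also have "\<dots> \<le> 2 * B y * norm (Y i - x0)"
          using mult_right_mono[OF bdA[OF y], of "norm (Y i - x0)"] by simp
        finally show "norm (?q' i y) \<le> 2 * B y" using n by (simp add: divide_le_eq)
      qed
    qed simp_all
    also have "(\<lambda>i. LINT y|M. ?q' i y) = (\<lambda>i. ((LINT y|M. K (Y i) y) - (LINT y|M. K x0 y)
        - (LINT y|M. A y) \<bullet> (Y i - x0)) / norm (Y i - x0))"
      using int[OF Y(1)] x0 iA by (intro ext) simp
    finally have "(\<lambda>i. norm (((LINT y|M. K (Y i) y) - (LINT y|M. K x0 y)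
        - (LINT y|M. A y) \<bullet> (Y i - x0)) / norm (Y i - x0))) \<longlonglongrightarrow> 0"
      by (intro tendsto_norm_zero) simp
    then show "((\<lambda>y. norm ((LINT z|M. K y z) - (LINT z|M. K x0 z) - (LINT z|M. A z) \<bullet> (y - x0)) / norm (y - x0)) \<circ> X) \<longlonglongrightarrow> 0"
      unfolding Y_def by - (rule LIMSEQ_offset[where k = N], simp add: o_def)
  qed
qed

text \<open>The mean value inequality turns a majorant of the derivative near \<open>x0\<close> into
  the Lipschitz bound of \<open>has_derivative_integral\<close>.\<close>

lemma has_field_derivative_integral:
  fixes K :: "real \<Rightarrow> 'y \<Rightarrow> real"
  assumes r: "r > 0"
    and int: "\<And>x. \<bar>x - x0\<bar> < r \<Longrightarrow> integrable M (K x)"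
    and der: "\<And>x y. y \<in> space M \<Longrightarrow> \<bar>x - x0\<bar> < r \<Longrightarrow> ((\<lambda>x. K x y) has_real_derivative A x y) (at x)"
    and A: "A x0 \<in> borel_measurable M"
    and bdA: "\<And>x y. y \<in> space M \<Longrightarrow> \<bar>x - x0\<bar> < r \<Longrightarrow> \<bar>A x y\<bar> \<le> B y"
    and B: "integrable M B"
  shows "((\<lambda>x. LINT y|M. K x y) has_real_derivative (LINT y|M. A x0 y)) (at x0)"
proof -
  have "((\<lambda>x. LINT y|M. K x y) has_derivative (\<lambda>h. (LINT y|M. A x0 y) \<bullet> h)) (at x0)"
  proof (rule has_derivative_integral(2)[OF r _ _ A _ _ B])
    fix y assume y: "y \<in> space M"
    show "((\<lambda>x. K x y) has_derivative (\<bullet>) (A x0 y)) (at x0)"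
      using der[OF y, of x0] r by (simp add: has_field_derivative_def)
    show "norm (A x0 y) \<le> B y" using bdA[OF y, of x0] r by simp
    fix x assume x: "x \<in> ball x0 r"
    have ball: "\<bar>z - x0\<bar> < r" if "z \<in> ball x0 r" for z
      using that by (simp add: dist_real_def abs_minus_commute)
    have "norm (K x y - K x0 y) \<le> B y * norm (x - x0)"
    proof (rule field_differentiable_bound[of "ball x0 r" "\<lambda>x. K x y" "\<lambda>x. A x y"])
      fix z assume z: "z \<in> ball x0 r"
      show "((\<lambda>x. K x y) has_real_derivative A z y) (at z within ball x0 r)"
        by (rule has_field_derivative_at_within[OF der[OF y ball[OF z]]])
      show "norm (A z y) \<le> B y" using bdA[OF y ball[OF z]] by simp
    qed (use x r in simp_all)
    then show "\<bar>K x y - K x0 y\<bar> \<le> B y * norm (x - x0)" by simp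
  next
    fix x assume "x \<in> ball x0 r"
    then show "integrable M (K x)" by (intro int) (simp add: dist_real_def abs_minus_commute)
  qed
  then show ?thesis by (simp add: has_field_derivative_def)
qed

lemma has_gradient_line:
  fixes K :: "'a::euclidean_space \<Rightarrow> real"
  assumes "(K has_derivative (\<lambda>h. a \<bullet> h)) (at (x + t *\<^sub>R e))"
  shows "((\<lambda>t. K (x + t *\<^sub>R e)) has_real_derivative (a \<bullet> e)) (at t)"
proof -
  have "((\<lambda>t. K (x + t *\<^sub>R e)) has_derivative (\<lambda>h. a \<bullet> (h *\<^sub>R e))) (at t)"
  proof (rule has_derivative_compose[where g = K and f = "\<lambda>t. x + t *\<^sub>R e" and g' = "\<lambda>h. a \<bullet> h"])
    show "((\<lambda>t. x + t *\<^sub>R e) has_derivative (\<lambda>h. h *\<^sub>R e)) (at t)"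
      by (auto intro!: derivative_eq_intros)
  qed (rule assms)
  moreover have "(\<lambda>h. a \<bullet> (h *\<^sub>R e)) = (*) (a \<bullet> e)" by (auto simp: mult.commute)
  ultimately show ?thesis by (simp add: has_field_derivative_def)
qed

lemma lborel_integral_translate:
  fixes f :: "'a::euclidean_space \<Rightarrow> real"
  shows "(LINT x|lborel. f (x + c)) = (LINT x|lborel. f x)"
proof (cases "f \<in> borel_measurable borel")
  case True
  have "(LINT x|lborel. f x) = (LINT x|distr lborel borel ((+) c). f x)" by (simp add: lborel_distr_plus)
  also have "\<dots> = (LINT x|lborel. f (c + x))" using True by (subst integral_distr) auto
  finally show ?thesis by (simp add: add.commute)
next
  \<comment> \<open>A translate of a nonmeasurable function is nonmeasurable, so neither side is
    integrable and both integrals take the default value 0.\<close>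
  case False
  have "(\<lambda>x. f (x + c)) \<notin> borel_measurable borel"
  proof
    assume "(\<lambda>x. f (x + c)) \<in> borel_measurable borel"
    then have "(\<lambda>x. f ((x - c) + c)) \<in> borel_measurable borel" by measurable
    with False show False by simp
  qed
  with False show ?thesis
    using borel_measurable_integrable[of lborel f] borel_measurable_integrable[of lborel "\<lambda>x. f (x + c)"]
    by (subst (1 2) not_integrable_integral_eq) auto
qed

lemma lborel_integrable_translate:
  fixes f :: "'a::euclidean_space \<Rightarrow> real"
  assumes "integrable lborel f"
  shows "integrable lborel (\<lambda>x. f (x + c))"
proof -
  have "integrable (distr lborel borel ((+) c)) f" using assms by (simp add: lborel_distr_plus)
  then have "integrable lborel (\<lambda>x. f (c + x))"
    by (subst (asm) integrable_distr_eq) (use borel_measurable_integrable[OF assms] in auto)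
  then show ?thesis by (simp add: add.commute)
qed

text \<open>Differentiate the constant function \<open>t \<mapsto> \<integral> K (x + t e) dx\<close> at \<open>0\<close>.\<close>

lemma integral_gradient_eq_0:
  fixes K :: "'a::euclidean_space \<Rightarrow> real"
  assumes der: "\<And>x. (K has_derivative (\<lambda>h. A x \<bullet> h)) (at x)"
    and K: "integrable lborel K"
    and A [measurable]: "A \<in> borel_measurable borel"
    and bd: "\<And>x t. \<bar>t\<bar> < 1 \<Longrightarrow> \<bar>A (x + t *\<^sub>R e) \<bullet> e\<bar> \<le> B x"
    and B: "integrable lborel B"
  shows "(LINT x|lborel. A x \<bullet> e) = 0"
proof -
  have "((\<lambda>t. LINT x|lborel. K (x + t *\<^sub>R e)) has_real_derivative (LINT x|lborel. A (x + 0 *\<^sub>R e) \<bullet> e)) (at 0)"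
  proof (rule has_field_derivative_integral[where r = 1 and B = B and A = "\<lambda>t x. A (x + t *\<^sub>R e) \<bullet> e"])
    show "integrable lborel (\<lambda>x. K (x + t *\<^sub>R e))" for t by (rule lborel_integrable_translate[OF K])
    show "((\<lambda>t. K (x + t *\<^sub>R e)) has_real_derivative A (x + t *\<^sub>R e) \<bullet> e) (at t)" for x t
      by (rule has_gradient_line[OF der])
  qed (use bd B in simp_all)
  moreover have "(\<lambda>t. LINT x|lborel. K (x + t *\<^sub>R e)) = (\<lambda>t. LINT x|lborel. K x)"
    by (simp add: lborel_integral_translate)
  ultimately have "((\<lambda>t::real. LINT x|lborel. K x) has_real_derivative (LINT x|lborel. A x \<bullet> e)) (at 0)"
    by simp
  then show ?thesis using DERIV_const DERIV_unique by blast
qed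

section \<open>Gaussian integration by parts and rotation invariance\<close>

lemma gauss_pdf_has_derivative:
  "(gauss_pdf has_derivative (\<lambda>h. - (gauss_pdf x *\<^sub>R x) \<bullet> h)) (at x)"
proof -
  have "((\<lambda>x. (2 * pi) powr (- real CARD('n) / 2) * exp (- (x \<bullet> x) / 2)) has_derivative
      (\<lambda>h. (2 * pi) powr (- real CARD('n) / 2) * (exp (- (x \<bullet> x) / 2) * (- (x \<bullet> h))))) (at x)" for x :: "real ^ 'n"
    by (auto intro!: derivative_eq_intros simp: inner_commute)
  then show ?thesis
    unfolding gauss_pdf_def[abs_def] power2_norm_eq_inner by (simp add: mult.assoc)
qed

text \<open>A majorant uniform in the shift. Half of the exponent of \<open>gauss_pdf y\<close>
  absorbs the linear factor; the remaining \<open>exp (- |y|^2 / 4)\<close> decays in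
  \<open>x\<close> because \<open>|x|^2 \<le> 2 |y|^2 + 2 |e|^2\<close>.\<close>

lemma gauss_pdf_shift_bound:
  fixes x e :: "real ^ 'n"
  assumes "\<bar>t\<bar> < 1" "a \<ge> 0" "b \<ge> 0"
  defines "y \<equiv> x + t *\<^sub>R e"
  shows "(a * norm y + b) * gauss_pdf y \<le>
    (a\<^sup>2 + b + 1) * (2 * pi) powr (- real CARD('n) / 2) * exp ((norm e)\<^sup>2 / 4) * exp (- (1/8) * (norm x)\<^sup>2)"
proof -
  have "norm x \<le> norm y + norm e"
  proof -
    have "norm x = norm (y - t *\<^sub>R e)" by (simp add: y_def)
    also have "\<dots> \<le> norm y + norm (t *\<^sub>R e)" by (rule norm_triangle_ineq4)
    also have "norm (t *\<^sub>R e) \<le> norm e" using assms(1) by (simp add: mult_left_le_one_le)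
    finally show ?thesis by simp
  qed
  then have "(norm x)\<^sup>2 \<le> (norm y + norm e)\<^sup>2" by (intro power_mono) auto
  also have "\<dots> \<le> 2 * (norm y)\<^sup>2 + 2 * (norm e)\<^sup>2" using sum_squares_bound[of "norm y" "norm e"] by (simp add: power2_eq_square algebra_simps)
  finally have x: "- (norm y)\<^sup>2 / 4 \<le> (norm e)\<^sup>2 / 4 + - (1/8) * (norm x)\<^sup>2" by simp
  have "a * norm y + b \<le> (a\<^sup>2 + b + 1) * exp ((norm y)\<^sup>2 / 4)"
    using quadratic_le_exp[of a "norm y" 0 b] assms(3) by simp
  then have "(a * norm y + b) * exp (- (norm y)\<^sup>2 / 2) \<le> (a\<^sup>2 + b + 1) * exp ((norm y)\<^sup>2 / 4) * exp (- (norm y)\<^sup>2 / 2)"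
    by (rule mult_right_mono) simp
  also have "\<dots> = (a\<^sup>2 + b + 1) * exp (- (norm y)\<^sup>2 / 4)"
    by (simp add: mult.assoc exp_add[symmetric])
  also have "\<dots> \<le> (a\<^sup>2 + b + 1) * exp ((norm e)\<^sup>2 / 4 + - (1/8) * (norm x)\<^sup>2)"
    using x assms(3) by (intro mult_left_mono) (auto intro: add_nonneg_nonneg)
  finally have "(a * norm y + b) * exp (- (norm y)\<^sup>2 / 2) * (2 * pi) powr (- real CARD('n) / 2)
     \<le> (a\<^sup>2 + b + 1) * exp ((norm e)\<^sup>2 / 4 + - (1/8) * (norm x)\<^sup>2) * (2 * pi) powr (- real CARD('n) / 2)"
    by (rule mult_right_mono) simp
  then show ?thesis unfolding exp_add by (simp add: gauss_pdf_def mult_ac)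
qed

lemma gradient_measurable:
  fixes K :: "'a::euclidean_space \<Rightarrow> real"
  assumes "\<And>x. (K has_derivative K' x) (at x)"
  shows "K \<in> borel_measurable borel"
  by (rule borel_measurable_continuous_onI, rule continuous_at_imp_continuous_on)
    (use has_derivative_continuous[OF assms] in blast)

text \<open>The gradient of \<open>\<psi> * gauss_pdf\<close> is the \<open>A\<close> of the proof:
  one term differentiates \<open>\<psi>\<close>, the other brings down \<open>- x\<close>. Its
  integral in direction \<open>e\<close> vanishes by \<open>integral_gradient_eq_0\<close>.\<close>

lemma gauss_ibp:
  fixes \<psi> :: "real ^ 'n \<Rightarrow> real"
  assumes der: "\<And>x. (\<psi> has_derivative (\<lambda>h. P x \<bullet> h)) (at x)"
    and P [measurable]: "P \<in> borel_measurable borel"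
    and bd: "\<And>x. \<bar>\<psi> x\<bar> \<le> a" "\<And>x. norm (P x) \<le> b"
  shows "(LINT x|gauss. \<psi> x * (x \<bullet> e)) = (LINT x|gauss. P x \<bullet> e)"
proof -
  have a: "a \<ge> 0" using bd(1)[of 0] by simp
  have b: "b \<ge> 0" by (rule order_trans[OF norm_ge_zero bd(2)[of 0]])
  have [measurable]: "\<psi> \<in> borel_measurable borel" by (rule gradient_measurable[OF der])
  define K where "K x = \<psi> x * gauss_pdf x" for x
  define A where "A x = gauss_pdf x *\<^sub>R P x - (\<psi> x * gauss_pdf x) *\<^sub>R x" for x
  define B where "B x = (a\<^sup>2 + b + 1) * (2 * pi) powr (- real CARD('n) / 2) * exp ((norm e)\<^sup>2 / 4) * exp (- (1/8) * (norm x)\<^sup>2) * norm e"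
    for x :: "real ^ 'n"
  have intK: "integrable gauss \<psi>"
    by (rule integrable_gauss_quadratic[of _ 0 0 a]) (use bd in auto)
  have int1: "integrable gauss (\<lambda>x. \<psi> x * (x \<bullet> e))"
  proof (rule integrable_gauss_quadratic[of _ "a * norm e" 0 0])
    fix x
    have "\<bar>\<psi> x\<bar> * \<bar>x \<bullet> e\<bar> \<le> a * (norm x * norm e)"
      by (intro mult_mono bd Cauchy_Schwarz_ineq2 a) auto
    then show "norm (\<psi> x * (x \<bullet> e)) \<le> a * norm e * norm x + 0 * (norm x)\<^sup>2 + 0"
      by (simp add: abs_mult mult_ac)
  qed simp
  have int2: "integrable gauss (\<lambda>x. P x \<bullet> e)"
    by (rule integrable_gauss_quadratic[of _ 0 0 "b * norm e"])
      (auto intro: order_trans[OF Cauchy_Schwarz_ineq2 mult_right_mono[OF bd(2)]])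
  have "(LINT x|lborel. A x \<bullet> e) = 0"
  proof (rule integral_gradient_eq_0[of K _ _ B])
    show "(K has_derivative (\<lambda>h. A x \<bullet> h)) (at x)" for x
      unfolding K_def A_def
      by (auto intro!: derivative_eq_intros der gauss_pdf_has_derivative simp: inner_diff_left algebra_simps)
    show "integrable lborel K" using intK unfolding K_def
      by (subst (asm) integrable_gauss_iff) (auto simp: mult.commute)
    show "A \<in> borel_measurable borel" unfolding A_def by measurable
    show "integrable lborel B" unfolding B_def
      by (intro integrable_mult_left integrable_mult_right integrable_exp_norm_sq) auto
    fix x and t :: real assume t: "\<bar>t\<bar> < 1"
    let ?y = "x + t *\<^sub>R e"
    have "norm (A ?y) \<le> gauss_pdf ?y * norm (P ?y) + \<bar>\<psi> ?y\<bar> * gauss_pdf ?y * norm ?y"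
      unfolding A_def using norm_triangle_ineq4[of "gauss_pdf ?y *\<^sub>R P ?y" "(\<psi> ?y * gauss_pdf ?y) *\<^sub>R ?y"]
      by (simp add: abs_mult abs_of_pos[OF gauss_pdf_pos])
    also have "\<dots> \<le> gauss_pdf ?y * b + a * gauss_pdf ?y * norm ?y"
      by (intro add_mono mult_mono bd) (auto simp: a less_imp_le[OF gauss_pdf_pos])
    also have "\<dots> = (a * norm ?y + b) * gauss_pdf ?y" by (simp add: algebra_simps)
    finally have *: "norm (A ?y) \<le> (a * norm ?y + b) * gauss_pdf ?y" .
    have "\<bar>A ?y \<bullet> e\<bar> \<le> norm (A ?y) * norm e" by (rule Cauchy_Schwarz_ineq2)
    also have "\<dots> \<le> B x"
      unfolding B_def by (intro mult_right_mono order_trans[OF * gauss_pdf_shift_bound[OF t a b]]) auto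
    finally show "\<bar>A ?y \<bullet> e\<bar> \<le> B x" .
  qed
  also have "(LINT x|lborel. A x \<bullet> e) = (LINT x|lborel. gauss_pdf x *\<^sub>R (P x \<bullet> e - \<psi> x * (x \<bullet> e)))"
    by (intro Bochner_Integration.integral_cong) (auto simp: A_def inner_diff_left algebra_simps)
  also have "\<dots> = (LINT x|gauss. P x \<bullet> e - \<psi> x * (x \<bullet> e))"
    by (subst integral_gauss) auto
  also have "\<dots> = (LINT x|gauss. P x \<bullet> e) - (LINT x|gauss. \<psi> x * (x \<bullet> e))"
    using int1 int2 by simp
  finally show ?thesis by simp
qed

section \<open>Rotation invariance of the product Gaussian\<close>

lemma emeasure_lborel_translate:
  fixes c :: "'a::euclidean_space"
  assumes "B \<in> sets borel"
  shows "emeasure lborel ((\<lambda>x. x + c) -` B) = emeasure lborel B"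
proof -
  have "emeasure lborel B = emeasure (distr lborel borel ((+) c)) B" by (simp add: lborel_distr_plus)
  also have "\<dots> = emeasure lborel ((+) c -` B)" using assms by (subst emeasure_distr) auto
  also have "(+) c = (\<lambda>x. x + c)" by (auto simp: add.commute)
  finally show ?thesis by simp
qed

text \<open>For fixed \<open>z\<close> the shear translates the slice in \<open>x\<close>, so Fubini
  with \<open>z\<close> outside reduces the claim to translation invariance.
  \<open>lborel_shear_snd\<close> is the same in the other order.\<close>

lemma lborel_shear_fst:
  "distr (lborel \<Otimes>\<^sub>M lborel) (borel \<Otimes>\<^sub>M borel) (\<lambda>(x, z). (x + p *\<^sub>R z, z))
    = (lborel \<Otimes>\<^sub>M lborel :: ('a::euclidean_space \<times> 'a) measure)" (is "?D = _")
proof (rule measure_eqI)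
  show "sets ?D = sets (lborel \<Otimes>\<^sub>M lborel :: ('a \<times> 'a) measure)"
    unfolding sets_distr by (rule sets_pair_measure_cong) simp_all
  fix A assume "A \<in> sets ?D"
  then have A [measurable]: "A \<in> sets (borel \<Otimes>\<^sub>M borel :: ('a \<times> 'a) measure)" by simp
  have A': "A \<in> sets (lborel \<Otimes>\<^sub>M lborel :: ('a \<times> 'a) measure)"
    using A sets_pair_measure_cong[OF sets_lborel sets_lborel] by blast
  let ?T = "\<lambda>(x, z). (x + p *\<^sub>R z, z :: 'a)"
  have m: "?T \<in> (lborel \<Otimes>\<^sub>M lborel) \<rightarrow>\<^sub>M (borel \<Otimes>\<^sub>M borel)" by measurable
  have "emeasure ?D A = emeasure (lborel \<Otimes>\<^sub>M lborel) (?T -` A)"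
    using A m by (subst emeasure_distr) (auto simp: space_pair_measure)
  also have "\<dots> = (\<integral>\<^sup>+z. emeasure lborel ((\<lambda>x. (x, z)) -` (?T -` A)) \<partial>lborel)"
    using measurable_sets[OF m A] by (intro lborel_pair.emeasure_pair_measure_alt2) (simp add: space_pair_measure)
  also have "\<dots> = (\<integral>\<^sup>+z. emeasure lborel ((\<lambda>x. x + p *\<^sub>R z) -` ((\<lambda>x. (x, z)) -` A)) \<partial>lborel)"
    by (simp add: vimage_def)
  also have "\<dots> = (\<integral>\<^sup>+z. emeasure lborel ((\<lambda>x. (x, z)) -` A) \<partial>lborel)"
    using sets_Pair2[OF A] by (intro nn_integral_cong emeasure_lborel_translate) simp
  also have "\<dots> = emeasure (lborel \<Otimes>\<^sub>M lborel) A"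
    using A' by (intro lborel_pair.emeasure_pair_measure_alt2[symmetric])
  finally show "emeasure ?D A = emeasure (lborel \<Otimes>\<^sub>M lborel) A" .
qed

lemma lborel_shear_snd:
  "distr (lborel \<Otimes>\<^sub>M lborel) (borel \<Otimes>\<^sub>M borel) (\<lambda>(x, z). (x, z + p *\<^sub>R x))
    = (lborel \<Otimes>\<^sub>M lborel :: ('a::euclidean_space \<times> 'a) measure)" (is "?D = _")
proof (rule measure_eqI)
  show "sets ?D = sets (lborel \<Otimes>\<^sub>M lborel :: ('a \<times> 'a) measure)"
    unfolding sets_distr by (rule sets_pair_measure_cong) simp_all
  fix A assume "A \<in> sets ?D"
  then have A [measurable]: "A \<in> sets (borel \<Otimes>\<^sub>M borel :: ('a \<times> 'a) measure)" by simp
  have A': "A \<in> sets (lborel \<Otimes>\<^sub>M lborel :: ('a \<times> 'a) measure)"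
    using A sets_pair_measure_cong[OF sets_lborel sets_lborel] by blast
  let ?T = "\<lambda>(x, z). (x, z + p *\<^sub>R x :: 'a)"
  have m: "?T \<in> (lborel \<Otimes>\<^sub>M lborel) \<rightarrow>\<^sub>M (borel \<Otimes>\<^sub>M borel)" by measurable
  have "emeasure ?D A = emeasure (lborel \<Otimes>\<^sub>M lborel) (?T -` A)"
    using A m by (subst emeasure_distr) (auto simp: space_pair_measure)
  also have "\<dots> = (\<integral>\<^sup>+x. emeasure lborel (Pair x -` (?T -` A)) \<partial>lborel)"
    using measurable_sets[OF m A] by (intro lborel.emeasure_pair_measure_alt) (simp add: space_pair_measure)
  also have "\<dots> = (\<integral>\<^sup>+x. emeasure lborel ((\<lambda>z. z + p *\<^sub>R x) -` (Pair x -` A)) \<partial>lborel)"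
    by (simp add: vimage_def)
  also have "\<dots> = (\<integral>\<^sup>+x. emeasure lborel (Pair x -` A) \<partial>lborel)"
    using sets_Pair1[OF A] by (intro nn_integral_cong emeasure_lborel_translate) simp
  also have "\<dots> = emeasure (lborel \<Otimes>\<^sub>M lborel) A"
    using A' by (intro lborel.emeasure_pair_measure_alt[symmetric])
  finally show "emeasure ?D A = emeasure (lborel \<Otimes>\<^sub>M lborel) A" .
qed

text \<open>The second component is the \<open>t\<close>-derivative of the first: differentiating a
  function of the first component produces an inner product with the second, which under the
  Gaussian is independent of it.\<close>

definition rotation :: "real \<Rightarrow> 'a::real_vector \<times> 'a \<Rightarrow> 'a \<times> 'a" where
  "rotation t = (\<lambda>(x, z). (cos t *\<^sub>R x + sin t *\<^sub>R z, cos t *\<^sub>R z - sin t *\<^sub>R x))"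

lemma rotation_measurable [measurable]:
  "rotation t \<in> (borel \<Otimes>\<^sub>M borel) \<rightarrow>\<^sub>M (borel \<Otimes>\<^sub>M borel :: ('a::euclidean_space \<times> 'a) measure)"
  unfolding rotation_def by measurable

lemma rotation_inverse: "rotation (- t) (rotation t p) = p"
proof -
  have cs: "cos t * cos t + sin t * sin t = 1" using sin_cos_squared_add3[of t] by simp
  have "cos t *\<^sub>R (cos t *\<^sub>R x + sin t *\<^sub>R z) - sin t *\<^sub>R (cos t *\<^sub>R z - sin t *\<^sub>R x) = x"
    "cos t *\<^sub>R (cos t *\<^sub>R z - sin t *\<^sub>R x) + sin t *\<^sub>R (cos t *\<^sub>R x + sin t *\<^sub>R z) = z" for x z :: 'a
    using cs by (simp_all add: algebra_simps scaleR_add_left[symmetric])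
  then show ?thesis by (cases p) (simp add: rotation_def)
qed

text \<open>A rotation by an angle other than \<open>pi\<close> is a product of three shears.\<close>

lemma lborel_rotation:
  assumes "cos t \<noteq> - 1"
  shows "distr (lborel \<Otimes>\<^sub>M lborel) (borel \<Otimes>\<^sub>M borel) (rotation t)
    = (lborel \<Otimes>\<^sub>M lborel :: ('a::euclidean_space \<times> 'a) measure)"
proof -
  \<comment> \<open>This is \<open>tan (t / 2)\<close>: the rotation is a shear by \<open>p\<close>
    in \<open>x\<close>, a shear by \<open>- sin t\<close> in \<open>z\<close>, and the first shear
    again. It is finite exactly because \<open>cos t \<noteq> - 1\<close>.\<close>
  define p where "p = sin t / (1 + cos t)"
  have n: "1 + cos t \<noteq> 0" using assms by linarith
  have "sin t * sin t = (1 - cos t) * (1 + cos t)"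
    using sin_cos_squared_add3[of t] by (simp add: algebra_simps)
  then have p1: "1 - p * sin t = cos t" using n by (simp add: p_def field_simps)
  have p2: "p * (1 + cos t) = sin t" using n by (simp add: p_def)
  let ?L = "lborel \<Otimes>\<^sub>M lborel :: ('a \<times> 'a) measure" and ?B = "borel \<Otimes>\<^sub>M borel :: ('a \<times> 'a) measure"
  let ?S1 = "\<lambda>(x :: 'a, z). (x + p *\<^sub>R z, z)" and ?S2 = "\<lambda>(x :: 'a, z). (x, z + (- sin t) *\<^sub>R x)"
  have sets: "sets ?L = sets ?B" by (rule sets_pair_measure_cong) simp_all
  have m: "?S1 \<in> ?B \<rightarrow>\<^sub>M ?B" "?S2 \<in> ?B \<rightarrow>\<^sub>M ?B" "?S1 \<in> ?L \<rightarrow>\<^sub>M ?B" by measurable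
  have eq: "rotation t = ?S1 \<circ> (?S2 \<circ> ?S1)"
  proof (rule ext, clarify)
    fix x z :: 'a
    have a: "z - sin t *\<^sub>R (x + p *\<^sub>R z) = cos t *\<^sub>R z - sin t *\<^sub>R x"
      by (subst p1[symmetric]) (simp add: algebra_simps)
    have "x + p *\<^sub>R z + p *\<^sub>R (cos t *\<^sub>R z - sin t *\<^sub>R x) = (1 - p * sin t) *\<^sub>R x + (p * (1 + cos t)) *\<^sub>R z"
      by (simp add: algebra_simps)
    also have "\<dots> = cos t *\<^sub>R x + sin t *\<^sub>R z" by (simp only: p1 p2)
    finally show "rotation t (x, z) = (?S1 \<circ> (?S2 \<circ> ?S1)) (x, z)"
      using a by (simp add: rotation_def)
  qed
  have "distr ?L ?B (rotation t) = distr (distr (distr ?L ?B ?S1) ?B ?S2) ?B ?S1"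
    unfolding eq by (simp only: distr_distr[OF m(2,3)] distr_distr[OF m(1) measurable_comp[OF m(3,2)]])
  also have "distr ?L ?B ?S1 = ?L" by (rule lborel_shear_fst)
  also have "distr ?L ?B ?S2 = ?L" by (rule lborel_shear_snd)
  also have "distr ?L ?B ?S1 = ?L" by (rule lborel_shear_fst)
  finally show ?thesis .
qed

lemma gauss_pdf_rotation:
  fixes x z :: "real ^ 'n"
  shows "gauss_pdf (cos t *\<^sub>R x + sin t *\<^sub>R z) * gauss_pdf (cos t *\<^sub>R z - sin t *\<^sub>R x) = gauss_pdf x * gauss_pdf z"
proof -
  have "(norm (cos t *\<^sub>R x + sin t *\<^sub>R z))\<^sup>2 + (norm (cos t *\<^sub>R z - sin t *\<^sub>R x))\<^sup>2
    = (cos t * cos t + sin t * sin t) * (x \<bullet> x + z \<bullet> z)"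
    unfolding power2_norm_eq_inner by (simp add: inner_simps inner_commute algebra_simps del: sin_cos_squared_add3)
  also have "\<dots> = (norm x)\<^sup>2 + (norm z)\<^sup>2"
    by (simp only: sin_cos_squared_add3 power2_norm_eq_inner mult_1)
  finally have q: "(norm (cos t *\<^sub>R x + sin t *\<^sub>R z))\<^sup>2 + (norm (cos t *\<^sub>R z - sin t *\<^sub>R x))\<^sup>2
    = (norm x)\<^sup>2 + (norm z)\<^sup>2" .
  have *: "- (norm (cos t *\<^sub>R x + sin t *\<^sub>R z))\<^sup>2 / 2 + - (norm (cos t *\<^sub>R z - sin t *\<^sub>R x))\<^sup>2 / 2
    = - (norm x)\<^sup>2 / 2 + - (norm z)\<^sup>2 / 2" using q by linarith
  have g: "gauss_pdf a * gauss_pdf b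
    = ((2 * pi) powr (- real CARD('n) / 2))\<^sup>2 * exp (- (norm a)\<^sup>2 / 2 + - (norm b)\<^sup>2 / 2)" for a b :: "real ^ 'n"
    by (simp only: gauss_pdf_def exp_add) (simp add: power2_eq_square)
  show ?thesis unfolding g * ..
qed

abbreviation gauss2 :: "((real ^ 'n) \<times> (real ^ 'n)) measure" where
  "gauss2 \<equiv> gauss_measure \<Otimes>\<^sub>M gauss_measure"

lemma sets_gauss2 [simp, measurable_cong]: "sets gauss2 = sets (borel \<Otimes>\<^sub>M borel)"
  by (rule sets_pair_measure_cong) simp_all

lemma gauss_rotation:
  assumes "cos t \<noteq> - 1"
  shows "distr gauss2 (borel \<Otimes>\<^sub>M borel) (rotation t) = (gauss2 :: ((real ^ 'n) \<times> (real ^ 'n)) measure)"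
proof -
  let ?L = "lborel \<Otimes>\<^sub>M lborel :: ((real ^ 'n) \<times> (real ^ 'n)) measure"
    and ?B = "borel \<Otimes>\<^sub>M borel :: ((real ^ 'n) \<times> (real ^ 'n)) measure"
  let ?f = "\<lambda>(x, z). ennreal (gauss_pdf x) * ennreal (gauss_pdf z) :: ennreal"
  have "sigma_finite_measure (density lborel (\<lambda>x :: real ^ 'n. ennreal (gauss_pdf x)))"
    unfolding gauss_measure_eq[symmetric] ..
  then have eq: "gauss2 = density ?L ?f"
    unfolding gauss_measure_eq by (intro pair_measure_density) (auto intro: lborel.sigma_finite_measure_axioms)
  have m: "rotation t \<in> ?L \<rightarrow>\<^sub>M ?B" "?f \<in> borel_measurable ?B" by measurable
  have inv: "?f (rotation t p) = ?f p" for p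
    by (cases p) (simp add: rotation_def ennreal_mult[symmetric] gauss_pdf_rotation less_imp_le[OF gauss_pdf_pos])
  have "distr (density ?L ?f) ?B (rotation t) = distr (density ?L (\<lambda>p. ?f (rotation t p))) ?B (rotation t)"
    by (simp only: inv)
  also have "\<dots> = density (distr ?L ?B (rotation t)) ?f"
    using m by (intro density_distr[symmetric])
  finally show ?thesis unfolding eq lborel_rotation[OF assms] .
qed

lemma gauss_rotation_integral:
  fixes F :: "(real ^ 'n) \<times> (real ^ 'n) \<Rightarrow> 'b::{banach, second_countable_topology}"
  assumes "cos t \<noteq> - 1" and [measurable]: "F \<in> borel_measurable (borel \<Otimes>\<^sub>M borel)"
  shows "(LINT p|gauss2. F (rotation t p)) = (LINT p|gauss2. F p)"
proof -
  have "(LINT p|gauss2. F p) = (LINT p|distr gauss2 (borel \<Otimes>\<^sub>M borel) (rotation t). F p)"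
    by (simp only: gauss_rotation[OF assms(1)])
  also have "\<dots> = (LINT p|gauss2. F (rotation t p))" by (rule integral_distr) measurable
  finally show ?thesis by simp
qed

lemma integrable_gauss2_quadratic:
  fixes F :: "(real ^ 'n) \<times> (real ^ 'n) \<Rightarrow> 'b::{banach, second_countable_topology}"
  assumes [measurable]: "F \<in> borel_measurable (borel \<Otimes>\<^sub>M borel)"
    and bd: "\<And>x z. norm (F (x, z)) \<le> a * (norm x)\<^sup>2 + b * (norm z)\<^sup>2 + d"
  shows "integrable gauss2 F"
proof (rule Bochner_Integration.integrable_bound)
  have *: "integrable gauss (\<lambda>x::real^'n. a * (norm x)\<^sup>2)" for a
    by (rule integrable_gauss_quadratic[of _ 0 "\<bar>a\<bar>" 0]) (auto simp: abs_mult)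
  have 1: "integrable gauss2 (\<lambda>p::(real^'n) \<times> (real^'n). a * (norm (fst p))\<^sup>2)"
    by (rule gauss_pair.Fubini_integrable) (use *[of "\<bar>a\<bar>"] in \<open>auto simp: abs_mult\<close>)
  have 2: "integrable gauss2 (\<lambda>p::(real^'n) \<times> (real^'n). b * (norm (snd p))\<^sup>2)"
    by (rule gauss_pair.Fubini_integrable) (use *[of b] in \<open>auto simp: abs_mult\<close>)
  show "integrable gauss2 (\<lambda>p::(real^'n) \<times> (real^'n). a * (norm (fst p))\<^sup>2 + b * (norm (snd p))\<^sup>2 + d)"
    using 1 2 by simp
  show "AE p in gauss2. norm (F p) \<le> norm (a * (norm (fst p))\<^sup>2 + b * (norm (snd p))\<^sup>2 + d)"
    using bd by (intro AE_I2) (fastforce intro: order_trans[OF _ abs_ge_self])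
qed measurable

section \<open>The entropy along the Mehler interpolation\<close>

lemma measure_gauss_UNIV [simp]: "measure (gauss :: (real ^ 'n) measure) UNIV = 1"
  using prob_space.prob_space[OF prob_space_gauss] by simp

text \<open>The Ornstein-Uhlenbeck semigroup at time \<open>- ln (cos t)\<close>. In the angle it
  runs over a compact interval, from the identity at 0 to the mean value at
  \<open>pi / 2\<close>.\<close>

definition mehler :: "real \<Rightarrow> (real ^ 'n \<Rightarrow> 'b::{banach, second_countable_topology}) \<Rightarrow> real ^ 'n \<Rightarrow> 'b" where
  "mehler t F x = (LINT z|gauss. F (cos t *\<^sub>R x + sin t *\<^sub>R z))"

lemma mehler_measurable [measurable]:
  assumes [measurable]: "F \<in> borel_measurable borel"
  shows "mehler t F \<in> borel_measurable borel"
  unfolding mehler_def[abs_def] by (intro gauss.borel_measurable_lebesgue_integral) measurable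

lemma integrable_gauss_bounded:
  fixes F :: "real ^ 'n \<Rightarrow> 'b::{banach, second_countable_topology}"
  assumes "F \<in> borel_measurable borel" "\<And>x. norm (F x) \<le> C"
  shows "integrable gauss F"
  by (rule integrable_gauss_quadratic[of _ 0 0 C]) (use assms in auto)

lemma mehler_integrable_bounded:
  fixes F :: "real ^ 'n \<Rightarrow> 'b::{banach, second_countable_topology}"
  assumes [measurable]: "F \<in> borel_measurable borel" and "\<And>x. norm (F x) \<le> C"
  shows "integrable gauss (\<lambda>z. F (cos t *\<^sub>R x + sin t *\<^sub>R z))"
  by (rule integrable_gauss_bounded[of _ C]) (use assms in simp_all)

lemma norm_mehler_le:
  fixes F :: "real ^ 'n \<Rightarrow> 'b::{banach, second_countable_topology}"
  assumes "F \<in> borel_measurable borel" and bd: "\<And>x. norm (F x) \<le> C"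
  shows "norm (mehler t F x) \<le> C"
proof -
  have "norm (mehler t F x) \<le> (LINT z|gauss. norm (F (cos t *\<^sub>R x + sin t *\<^sub>R z)))"
    unfolding mehler_def by (rule integral_norm_bound)
  also have "\<dots> \<le> (LINT z|(gauss_measure :: (real ^ 'n) measure). C)"
    by (rule integral_mono) (use mehler_integrable_bounded[OF assms, of t x] bd in auto)
  also have "\<dots> = C" by simp
  finally show ?thesis .
qed

lemma norm_rotation_le:
  "norm (cos t *\<^sub>R x + sin t *\<^sub>R z) \<le> norm x + norm (z :: 'a::real_normed_vector)"
  "norm (cos t *\<^sub>R z - sin t *\<^sub>R x) \<le> norm x + norm z"
proof -
  have *: "norm (cos t *\<^sub>R y) \<le> norm y" "norm (sin t *\<^sub>R y) \<le> norm y" for y :: 'a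
    by (simp_all add: mult_left_le_one_le)
  show "norm (cos t *\<^sub>R x + sin t *\<^sub>R z) \<le> norm x + norm z"
    using norm_triangle_ineq[of "cos t *\<^sub>R x" "sin t *\<^sub>R z"] *(1)[of x] *(2)[of z] by linarith
  show "norm (cos t *\<^sub>R z - sin t *\<^sub>R x) \<le> norm x + norm z"
    using norm_triangle_ineq4[of "cos t *\<^sub>R z" "sin t *\<^sub>R x"] *(1)[of z] *(2)[of x] by linarith
qed

locale bounded_gradient =
  fixes g :: "real ^ 'n \<Rightarrow> real" and A :: "real ^ 'n \<Rightarrow> real ^ 'n" and C :: real
  assumes der: "\<And>x. (g has_derivative (\<lambda>h. A x \<bullet> h)) (at x)"
    and A_meas [measurable]: "A \<in> borel_measurable borel"
    and g_bd: "\<And>x. \<bar>g x\<bar> \<le> C" and A_bd: "\<And>x. norm (A x) \<le> C"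
begin

lemma C_nonneg: "0 \<le> C" using g_bd[of 0] by simp

lemma g_meas [measurable]: "g \<in> borel_measurable borel"
  by (rule gradient_measurable[OF der])

lemma g_lipschitz: "\<bar>g x - g y\<bar> \<le> C * norm (x - y)"
proof -
  have "norm (g x - g y) \<le> C * norm (x - y)"
  proof (rule differentiable_bound[of UNIV g "\<lambda>x h. A x \<bullet> h" C])
    show "onorm ((\<bullet>) (A x)) \<le> C" for x
    proof (rule onorm_bound[OF C_nonneg])
      show "norm (A x \<bullet> h) \<le> C * norm h" for h
        using Cauchy_Schwarz_ineq2[of "A x" h] mult_right_mono[OF A_bd[of x], of "norm h"] by simp
    qed
  qed (use der in \<open>simp_all add: has_derivative_at_withinI\<close>)
  then show ?thesis by simp
qed

lemma mehler_gradient: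
  "(mehler t g has_derivative (\<lambda>h. (cos t *\<^sub>R mehler t A x) \<bullet> h)) (at x)"
proof -
  have "((\<lambda>x. LINT z|gauss. g (cos t *\<^sub>R x + sin t *\<^sub>R z)) has_derivative
     (\<lambda>h. (LINT z|gauss. cos t *\<^sub>R A (cos t *\<^sub>R x + sin t *\<^sub>R z)) \<bullet> h)) (at x)"
  proof (rule has_derivative_integral(2)[where r = 1 and B = "\<lambda>z. C"])
    show "integrable gauss (\<lambda>z. g (cos t *\<^sub>R y + sin t *\<^sub>R z))" for y
      by (rule mehler_integrable_bounded[of _ C]) (use g_bd in auto)
    show "((\<lambda>x. g (cos t *\<^sub>R x + sin t *\<^sub>R z)) has_derivative
        (\<lambda>h. cos t *\<^sub>R A (cos t *\<^sub>R x + sin t *\<^sub>R z) \<bullet> h)) (at x)" for z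
    proof -
      have "((\<lambda>x. g (cos t *\<^sub>R x + sin t *\<^sub>R z)) has_derivative
        (\<lambda>h. A (cos t *\<^sub>R x + sin t *\<^sub>R z) \<bullet> (cos t *\<^sub>R h))) (at x)"
      proof (rule has_derivative_compose[where g = g and f = "\<lambda>x. cos t *\<^sub>R x + sin t *\<^sub>R z"])
        show "((\<lambda>x. cos t *\<^sub>R x + sin t *\<^sub>R z) has_derivative (\<lambda>h. cos t *\<^sub>R h)) (at x)"
          by (auto intro!: derivative_eq_intros)
      qed (rule der)
      then show ?thesis by simp
    qed
    show "norm (cos t *\<^sub>R A (cos t *\<^sub>R x + sin t *\<^sub>R z)) \<le> C" for z
    proof -
      have "\<bar>cos t\<bar> * norm (A (cos t *\<^sub>R x + sin t *\<^sub>R z)) \<le> 1 * C"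
        by (intro mult_mono A_bd abs_cos_le_one) auto
      then show ?thesis by simp
    qed
    show "\<bar>g (cos t *\<^sub>R y + sin t *\<^sub>R z) - g (cos t *\<^sub>R x + sin t *\<^sub>R z)\<bar> \<le> C * norm (y - x)" for y z
    proof -
      have "\<bar>g (cos t *\<^sub>R y + sin t *\<^sub>R z) - g (cos t *\<^sub>R x + sin t *\<^sub>R z)\<bar> \<le> C * norm (cos t *\<^sub>R (y - x))"
        using g_lipschitz[of "cos t *\<^sub>R y + sin t *\<^sub>R z" "cos t *\<^sub>R x + sin t *\<^sub>R z"]
        by (simp add: algebra_simps)
      also have "\<dots> \<le> C * norm (y - x)"
        by (intro mult_left_mono C_nonneg) (simp add: mult_left_le_one_le)
      finally show ?thesis .
    qed
  qed simp_all
  then show ?thesis unfolding mehler_def[abs_def] by simp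
qed

lemma mehler_time_derivative:
  "((\<lambda>t. mehler t g x) has_real_derivative
    (LINT z|gauss. A (cos t *\<^sub>R x + sin t *\<^sub>R z) \<bullet> (cos t *\<^sub>R z - sin t *\<^sub>R x))) (at t)"
  and mehler_time_derivative_bound:
  "\<bar>LINT z|gauss. A (cos t *\<^sub>R x + sin t *\<^sub>R z) \<bullet> (cos t *\<^sub>R z - sin t *\<^sub>R x)\<bar>
     \<le> C * (norm x + (LINT z|(gauss_measure :: (real ^ 'n) measure). norm z))"
proof -
  let ?A = "\<lambda>t z. A (cos t *\<^sub>R x + sin t *\<^sub>R z) \<bullet> (cos t *\<^sub>R z - sin t *\<^sub>R x)"
  have n: "integrable gauss (\<lambda>z :: real ^ 'n. norm z)"
    by (rule integrable_gauss_quadratic[of _ 1 0 0]) auto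
  have B: "integrable gauss (\<lambda>z :: real ^ 'n. C * (norm x + norm z))"
    using n by simp
  have bd: "\<bar>?A t z\<bar> \<le> C * (norm x + norm z)" for t z
    by (rule order_trans[OF Cauchy_Schwarz_ineq2], rule mult_mono[OF A_bd norm_rotation_le(2) C_nonneg]) simp
  show "((\<lambda>t. mehler t g x) has_real_derivative (LINT z|gauss. ?A t z)) (at t)"
    unfolding mehler_def
  proof (rule has_field_derivative_integral[where r = 1 and A = ?A, OF _ _ _ _ bd B])
    show "integrable gauss (\<lambda>z. g (cos t *\<^sub>R x + sin t *\<^sub>R z))" for t
      by (rule mehler_integrable_bounded[of _ C]) (use g_bd in auto)
    show "((\<lambda>t. g (cos t *\<^sub>R x + sin t *\<^sub>R z)) has_real_derivative ?A t z) (at t)" for t z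
    proof -
      have "((\<lambda>t. g (cos t *\<^sub>R x + sin t *\<^sub>R z)) has_derivative
        (\<lambda>h. A (cos t *\<^sub>R x + sin t *\<^sub>R z) \<bullet> (h *\<^sub>R (cos t *\<^sub>R z - sin t *\<^sub>R x)))) (at t)"
      proof (rule has_derivative_compose[where g = g and f = "\<lambda>t. cos t *\<^sub>R x + sin t *\<^sub>R z"])
        show "((\<lambda>t. cos t *\<^sub>R x + sin t *\<^sub>R z) has_derivative (\<lambda>h. h *\<^sub>R (cos t *\<^sub>R z - sin t *\<^sub>R x))) (at t)"
          by (auto intro!: derivative_eq_intros simp: algebra_simps)
      qed (rule der)
      moreover have "(\<lambda>h. A (cos t *\<^sub>R x + sin t *\<^sub>R z) \<bullet> (h *\<^sub>R (cos t *\<^sub>R z - sin t *\<^sub>R x))) = (*) (?A t z)"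
        by (auto simp: mult.commute)
      ultimately show ?thesis by (simp add: has_field_derivative_def)
    qed
  qed simp_all
  have i: "integrable gauss (?A t)"
    by (rule Bochner_Integration.integrable_bound[OF B]) (use bd in \<open>auto intro!: AE_I2 order_trans[OF bd]\<close>)
  have "\<bar>LINT z|gauss. ?A t z\<bar> \<le> (LINT z|gauss. \<bar>?A t z\<bar>)" by (rule integral_abs_bound)
  also have "\<dots> \<le> (LINT z|(gauss_measure :: (real ^ 'n) measure). C * (norm x + norm z))"
    using i B bd by (intro integral_mono) auto
  also have "\<dots> = C * (norm x + (LINT z|(gauss_measure :: (real ^ 'n) measure). norm z))"
    using n by simp
  finally show "\<bar>LINT z|gauss. ?A t z\<bar> \<le> C * (norm x + (LINT z|(gauss_measure :: (real ^ 'n) measure). norm z))" .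
qed

end

text \<open>The bounds keep the logarithm and the score bounded along the whole interpolation, so
  every derivative and every Fubini step is legitimate. \<open>C\<close> and \<open>\<kappa>\<close>
  do not enter the quantitative estimates derived below.\<close>

locale nice_density = bounded_gradient g A C for g :: "real ^ 'n \<Rightarrow> real" and A C +
  fixes \<kappa> :: real
  assumes kappa_pos: "0 < \<kappa>" and kappa_le: "\<And>x. \<kappa> \<le> g x"
    and total: "(LINT x|gauss. g x) = 1"
begin

lemma g_pos: "0 < g x" using kappa_pos kappa_le[of x] by linarith
lemma g_le: "g x \<le> C" using g_bd[of x] by simp
lemma C_pos: "0 < C" using g_pos g_le less_le_trans by blast

lemma g_int: "integrable gauss g"
  by (rule integrable_gauss_bounded[of _ C]) (use g_bd in auto)

lemma A_int: "integrable gauss A"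
  by (rule integrable_gauss_bounded[of _ C]) (use A_bd in auto)

lemma mehler_g_le: "mehler t g x \<le> C"
  using norm_mehler_le[of g C t x] g_bd by auto

lemma mehler_g_ge: "\<kappa> \<le> mehler t g x"
proof -
  have "\<kappa> = (LINT z|(gauss_measure :: (real ^ 'n) measure). \<kappa>)" by simp
  also have "\<dots> \<le> mehler t g x" unfolding mehler_def
    by (rule integral_mono) (use mehler_integrable_bounded[of g C t x] g_bd kappa_le in auto)
  finally show ?thesis .
qed

lemma mehler_g_pos: "0 < mehler t g x"
  using kappa_pos mehler_g_ge[of t x] by linarith

lemma norm_mehler_A: "norm (mehler t A x) \<le> C"
  by (rule norm_mehler_le) (use A_bd in auto)

definition "score t x = (1 / mehler t g x) *\<^sub>R mehler t A x"

lemma score_meas [measurable]: "score t \<in> borel_measurable borel"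
  unfolding score_def[abs_def] by measurable

lemma norm_score_le: "norm (score t x) \<le> C / \<kappa>"
proof -
  have "norm (score t x) = norm (mehler t A x) / mehler t g x"
    using mehler_g_pos[of t x] by (simp add: score_def)
  also have "\<dots> \<le> C / \<kappa>"
    by (rule frac_le) (use norm_mehler_A mehler_g_ge kappa_pos C_nonneg in auto)
  finally show ?thesis .
qed

definition "ent t = (LINT x|gauss. mehler t g x * ln (mehler t g x))"
definition "fisher_at t = (LINT x|gauss. (norm (mehler t A x))\<^sup>2 / mehler t g x)"

lemma abs_ln_mehler: "\<bar>ln (mehler t g x)\<bar> \<le> \<bar>ln \<kappa>\<bar> + \<bar>ln C\<bar>"
proof -
  have "ln \<kappa> \<le> ln (mehler t g x)" "ln (mehler t g x) \<le> ln C"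
    using mehler_g_ge[of t x] mehler_g_le[of t x] kappa_pos mehler_g_pos[of t x] C_pos by auto
  then show ?thesis by linarith
qed

lemma ent_derivative1:
  "(ent has_real_derivative (LINT x|gauss. (ln (mehler t g x) + 1) *
     (LINT z|gauss. A (cos t *\<^sub>R x + sin t *\<^sub>R z) \<bullet> (cos t *\<^sub>R z - sin t *\<^sub>R x)))) (at t)"
proof -
  let ?l = "\<bar>ln \<kappa>\<bar> + \<bar>ln C\<bar>"
  let ?m = "LINT z|(gauss_measure :: (real ^ 'n) measure). norm z"
  let ?A = "\<lambda>t x. (ln (mehler t g x) + 1) * (LINT z|gauss. A (cos t *\<^sub>R x + sin t *\<^sub>R z) \<bullet> (cos t *\<^sub>R z - sin t *\<^sub>R x))"
  have bd: "\<bar>?A t x\<bar> \<le> (?l + 1) * (C * (norm x + ?m))" for t x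
    unfolding abs_mult
    by (intro mult_mono mehler_time_derivative_bound) (use abs_ln_mehler[of t x] in auto)
  show ?thesis
    unfolding ent_def[abs_def]
  proof (rule has_field_derivative_integral[where r = 1 and A = ?A, OF _ _ _ _ bd])
    show "integrable gauss (\<lambda>x. mehler t g x * ln (mehler t g x))" for t
      by (rule integrable_gauss_bounded[of _ "C * ?l"])
        (auto simp: abs_mult mehler_g_pos[THEN less_imp_le] C_nonneg intro!: mult_mono mehler_g_le abs_ln_mehler)
    show "((\<lambda>t. mehler t g x * ln (mehler t g x)) has_real_derivative ?A t x) (at t)" for t x
      using mehler_g_pos[of t x]
      by (auto intro!: derivative_eq_intros mehler_time_derivative simp: field_simps)
    show "?A t \<in> borel_measurable gauss" by measurable
    show "integrable gauss (\<lambda>x::real^'n. (?l + 1) * (C * (norm x + ?m)))"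
      by (intro integrable_mult_right Bochner_Integration.integrable_add integrable_gauss_quadratic[of norm 1 0 0]) auto
  qed simp
qed

lemma ln_mehler_gradient:
  "((\<lambda>v. ln (mehler t g (a - sin t *\<^sub>R v)) + 1) has_derivative
     (\<lambda>h. (- (sin t * cos t) *\<^sub>R score t (a - sin t *\<^sub>R v)) \<bullet> h)) (at v)"
proof -
  let ?y = "a - sin t *\<^sub>R v"
  have "((\<lambda>v. mehler t g (a - sin t *\<^sub>R v)) has_derivative (\<lambda>h. (cos t *\<^sub>R mehler t A ?y) \<bullet> (- (sin t *\<^sub>R h)))) (at v)"
  proof (rule has_derivative_compose[where g = "mehler t g" and f = "\<lambda>v. a - sin t *\<^sub>R v"])
    show "((\<lambda>v. a - sin t *\<^sub>R v) has_derivative (\<lambda>h. - (sin t *\<^sub>R h))) (at v)"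
      by (auto intro!: derivative_eq_intros)
  qed (rule mehler_gradient)
  from has_derivative_add[OF has_derivative_ln[OF mehler_g_pos this] has_derivative_const]
  show ?thesis by (simp add: score_def divide_inverse mult_ac)
qed

text \<open>In the coordinates \<open>(u, v)\<close> of the rotation the first formula reads
  \<open>\<psi> (cos t u - sin t v) * (v \<bullet> A u)\<close>. With \<open>u\<close> frozen,
  \<open>v\<close> is a standard Gaussian, and integration by parts moves the factor
  \<open>v\<close> onto \<open>\<psi>\<close>, whose gradient in \<open>v\<close> is
  \<open>- sin t cos t\<close> times the score. Rotating back and averaging over \<open>z\<close>
  turns \<open>A\<close> into \<open>mehler t A\<close>.\<close>

lemma ent_derivative:
  assumes t: "cos t \<noteq> - 1"
  shows "(ent has_real_derivative (- (sin t * cos t) * fisher_at t)) (at t)"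
proof -
  let ?l = "\<bar>ln \<kappa>\<bar> + \<bar>ln C\<bar>"
  let ?c = "cos t" and ?s = "sin t"
  have cs: "?c *\<^sub>R (?c *\<^sub>R x + ?s *\<^sub>R z) - ?s *\<^sub>R (?c *\<^sub>R z - ?s *\<^sub>R x) = x" for x z :: "real ^ 'n"
    using rotation_inverse[of t "(x, z)"] by (simp add: rotation_def)
  define \<psi> where "\<psi> x = ln (mehler t g x) + 1" for x
  have \<psi>_bd: "\<bar>\<psi> x\<bar> \<le> ?l + 1" for x using abs_ln_mehler[of t x] by (auto simp: \<psi>_def)
  have [measurable]: "\<psi> \<in> borel_measurable borel" unfolding \<psi>_def[abs_def] by measurable
  define F where "F = (\<lambda>(u, v). \<psi> (?c *\<^sub>R u - ?s *\<^sub>R v) * (v \<bullet> A u))"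
  define G where "G = (\<lambda>(u, v). - (?s * ?c) * (score t (?c *\<^sub>R u - ?s *\<^sub>R v) \<bullet> A u))"
  have F_meas [measurable]: "F \<in> borel_measurable (borel \<Otimes>\<^sub>M borel)" unfolding F_def by measurable
  have G_meas [measurable]: "G \<in> borel_measurable (borel \<Otimes>\<^sub>M borel)" unfolding G_def by measurable
  have F_bd: "norm (F (u, v)) \<le> 0 * (norm u)\<^sup>2 + ((?l + 1) * C) * (norm v)\<^sup>2 + (?l + 1) * C" for u v
  proof -
    have "\<bar>F (u, v)\<bar> \<le> (?l + 1) * (norm v * C)"
      unfolding F_def split abs_mult
      by (intro mult_mono \<psi>_bd order_trans[OF Cauchy_Schwarz_ineq2] mult_mono A_bd) auto
    also have "\<dots> \<le> (?l + 1) * ((1 + (norm v)\<^sup>2) * C)"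
    proof -
      have "norm v \<le> 1 + (norm v)\<^sup>2" using zero_le_power2[of "norm v - 1"] by (simp add: power2_diff) (smt (verit) zero_le_power2)
      then show ?thesis by (intro mult_left_mono mult_right_mono C_nonneg) auto
    qed
    finally show ?thesis by (simp add: algebra_simps)
  qed
  have G_bd: "norm (G (u, v)) \<le> 0 * (norm u)\<^sup>2 + 0 * (norm v)\<^sup>2 + (C / \<kappa>) * C" for u v
  proof -
    have "\<bar>G (u, v)\<bar> \<le> (1 * 1) * ((C / \<kappa>) * C)"
      unfolding G_def split abs_mult abs_minus_cancel
      by (intro mult_mono order_trans[OF Cauchy_Schwarz_ineq2] A_bd norm_score_le)
        (use C_nonneg kappa_pos in auto)
    then show ?thesis by simp
  qed
  have iF: "integrable gauss2 F" by (rule integrable_gauss2_quadratic[OF F_meas F_bd])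
  have iG: "integrable gauss2 G" by (rule integrable_gauss2_quadratic[OF G_meas G_bd])
  have sq: "(norm x + norm z)\<^sup>2 \<le> 2 * (norm x)\<^sup>2 + 2 * (norm z)\<^sup>2" for x z :: "real ^ 'n"
    using sum_squares_bound[of "norm x" "norm z"] by (simp add: power2_sum)
  have iF': "integrable gauss2 (\<lambda>p. F (rotation t p))"
  proof (rule integrable_gauss2_quadratic[of _ "2 * ((?l + 1) * C)" "2 * ((?l + 1) * C)" "(?l + 1) * C"])
    fix x z :: "real ^ 'n"
    have "norm (F (rotation t (x, z))) \<le> ((?l + 1) * C) * (norm (?c *\<^sub>R z - ?s *\<^sub>R x))\<^sup>2 + (?l + 1) * C"
      using F_bd[of "?c *\<^sub>R x + ?s *\<^sub>R z" "?c *\<^sub>R z - ?s *\<^sub>R x"] by (simp add: rotation_def)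
    also have "\<dots> \<le> ((?l + 1) * C) * (2 * (norm x)\<^sup>2 + 2 * (norm z)\<^sup>2) + (?l + 1) * C"
      using norm_rotation_le(2)[of t z x] C_nonneg
      by (intro add_mono mult_left_mono order_trans[OF power_mono sq]) auto
    finally show "norm (F (rotation t (x, z))) \<le> 2 * ((?l + 1) * C) * (norm x)\<^sup>2 + 2 * ((?l + 1) * C) * (norm z)\<^sup>2 + (?l + 1) * C"
      by (simp add: algebra_simps)
  qed measurable
  have iG': "integrable gauss2 (\<lambda>p. G (rotation t p))"
    by (rule integrable_gauss2_quadratic[of _ 0 0 "(C / \<kappa>) * C"]) (use G_bd in \<open>auto simp: rotation_def\<close>)
  have "(LINT x|gauss. \<psi> x * (LINT z|gauss. A (?c *\<^sub>R x + ?s *\<^sub>R z) \<bullet> (?c *\<^sub>R z - ?s *\<^sub>R x)))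
      = (LINT x|gauss. LINT z|gauss. F (rotation t (x, z)))"
    by (simp add: F_def rotation_def cs inner_commute)
  also have "\<dots> = (LINT p|gauss2. F (rotation t p))" by (rule gauss_pair.integral_fst'[OF iF'])
  also have "\<dots> = (LINT p|gauss2. F p)" by (rule gauss_rotation_integral[OF t F_meas])
  also have "\<dots> = (LINT u|gauss. LINT v|gauss. F (u, v))" by (rule gauss_pair.integral_fst'[OF iF, symmetric])
  also have "\<dots> = (LINT u|gauss. LINT v|gauss. G (u, v))"
  proof (rule Bochner_Integration.integral_cong[OF refl])
    fix u :: "real ^ 'n"
    have "(LINT v|gauss. \<psi> (?c *\<^sub>R u - ?s *\<^sub>R v) * (v \<bullet> A u))
      = (LINT v|gauss. (- (?s * ?c) *\<^sub>R score t (?c *\<^sub>R u - ?s *\<^sub>R v)) \<bullet> A u)"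
    proof (rule gauss_ibp[where a = "?l + 1" and b = "C / \<kappa>"])
      show "((\<lambda>v. \<psi> (?c *\<^sub>R u - ?s *\<^sub>R v)) has_derivative
          (\<lambda>h. (- (?s * ?c) *\<^sub>R score t (?c *\<^sub>R u - ?s *\<^sub>R v)) \<bullet> h)) (at v)" for v
        unfolding \<psi>_def by (rule ln_mehler_gradient)
      show "\<bar>\<psi> (?c *\<^sub>R u - ?s *\<^sub>R v)\<bar> \<le> ?l + 1" for v by (rule \<psi>_bd)
      show "norm (- (?s * ?c) *\<^sub>R score t (?c *\<^sub>R u - ?s *\<^sub>R v)) \<le> C / \<kappa>" for v
      proof -
        have "\<bar>?s\<bar> * \<bar>?c\<bar> * norm (score t (?c *\<^sub>R u - ?s *\<^sub>R v)) \<le> 1 * 1 * (C / \<kappa>)"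
          by (intro mult_mono norm_score_le) auto
        then show ?thesis by (simp add: abs_mult)
      qed
    qed measurable
    then show "(LINT v|gauss. F (u, v)) = (LINT v|gauss. G (u, v))" by (simp add: F_def G_def)
  qed
  also have "\<dots> = (LINT p|gauss2. G p)" by (rule gauss_pair.integral_fst'[OF iG])
  also have "\<dots> = (LINT p|gauss2. G (rotation t p))" by (rule gauss_rotation_integral[OF t G_meas, symmetric])
  also have "\<dots> = (LINT x|gauss. LINT z|gauss. G (rotation t (x, z)))"
    by (rule gauss_pair.integral_fst'[OF iG', symmetric])
  also have "\<dots> = (LINT x|gauss. - (?s * ?c) * ((norm (mehler t A x))\<^sup>2 / mehler t g x))"
  proof (intro Bochner_Integration.integral_cong refl)
    fix x :: "real ^ 'n"
    have "(LINT z|gauss. G (rotation t (x, z))) = (LINT z|gauss. - (?s * ?c) * (score t x \<bullet> A (?c *\<^sub>R x + ?s *\<^sub>R z)))"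
      by (simp add: G_def rotation_def cs)
    also have "\<dots> = - (?s * ?c) * (score t x \<bullet> mehler t A x)"
      unfolding mehler_def using mehler_integrable_bounded[OF A_meas A_bd] by simp
    also have "score t x \<bullet> mehler t A x = (norm (mehler t A x))\<^sup>2 / mehler t g x"
      by (simp add: score_def power2_norm_eq_inner)
    finally show "(LINT z|gauss. G (rotation t (x, z))) = - (?s * ?c) * ((norm (mehler t A x))\<^sup>2 / mehler t g x)" .
  qed
  also have "\<dots> = - (?s * ?c) * fisher_at t" unfolding fisher_at_def by (rule integral_mult_right_zero)
  finally show ?thesis using ent_derivative1[of t] unfolding \<psi>_def by simp
qed

lemma fisher_at_0: "fisher_at 0 = (LINT x|gauss. (norm (A x))\<^sup>2 / g x)"
  by (simp add: fisher_at_def mehler_def)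

lemma ent_0: "ent 0 = (LINT x|gauss. g x * ln (g x))"
  by (simp add: ent_def mehler_def)

lemma ent_pi_half: "ent (pi / 2) = 0"
  by (simp add: ent_def mehler_def total)

text \<open>The D(t) of the overview in rotated coordinates: \<open>p\<close> is (U, V), and X is
  recovered as \<open>cos t U - sin t V\<close>.\<close>

definition "defect t = (LINT p|gauss2. g (fst p) *
  (norm ((1 / g (fst p)) *\<^sub>R A (fst p) - score t (cos t *\<^sub>R fst p - sin t *\<^sub>R snd p)))\<^sup>2)"

lemma inverse_g_le: "1 / g x \<le> 1 / \<kappa>" using kappa_le[of x] kappa_pos by (simp add: frac_le)

lemma norm_A_over_g: "norm ((1 / g x) *\<^sub>R A x) \<le> C / \<kappa>"
  using mult_mono[OF inverse_g_le[of x] A_bd[of x]] g_pos[of x] kappa_pos by (simp add: divide_inverse mult.commute)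

text \<open>Orthogonality of conditional expectation. After expanding the square, conditioning on X
  replaces \<open>A\<close> and \<open>g\<close> at U by \<open>mehler t A\<close> and
  \<open>mehler t g\<close> at X, so the cross term \<open>F2\<close> and the square term
  \<open>F3\<close> both integrate to \<open>fisher_at t\<close>.\<close>

lemma fisher_at_defect:
  assumes t: "cos t \<noteq> - 1"
  shows "fisher_at 0 - fisher_at t = defect t"
proof -
  let ?c = "cos t" and ?s = "sin t"
  have cs: "?c *\<^sub>R (?c *\<^sub>R x + ?s *\<^sub>R z) - ?s *\<^sub>R (?c *\<^sub>R z - ?s *\<^sub>R x) = x" for x z :: "real ^ 'n"
    using rotation_inverse[of t "(x, z)"] by (simp add: rotation_def)
  define F1 where "F1 = (\<lambda>p :: (real ^ 'n) \<times> (real ^ 'n). (norm (A (fst p)))\<^sup>2 / g (fst p))"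
  define F2 where "F2 = (\<lambda>p. A (fst p) \<bullet> score t (?c *\<^sub>R fst p - ?s *\<^sub>R snd p))"
  define F3 where "F3 = (\<lambda>p. g (fst p) * (norm (score t (?c *\<^sub>R fst p - ?s *\<^sub>R snd p)))\<^sup>2)"
  have m [measurable]: "F1 \<in> borel_measurable (borel \<Otimes>\<^sub>M borel)" "F2 \<in> borel_measurable (borel \<Otimes>\<^sub>M borel)"
    "F3 \<in> borel_measurable (borel \<Otimes>\<^sub>M borel)" unfolding F1_def F2_def F3_def by measurable
  have b1: "norm (F1 p) \<le> C\<^sup>2 * (1 / \<kappa>)" for p
    unfolding F1_def using mult_mono[OF power_mono[OF A_bd norm_ge_zero, of "fst p" 2] inverse_g_le[of "fst p"]] g_pos[of "fst p"]
    by simp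
  have b2: "norm (F2 p) \<le> C * (C / \<kappa>)" for p
    unfolding F2_def real_norm_def
    by (rule order_trans[OF Cauchy_Schwarz_ineq2], rule mult_mono[OF A_bd norm_score_le C_nonneg]) simp
  have b3: "norm (F3 p) \<le> C * (C / \<kappa>)\<^sup>2" for p
    unfolding F3_def norm_mult norm_power using g_bd[of "fst p"] C_nonneg
    by (intro mult_mono power_mono) (auto intro: norm_score_le)
  have i: "integrable gauss2 F1" "integrable gauss2 F2" "integrable gauss2 F3"
    using integrable_gauss2_quadratic[of F1 0 0 "C\<^sup>2 * (1 / \<kappa>)"] integrable_gauss2_quadratic[of F2 0 0 "C * (C / \<kappa>)"]
      integrable_gauss2_quadratic[of F3 0 0 "C * (C / \<kappa>)\<^sup>2"] b1 b2 b3 m by auto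
  have i': "integrable gauss2 (\<lambda>p. F2 (rotation t p))" "integrable gauss2 (\<lambda>p. F3 (rotation t p))"
    using integrable_gauss2_quadratic[of "\<lambda>p. F2 (rotation t p)" 0 0 "C * (C / \<kappa>)"]
      integrable_gauss2_quadratic[of "\<lambda>p. F3 (rotation t p)" 0 0 "C * (C / \<kappa>)\<^sup>2"] b2 b3 by auto
  have e1: "(LINT p|gauss2. F1 p) = fisher_at 0"
    unfolding gauss_pair.integral_fst'[OF i(1), symmetric] fisher_at_0 by (simp add: F1_def)
  have e2: "(LINT p|gauss2. F2 p) = fisher_at t"
  proof -
    have "(LINT p|gauss2. F2 p) = (LINT x|gauss. LINT z|gauss. F2 (rotation t (x, z)))"
      unfolding gauss_rotation_integral[OF t m(2), symmetric] gauss_pair.integral_fst'[OF i'(1), symmetric] ..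
    also have "\<dots> = (LINT x|gauss. mehler t A x \<bullet> score t x)"
      unfolding mehler_def[of t A] using mehler_integrable_bounded[OF A_meas A_bd] by (simp add: F2_def rotation_def cs)
    also have "\<dots> = fisher_at t" unfolding fisher_at_def
      by (intro Bochner_Integration.integral_cong refl) (simp add: score_def power2_norm_eq_inner)
    finally show ?thesis .
  qed
  have e3: "(LINT p|gauss2. F3 p) = fisher_at t"
  proof -
    have "(LINT p|gauss2. F3 p) = (LINT x|gauss. LINT z|gauss. F3 (rotation t (x, z)))"
      unfolding gauss_rotation_integral[OF t m(3), symmetric] gauss_pair.integral_fst'[OF i'(2), symmetric] ..
    also have "\<dots> = (LINT x|gauss. mehler t g x * (norm (score t x))\<^sup>2)"
      unfolding mehler_def[of t g] by (simp add: F3_def rotation_def cs)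
    also have "\<dots> = fisher_at t" unfolding fisher_at_def
      by (intro Bochner_Integration.integral_cong refl)
        (use mehler_g_pos in \<open>auto simp add: score_def power_divide power2_eq_square less_imp_neq[symmetric]\<close>)
    finally show ?thesis .
  qed
  have "defect t = (LINT p|gauss2. F1 p - 2 * F2 p + F3 p)"
    unfolding defect_def
  proof (intro Bochner_Integration.integral_cong refl)
    fix p :: "(real ^ 'n) \<times> (real ^ 'n)"
    let ?m = "score t (?c *\<^sub>R fst p - ?s *\<^sub>R snd p)"
    have g: "g (fst p) \<noteq> 0" using g_pos[of "fst p"] by simp
    have "(norm ((1 / g (fst p)) *\<^sub>R A (fst p) - ?m))\<^sup>2
      = (1 / g (fst p))\<^sup>2 * (norm (A (fst p)))\<^sup>2 - 2 * (1 / g (fst p)) * (A (fst p) \<bullet> ?m) + (norm ?m)\<^sup>2"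
      unfolding power2_norm_eq_inner by (simp add: inner_diff inner_commute power2_eq_square)
    then show "g (fst p) * (norm ((1 / g (fst p)) *\<^sub>R A (fst p) - ?m))\<^sup>2 = F1 p - 2 * F2 p + F3 p"
      using g unfolding F1_def F2_def F3_def by (simp add: field_simps power2_eq_square)
  qed
  also have "\<dots> = fisher_at 0 - 2 * fisher_at t + fisher_at t"
    using i by (simp add: e1 e2 e3)
  finally show ?thesis by simp
qed

lemma defect_nonneg: "0 \<le> defect t"
  unfolding defect_def by (rule Bochner_Integration.integral_nonneg) (simp add: g_pos less_imp_le)

definition "deficit = fisher_at 0 / 2 - ent 0"

text \<open>Mean value theorem for \<open>k t = sin\<^sup>2 t / 2 I - (H(g) - H(Q\<^sub>t g))\<close>, which increases from \<open>0\<close> to the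
  deficit on \<open>[0, pi/2]\<close> and has derivative \<open>sin t cos t D(t)\<close>.\<close>

lemma deficit_defect:
  obtains t where "pi / 6 < t" "t < pi / 3" "defect t \<le> 10 * deficit"
proof -
  define k where "k t = (sin t)\<^sup>2 / 2 * fisher_at 0 - ent 0 + ent t" for t
  have k: "(k has_real_derivative (sin t * cos t * defect t)) (at t)" if "cos t \<noteq> - 1" for t
  proof -
    have "(k has_real_derivative (sin t * cos t * fisher_at 0 + - (sin t * cos t) * fisher_at t)) (at t)"
      unfolding k_def using that
      by (auto intro!: derivative_eq_intros ent_derivative)
    then show ?thesis by (simp add: fisher_at_defect[OF that, symmetric] algebra_simps)
  qed
  have cos: "cos t \<noteq> - 1" if "0 \<le> t" "t \<le> pi / 2" for t
    using cos_ge_zero[of t] that by auto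
  have mono: "k a \<le> k b" if "0 \<le> a" "a \<le> b" "b \<le> pi / 2" for a b
  proof (rule DERIV_nonneg_imp_nondecreasing[OF that(2)])
    fix x assume x: "a \<le> x" "x \<le> b"
    have "0 \<le> sin x * cos x * defect x"
      using x that by (intro mult_nonneg_nonneg defect_nonneg sin_ge_zero cos_ge_zero) auto
    then show "\<exists>y. (k has_real_derivative y) (at x) \<and> 0 \<le> y"
      using k[OF cos[of x]] x that by auto
  qed
  have k0: "k 0 = 0" by (simp add: k_def)
  have k1: "k (pi / 2) = deficit" by (simp add: k_def deficit_def ent_pi_half)
  have "\<exists>t>pi / 6. t < pi / 3 \<and> k (pi / 3) - k (pi / 6) = (pi / 3 - pi / 6) * (sin t * cos t * defect t)"
  proof (rule MVT2)
    show "(k has_real_derivative sin x * cos x * defect x) (at x)" if "pi / 6 \<le> x" "x \<le> pi / 3" for x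
    proof (rule k[OF cos])
      show "0 \<le> x" "x \<le> pi / 2" using that pi_gt_zero by linarith+
    qed
  qed simp
  then obtain t where t: "pi / 6 < t" "t < pi / 3"
    "k (pi / 3) - k (pi / 6) = (pi / 6) * (sin t * cos t * defect t)" by auto
  have "k (pi / 3) - k (pi / 6) \<le> deficit"
    using mono[of 0 "pi / 6"] mono[of "pi / 3" "pi / 2"] k0 k1 pi_gt_zero by simp
  \<comment> \<open>The weight \<open>sin t * cos t\<close> is at least 1/4 here. With the interval
    length pi/6 this gives pi/24 > 1/10, the origin of the factor 10.\<close>
  moreover have "1 / 2 \<le> sin t" "1 / 2 \<le> cos t"
    using sin_monotone_2pi_le[of "pi / 6" t] cos_monotone_0_pi_le[of t "pi / 3"] t
    by (auto simp: sin_30 cos_60)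
  then have "1 / 2 * (1 / 2) \<le> sin t * cos t" by (intro mult_mono) auto
  then have "(1 / 4) * defect t \<le> sin t * cos t * defect t"
    by (intro mult_right_mono defect_nonneg) simp
  then have "(pi / 6) * ((1 / 4) * defect t) \<le> (pi / 6) * (sin t * cos t * defect t)"
    by (intro mult_left_mono) auto
  moreover have "(1 / 10) * defect t \<le> (pi / 6) * ((1 / 4) * defect t)"
    using mult_right_mono[of "1 / 10" "pi / 24" "defect t"] pi_gt3 defect_nonneg[of t] by simp
  ultimately have "defect t \<le> 10 * deficit" using t(3) by linarith
  then show thesis using that t by blast
qed

text \<open>The Gaussian logarithmic Sobolev inequality for regular densities: ten times the deficit
  dominates a nonnegative defect.\<close>

lemma deficit_nonneg: "0 \<le> deficit"
  using deficit_defect defect_nonneg by (metis order_trans zero_le_mult_iff not_numeral_le_zero)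

end

section \<open>Almost constant score\<close>

lemma cball_sets_borel [measurable]: "cball (a :: 'a::metric_space) r \<in> sets borel"
  by (simp add: borel_closed)

lemma gauss_pdf_antimono:
  fixes x y :: "real ^ 'n"
  shows "norm x \<le> norm y \<Longrightarrow> gauss_pdf y \<le> gauss_pdf x"
  unfolding gauss_pdf_def by (intro mult_left_mono) (auto intro!: power_mono)

text \<open>The Jacobian \<open>s ^ DIM\<close> of the substitution is at most 1 and is
  dropped.\<close>

lemma nn_integral_affine_le:
  fixes F :: "'a::euclidean_space \<Rightarrow> ennreal"
  assumes [measurable]: "F \<in> borel_measurable borel" and "0 < s" "s \<le> 1"
  shows "(\<integral>\<^sup>+x. F x \<partial>lborel) \<le> (\<integral>\<^sup>+v. F (a - s *\<^sub>R v) \<partial>lborel)"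
proof -
  have "(\<integral>\<^sup>+x. F x \<partial>lborel) = (\<integral>\<^sup>+x. F x \<partial>(density (distr lborel borel (\<lambda>x. a + (- s) *\<^sub>R x)) (\<lambda>_. \<bar>- s\<bar> ^ DIM('a))))"
    using assms by (subst lborel_affine[of "- s" a]) auto
  also have "\<dots> = (\<integral>\<^sup>+v. ennreal (s ^ DIM('a)) * F (a - s *\<^sub>R v) \<partial>lborel)"
    using assms(2) by (subst nn_integral_density) (auto simp: nn_integral_distr)
  also have "\<dots> \<le> (\<integral>\<^sup>+v. 1 * F (a - s *\<^sub>R v) \<partial>lborel)"
    using assms(2,3) by (intro nn_integral_mono mult_right_mono) (auto simp: ennreal_le_1 power_le_one)
  finally show ?thesis by simp
qed

text \<open>A minorization: for \<open>|u| \<le> R\<close> the law of \<open>c u - s V\<close> has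
  density at least \<open>gauss_pdf w\<close> on the unit ball. Indeed
  \<open>|c u - s v| \<le> 1\<close> and \<open>s \<ge> 1/2\<close> force
  \<open>|v| \<le> 2 (1 + R)\<close>; only the norm of \<open>w\<close> matters.\<close>

lemma nn_integral_gauss_minorant:
  fixes F :: "real ^ 'n \<Rightarrow> ennreal" and u w :: "real ^ 'n"
  assumes [measurable]: "F \<in> borel_measurable borel" and s: "1 / 2 \<le> s" "s \<le> 1" and c: "\<bar>c\<bar> \<le> 1"
    and u: "norm u \<le> R" and w: "norm w = 2 * (1 + R)"
  shows "ennreal (gauss_pdf w) * (\<integral>\<^sup>+x\<in>cball 0 1. F x \<partial>lborel) \<le> (\<integral>\<^sup>+v. F (c *\<^sub>R u - s *\<^sub>R v) \<partial>gauss)"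
proof -
  have "ennreal (gauss_pdf w) * (\<integral>\<^sup>+x\<in>cball 0 1. F x \<partial>lborel)
    \<le> ennreal (gauss_pdf w) * (\<integral>\<^sup>+v. F (c *\<^sub>R u - s *\<^sub>R v) * indicator (cball 0 1) (c *\<^sub>R u - s *\<^sub>R v) \<partial>lborel)"
  proof (intro mult_left_mono nn_integral_affine_le)
    show "(\<lambda>x. F x * indicator (cball 0 1) x) \<in> borel_measurable borel" by measurable
  qed (use s in auto)
  also have "\<dots> = (\<integral>\<^sup>+v. ennreal (gauss_pdf w) * (F (c *\<^sub>R u - s *\<^sub>R v) * indicator (cball 0 1) (c *\<^sub>R u - s *\<^sub>R v)) \<partial>lborel)"
    by (subst nn_integral_cmult) auto
  also have "\<dots> \<le> (\<integral>\<^sup>+v. ennreal (gauss_pdf v) * F (c *\<^sub>R u - s *\<^sub>R v) \<partial>lborel)"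
  proof (rule nn_integral_mono)
    fix v :: "real ^ 'n"
    show "ennreal (gauss_pdf w) * (F (c *\<^sub>R u - s *\<^sub>R v) * indicator (cball 0 1) (c *\<^sub>R u - s *\<^sub>R v))
      \<le> ennreal (gauss_pdf v) * F (c *\<^sub>R u - s *\<^sub>R v)"
    proof (cases "norm (c *\<^sub>R u - s *\<^sub>R v) \<le> 1")
      case True
      have "(1 / 2) * norm v \<le> norm (s *\<^sub>R v)" using s mult_right_mono[OF s(1), of "norm v"] by simp
      also have "\<dots> \<le> norm (c *\<^sub>R u) + norm (c *\<^sub>R u - s *\<^sub>R v)"
        using norm_triangle_ineq4[of "c *\<^sub>R u" "c *\<^sub>R u - s *\<^sub>R v"] by simp
      also have "norm (c *\<^sub>R u) \<le> 1 * R" unfolding norm_scaleR using c u by (intro mult_mono) auto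
      finally have "norm v \<le> norm w" using True w by simp
      then have "gauss_pdf w \<le> gauss_pdf v" by (rule gauss_pdf_antimono)
      then show ?thesis using True by (auto intro!: mult_right_mono ennreal_leI)
    qed (simp add: indicator_def)
  qed
  also have "\<dots> = (\<integral>\<^sup>+v. F (c *\<^sub>R u - s *\<^sub>R v) \<partial>gauss)" by (subst nn_integral_gauss) auto
  finally show ?thesis .
qed

abbreviation gauss_mom1 :: "'n::finite itself \<Rightarrow> real" where
  "gauss_mom1 n \<equiv> (LINT v|(gauss :: (real ^ 'n) measure). norm v)"

abbreviation gauss_mom2 :: "'n::finite itself \<Rightarrow> real" where
  "gauss_mom2 n \<equiv> (LINT v|(gauss :: (real ^ 'n) measure). (norm v)\<^sup>2)"

lemma integrable_gauss_norm2: "integrable gauss (\<lambda>v :: real ^ 'n. (norm v)\<^sup>2)"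
  by (rule integrable_gauss_quadratic[of _ 0 1 0]) auto

section \<open>Fisher information at positive angles and freezing of the score\<close>

context nice_density
begin

text \<open>The noise pays for the gradient: integration by parts in \<open>z\<close> writes
  \<open>sin t\<close> times \<open>mehler t A x\<close> as the average of \<open>g z\<close>.
  Testing with the score and absorbing half of the result bounds the integrand by 4 times the
  average of \<open>g |z|^2\<close>, since \<open>sin t \<ge> 1/2\<close>. In rotated coordinates
  \<open>z = sin t u + cos t v\<close>, which brings in the second moments and another factor
  2.\<close>

lemma fisher_at_le:
  assumes t: "pi / 6 < t" "t < pi / 3" and M: "(LINT x|gauss. g x * (norm x)\<^sup>2) \<le> M"
  shows "fisher_at t \<le> 8 * (M + gauss_mom2 TYPE('n))"
proof -
  let ?c = "cos t" and ?s = "sin t"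
  have s: "1 / 2 \<le> ?s" using sin_monotone_2pi_le[of "pi / 6" t] t by (simp add: sin_30)
  then have s0: "?s > 0" by linarith
  have t1: "?c \<noteq> - 1" using cos_ge_zero[of t] t by auto
  define F where "F = (\<lambda>(u :: real ^ 'n, v). g u * (norm (?s *\<^sub>R u + ?c *\<^sub>R v))\<^sup>2)"
  have F_meas [measurable]: "F \<in> borel_measurable (borel \<Otimes>\<^sub>M borel)" unfolding F_def by measurable
  have sq: "(norm (?s *\<^sub>R u + ?c *\<^sub>R v))\<^sup>2 \<le> 2 * (norm u)\<^sup>2 + 2 * (norm v)\<^sup>2" for u v :: "real ^ 'n"
  proof -
    \<comment> \<open>The complementary angle exchanges sine and cosine, so the norm estimate for
      rotations applies.\<close>
    have "(norm (?s *\<^sub>R u + ?c *\<^sub>R v))\<^sup>2 \<le> (norm u + norm v)\<^sup>2"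
      using norm_rotation_le(1)[of "pi / 2 - t" u v] by (intro power_mono) (simp_all add: cos_diff sin_diff)
    then show ?thesis using sum_squares_bound[of "norm u" "norm v"] by (simp add: power2_sum)
  qed
  have cs: "?s *\<^sub>R (?c *\<^sub>R x + ?s *\<^sub>R z) + ?c *\<^sub>R (?c *\<^sub>R z - ?s *\<^sub>R x) = z" for x z :: "real ^ 'n"
    using rotation_inverse[of t "(x, z)"] by (simp add: rotation_def add.commute)
  have gM: "integrable gauss (\<lambda>x. g x * (norm x)\<^sup>2)"
    by (rule integrable_gauss_quadratic[of _ 0 C 0]) (use g_bd in \<open>auto simp: abs_mult intro!: mult_right_mono\<close>)
  have iF: "integrable gauss2 F"
  proof (rule integrable_gauss2_quadratic[OF F_meas, of "2 * C" "2 * C" 0])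
    fix u v
    have "norm (F (u, v)) = g u * (norm (?s *\<^sub>R u + ?c *\<^sub>R v))\<^sup>2"
      using g_pos[of u] by (simp add: F_def)
    also have "\<dots> \<le> C * (2 * (norm u)\<^sup>2 + 2 * (norm v)\<^sup>2)"
      by (intro mult_mono g_le sq C_nonneg) simp
    finally show "norm (F (u, v)) \<le> 2 * C * (norm u)\<^sup>2 + 2 * C * (norm v)\<^sup>2 + 0" by (simp add: algebra_simps)
  qed
  have eF: "F (rotation t (x, z)) = g (?c *\<^sub>R x + ?s *\<^sub>R z) * (norm z)\<^sup>2" for x z
    by (simp add: F_def rotation_def cs)
  have iF': "integrable gauss2 (\<lambda>p. F (rotation t p))"
    by (rule integrable_gauss2_quadratic[of _ 0 C 0])
      (use g_bd in \<open>auto simp: eF abs_mult intro!: mult_right_mono\<close>)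
  have pt: "(norm (mehler t A x))\<^sup>2 / mehler t g x \<le> 4 * (LINT z|gauss. F (rotation t (x, z)))" for x
  proof -
    define m where "m = score t x"
    have Am: "mehler t A x = mehler t g x *\<^sub>R m" using mehler_g_pos[of t x] by (simp add: m_def score_def)
    have i1: "integrable gauss (\<lambda>z. g (?c *\<^sub>R x + ?s *\<^sub>R z) * (norm z)\<^sup>2)"
      by (rule integrable_gauss_quadratic[of _ 0 C 0]) (use g_bd in \<open>auto simp: abs_mult intro!: mult_right_mono\<close>)
    have i2: "integrable gauss (\<lambda>z. g (?c *\<^sub>R x + ?s *\<^sub>R z))"
      by (rule mehler_integrable_bounded[of _ C]) (use g_bd in auto)
    have i3: "integrable gauss (\<lambda>z. g (?c *\<^sub>R x + ?s *\<^sub>R z) * (z \<bullet> m))"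
    proof (rule integrable_gauss_quadratic[of _ "C * norm m" 0 0])
      fix z
      have "\<bar>g (?c *\<^sub>R x + ?s *\<^sub>R z)\<bar> * \<bar>z \<bullet> m\<bar> \<le> C * (norm z * norm m)"
        by (intro mult_mono g_bd Cauchy_Schwarz_ineq2 C_nonneg) auto
      then show "norm (g (?c *\<^sub>R x + ?s *\<^sub>R z) * (z \<bullet> m)) \<le> C * norm m * norm z + 0 * (norm z)\<^sup>2 + 0"
        by (simp add: abs_mult mult_ac)
    qed simp
    have "(LINT z|gauss. g (?c *\<^sub>R x + ?s *\<^sub>R z) * (z \<bullet> m)) = (LINT z|gauss. (?s *\<^sub>R A (?c *\<^sub>R x + ?s *\<^sub>R z)) \<bullet> m)"
    proof (rule gauss_ibp[where a = C and b = "\<bar>?s\<bar> * C"])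
      show "((\<lambda>z. g (?c *\<^sub>R x + ?s *\<^sub>R z)) has_derivative (\<lambda>h. (?s *\<^sub>R A (?c *\<^sub>R x + ?s *\<^sub>R z)) \<bullet> h)) (at z)" for z
      proof -
        have "((\<lambda>z. g (?c *\<^sub>R x + ?s *\<^sub>R z)) has_derivative (\<lambda>h. A (?c *\<^sub>R x + ?s *\<^sub>R z) \<bullet> (?s *\<^sub>R h))) (at z)"
        proof (rule has_derivative_compose[where g = g and f = "\<lambda>z. ?c *\<^sub>R x + ?s *\<^sub>R z"])
          show "((\<lambda>z. ?c *\<^sub>R x + ?s *\<^sub>R z) has_derivative (\<lambda>h. ?s *\<^sub>R h)) (at z)"
            by (auto intro!: derivative_eq_intros)
        qed (rule der)
        then show ?thesis by simp
      qed
    qed (use g_bd in \<open>auto simp: intro!: mult_left_mono A_bd\<close>)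
    also have "\<dots> = ?s * (mehler t g x * (norm m)\<^sup>2)"
      using mehler_integrable_bounded[OF A_meas A_bd, of t x]
      by (simp add: mehler_def[of t A, symmetric] Am power2_norm_eq_inner)
    finally have e: "(LINT z|gauss. g (?c *\<^sub>R x + ?s *\<^sub>R z) * (z \<bullet> m)) = ?s * (mehler t g x * (norm m)\<^sup>2)" .
    \<comment> \<open>Young's inequality for \<open>z \<bullet> m\<close>, weighted so that the term
      in \<open>|m|^2\<close> is exactly half of the left side and can be absorbed.\<close>
    have "(LINT z|gauss. g (?c *\<^sub>R x + ?s *\<^sub>R z) * (z \<bullet> m))
      \<le> (LINT z|gauss. (1 / (2 * ?s)) * (g (?c *\<^sub>R x + ?s *\<^sub>R z) * (norm z)\<^sup>2) + (?s / 2 * (norm m)\<^sup>2) * g (?c *\<^sub>R x + ?s *\<^sub>R z))"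
    proof (rule integral_mono)
      fix z :: "real ^ 'n"
      have "0 \<le> (norm z - ?s * norm m)\<^sup>2" by simp
      then have "2 * ?s * (norm z * norm m) \<le> (norm z)\<^sup>2 + ?s\<^sup>2 * (norm m)\<^sup>2"
        by (simp add: power2_eq_square algebra_simps)
      then have "norm z * norm m \<le> ((norm z)\<^sup>2 + ?s\<^sup>2 * (norm m)\<^sup>2) / (2 * ?s)"
        using s0 by (simp add: pos_le_divide_eq mult_ac)
      also have "\<dots> = (1 / (2 * ?s)) * (norm z)\<^sup>2 + ?s / 2 * (norm m)\<^sup>2"
        using s0 by (simp add: field_simps power2_eq_square)
      finally have "z \<bullet> m \<le> (1 / (2 * ?s)) * (norm z)\<^sup>2 + ?s / 2 * (norm m)\<^sup>2"
        using norm_cauchy_schwarz[of z m] by linarith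
      then have "g (?c *\<^sub>R x + ?s *\<^sub>R z) * (z \<bullet> m) \<le> g (?c *\<^sub>R x + ?s *\<^sub>R z) * ((1 / (2 * ?s)) * (norm z)\<^sup>2 + ?s / 2 * (norm m)\<^sup>2)"
        by (intro mult_left_mono less_imp_le[OF g_pos])
      then show "g (?c *\<^sub>R x + ?s *\<^sub>R z) * (z \<bullet> m)
        \<le> (1 / (2 * ?s)) * (g (?c *\<^sub>R x + ?s *\<^sub>R z) * (norm z)\<^sup>2) + (?s / 2 * (norm m)\<^sup>2) * g (?c *\<^sub>R x + ?s *\<^sub>R z)"
        by (simp add: algebra_simps)
    qed (use i1 i2 i3 in simp_all)
    also have "\<dots> = (1 / (2 * ?s)) * (LINT z|gauss. F (rotation t (x, z))) + ?s / 2 * (norm m)\<^sup>2 * mehler t g x"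
      using i1 i2 by (simp add: eF mehler_def[symmetric])
    finally have "?s / 2 * (mehler t g x * (norm m)\<^sup>2) \<le> (1 / (2 * ?s)) * (LINT z|gauss. F (rotation t (x, z)))"
      unfolding e by (simp add: algebra_simps)
    then have "2 * ?s * (?s / 2 * (mehler t g x * (norm m)\<^sup>2)) \<le> 2 * ?s * ((1 / (2 * ?s)) * (LINT z|gauss. F (rotation t (x, z))))"
      using s0 by (intro mult_left_mono) auto
    then have "?s\<^sup>2 * (mehler t g x * (norm m)\<^sup>2) \<le> (LINT z|gauss. F (rotation t (x, z)))"
      using s0 by (simp add: power2_eq_square mult.assoc)
    moreover have "(1 / 2)\<^sup>2 * (mehler t g x * (norm m)\<^sup>2) \<le> ?s\<^sup>2 * (mehler t g x * (norm m)\<^sup>2)"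
      using s mehler_g_pos[of t x] by (intro mult_right_mono power_mono) auto
    moreover have "(norm (mehler t A x))\<^sup>2 / mehler t g x = mehler t g x * (norm m)\<^sup>2"
      using mehler_g_pos[of t x] by (simp add: Am power_mult_distrib power2_eq_square)
    ultimately show ?thesis by (simp add: power2_eq_square)
  qed
  have "fisher_at t \<le> (LINT x|gauss. 4 * (LINT z|gauss. F (rotation t (x, z))))"
    unfolding fisher_at_def
  proof (rule integral_mono[OF _ _ pt])
    show "integrable gauss (\<lambda>x. (norm (mehler t A x))\<^sup>2 / mehler t g x)"
    proof (rule integrable_gauss_bounded[of _ "C\<^sup>2 / \<kappa>"])
      fix x
      have "norm ((norm (mehler t A x))\<^sup>2 / mehler t g x) = (norm (mehler t A x))\<^sup>2 / mehler t g x"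
        using mehler_g_pos[of t x] by simp
      also have "\<dots> \<le> C\<^sup>2 / \<kappa>"
        by (intro frac_le power_mono norm_mehler_A mehler_g_ge kappa_pos) auto
      finally show "norm ((norm (mehler t A x))\<^sup>2 / mehler t g x) \<le> C\<^sup>2 / \<kappa>" .
    qed simp
    show "integrable gauss (\<lambda>x. 4 * (LINT z|gauss. F (rotation t (x, z))))"
      using gauss_pair.integrable_fst'[OF iF'] by simp
  qed
  also have "\<dots> = 4 * (LINT p|gauss2. F p)"
    using gauss_pair.integral_fst'[OF iF'] gauss_rotation_integral[OF t1 F_meas] by simp
  also have "(LINT p|gauss2. F p) = (LINT u|gauss. LINT v|gauss. F (u, v))"
    by (rule gauss_pair.integral_fst'[OF iF, symmetric])
  also have "\<dots> \<le> (LINT u|gauss. 2 * (g u * (norm u)\<^sup>2) + 2 * gauss_mom2 TYPE('n) * g u)"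
  proof (rule integral_mono)
    fix u
    have iu: "integrable gauss (\<lambda>v. F (u, v))"
    proof (rule integrable_gauss_quadratic[of _ 0 "2 * C" "2 * C * (norm u)\<^sup>2"])
      fix v
      have "norm (F (u, v)) = g u * (norm (?s *\<^sub>R u + ?c *\<^sub>R v))\<^sup>2"
        using g_pos[of u] by (simp add: F_def)
      also have "\<dots> \<le> C * (2 * (norm u)\<^sup>2 + 2 * (norm v)\<^sup>2)"
        by (intro mult_mono g_le sq C_nonneg) simp
      finally show "norm (F (u, v)) \<le> 0 * norm v + 2 * C * (norm v)\<^sup>2 + 2 * C * (norm u)\<^sup>2" by (simp add: algebra_simps)
    qed measurable
    have "(LINT v|gauss. F (u, v)) \<le> (LINT v|(gauss :: (real ^ 'n) measure). 2 * g u * (norm u)\<^sup>2 + 2 * g u * (norm v)\<^sup>2)"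
    proof (rule integral_mono[OF iu])
      show "integrable gauss (\<lambda>v :: real ^ 'n. 2 * g u * (norm u)\<^sup>2 + 2 * g u * (norm v)\<^sup>2)"
        by (intro Bochner_Integration.integrable_add integrable_mult_right integrable_gauss_norm2) simp
      show "F (u, v) \<le> 2 * g u * (norm u)\<^sup>2 + 2 * g u * (norm v)\<^sup>2" for v
        using mult_left_mono[OF sq[of u v] less_imp_le[OF g_pos[of u]]] by (simp add: F_def algebra_simps)
    qed
    also have "\<dots> = 2 * (g u * (norm u)\<^sup>2) + 2 * gauss_mom2 TYPE('n) * g u"
      by (subst Bochner_Integration.integral_add)
        (auto intro!: integrable_mult_right integrable_gauss_norm2)
    finally show "(LINT v|gauss. F (u, v)) \<le> 2 * (g u * (norm u)\<^sup>2) + 2 * gauss_mom2 TYPE('n) * g u" .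
  qed (use gauss_pair.integrable_fst'[OF iF] gM g_int in simp_all)
  also have "\<dots> = 2 * (LINT x|gauss. g x * (norm x)\<^sup>2) + 2 * gauss_mom2 TYPE('n)"
    using gM g_int total by simp
  finally show ?thesis using M by simp
qed

text \<open>The Fisher information at angle 0 exceeds that at angle \<open>t\<close> by the defect,
  and \<open>t\<close> is taken where the defect is controlled.\<close>

lemma fisher_le:
  assumes "(LINT x|gauss. g x * (norm x)\<^sup>2) \<le> M"
  shows "fisher_at 0 \<le> 10 * deficit + 8 * (M + gauss_mom2 TYPE('n))"
proof -
  obtain t where t: "pi / 6 < t" "t < pi / 3" "defect t \<le> 10 * deficit" by (rule deficit_defect)
  have "cos t \<noteq> - 1" using cos_ge_zero[of t] t by auto
  from fisher_at_defect[OF this] fisher_at_le[OF t(1,2) assms] t(3) show ?thesis by linarith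
qed

lemma score_almost_constant:
  fixes w :: "real ^ 'n"
  assumes d: "deficit < d" and w: "norm w = 2 * (1 + R)"
  obtains m where "(LINT u|gauss. indicator (cball 0 R) u * (g u * (norm ((1 / g u) *\<^sub>R A u - m))\<^sup>2))
     \<le> 10 * d / (gauss_pdf w * measure lborel (cball (0 :: real ^ 'n) 1))"
proof -
  obtain t where t: "pi / 6 < t" "t < pi / 3" "defect t \<le> 10 * deficit" by (rule deficit_defect)
  let ?c = "cos t" and ?s = "sin t"
  have s: "1 / 2 \<le> ?s" using sin_monotone_2pi_le[of "pi / 6" t] t by (simp add: sin_30)
  define V where "V = measure lborel (cball (0 :: real ^ 'n) 1)"
  have V: "V > 0" unfolding V_def by (simp add: content_cball_pos)
  have eV: "emeasure lborel (cball (0 :: real ^ 'n) 1) = ennreal V"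
    unfolding V_def by (rule emeasure_eq_ennreal_measure) (use emeasure_bounded_finite[of "cball (0 :: real ^ 'n) 1"] in \<open>auto simp: less_top\<close>)
  have d0: "d > 0" using d deficit_nonneg by linarith
  define f where "f u x = g u * (norm ((1 / g u) *\<^sub>R A u - score t x))\<^sup>2" for u x
  have f_meas [measurable]: "(\<lambda>(u, x). f u x) \<in> borel_measurable (borel \<Otimes>\<^sub>M borel)"
    unfolding f_def by measurable
  have f_nn: "0 \<le> f u x" for u x unfolding f_def using g_pos[of u] by simp
  have f_bd: "f u x \<le> C * (C / \<kappa> + C / \<kappa>)\<^sup>2" for u x
    unfolding f_def
    by (intro mult_mono power_mono order_trans[OF norm_triangle_ineq4] add_mono norm_A_over_g norm_score_le g_le C_nonneg) auto
  define J where "J x = (\<integral>\<^sup>+u\<in>cball 0 R. ennreal (f u x) \<partial>gauss)" for x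
  have J_meas [measurable]: "J \<in> borel_measurable borel"
    unfolding J_def by (intro gauss.borel_measurable_nn_integral) measurable
  have "ennreal (gauss_pdf w) * (\<integral>\<^sup>+x\<in>cball 0 1. J x \<partial>lborel)
    = ennreal (gauss_pdf w) * (\<integral>\<^sup>+x. \<integral>\<^sup>+u. ennreal (f u x) * indicator (cball 0 R) u * indicator (cball 0 1) x \<partial>gauss \<partial>lborel)"
    unfolding J_def by (subst nn_integral_multc) auto
  also have "\<dots> = ennreal (gauss_pdf w) * (\<integral>\<^sup>+u. \<integral>\<^sup>+x. ennreal (f u x) * indicator (cball 0 R) u * indicator (cball 0 1) x \<partial>lborel \<partial>gauss)"
  proof -
    have "pair_sigma_finite (gauss :: (real ^ 'n) measure) (lborel :: (real ^ 'n) measure)" ..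
    then show ?thesis
      by (subst pair_sigma_finite.Fubini') auto
  qed
  also have "\<dots> = (\<integral>\<^sup>+u. indicator (cball 0 R) u * (ennreal (gauss_pdf w) * (\<integral>\<^sup>+x\<in>cball 0 1. ennreal (f u x) \<partial>lborel)) \<partial>gauss)"
    by (subst nn_integral_cmult[symmetric], measurable, intro nn_integral_cong)
      (auto simp: indicator_def)
  also have "\<dots> \<le> (\<integral>\<^sup>+u. (\<integral>\<^sup>+v. ennreal (f u (?c *\<^sub>R u - ?s *\<^sub>R v)) \<partial>gauss) \<partial>gauss)"
  proof (rule nn_integral_mono)
    fix u :: "real ^ 'n"
    show "indicator (cball 0 R) u * (ennreal (gauss_pdf w) * (\<integral>\<^sup>+x\<in>cball 0 1. ennreal (f u x) \<partial>lborel))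
      \<le> (\<integral>\<^sup>+v. ennreal (f u (?c *\<^sub>R u - ?s *\<^sub>R v)) \<partial>gauss)"
      using nn_integral_gauss_minorant[of "\<lambda>x. ennreal (f u x)" ?s ?c u R w] s w
      by (cases "norm u \<le> R") (auto simp: indicator_def)
  qed
  also have "\<dots> = (\<integral>\<^sup>+p. ennreal (f (fst p) (?c *\<^sub>R fst p - ?s *\<^sub>R snd p)) \<partial>gauss2)"
    by (subst gauss.nn_integral_fst[symmetric]) auto
  also have "\<dots> = ennreal (defect t)"
    unfolding defect_def f_def[symmetric]
    by (rule nn_integral_eq_integral, rule integrable_gauss2_quadratic[of _ 0 0 "C * (C / \<kappa> + C / \<kappa>)\<^sup>2"])
      (use f_nn f_bd in auto)
  \<comment> \<open>Strict because \<open>deficit < d\<close>. This lets the contradiction below run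
    on weak inequalities between integrals.\<close>
  also have "\<dots> < ennreal (10 * d)" using t(3) d d0 by (intro ennreal_lessI) auto
  finally have less: "ennreal (gauss_pdf w) * (\<integral>\<^sup>+x\<in>cball 0 1. J x \<partial>lborel) < ennreal (10 * d)" .
  \<comment> \<open>An averaging argument over the unit ball, whose volume is \<open>V\<close>:
    \<open>J\<close> cannot exceed the bound everywhere. The constant vector is then
    \<open>score t x\<close> at such a point \<open>x\<close>.\<close>
  have "\<exists>x\<in>cball 0 1. J x \<le> ennreal (10 * d / (gauss_pdf w * V))"
  proof (rule ccontr)
    assume "\<not> ?thesis"
    then have ge: "ennreal (10 * d / (gauss_pdf w * V)) \<le> J x" if "x \<in> cball 0 1" for x
      using that by (meson less_le not_le)
    have "ennreal (10 * d) = ennreal (gauss_pdf w) * (ennreal (10 * d / (gauss_pdf w * V)) * ennreal V)"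
      using V gauss_pdf_pos[of w] d0 by (simp add: ennreal_mult[symmetric])
    also have "ennreal (10 * d / (gauss_pdf w * V)) * ennreal V
        = (\<integral>\<^sup>+x\<in>cball (0 :: real ^ 'n) 1. ennreal (10 * d / (gauss_pdf w * V)) \<partial>lborel)"
      by (simp add: nn_integral_cmult_indicator eV)
    also have "\<dots> \<le> (\<integral>\<^sup>+x\<in>cball 0 1. J x \<partial>lborel)"
      by (intro nn_integral_mono) (use ge in \<open>auto simp: indicator_def\<close>)
    finally show False using less by (auto simp: mult_left_mono)
  qed
  then obtain x where x: "J x \<le> ennreal (10 * d / (gauss_pdf w * V))" by blast
  have "J x = (\<integral>\<^sup>+u. ennreal (indicator (cball 0 R) u * f u x) \<partial>gauss)"
    unfolding J_def by (intro nn_integral_cong) (auto simp: indicator_def)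
  also have "\<dots> = ennreal (LINT u|gauss. indicator (cball 0 R) u * f u x)"
  proof (rule nn_integral_eq_integral)
    show "integrable gauss (\<lambda>u. indicator (cball 0 R) u * f u x)"
      by (rule integrable_gauss_bounded[of _ "C * (C / \<kappa> + C / \<kappa>)\<^sup>2"])
        (use f_nn f_bd order_trans[OF f_nn f_bd] in \<open>auto simp: indicator_def\<close>)
  qed (use f_nn in auto)
  finally have "(LINT u|gauss. indicator (cball 0 R) u * f u x) \<le> 10 * d / (gauss_pdf w * V)"
    using x V gauss_pdf_pos[of w] d0 by (simp add: ennreal_le_iff)
  then show thesis using that unfolding f_def V_def by blast
qed

end

section \<open>From an almost constant score to closeness in L1\<close>

context nice_density
begin

lemma integral_A: "(LINT x|gauss. A x) = (LINT x|gauss. g x *\<^sub>R x)"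
proof (rule euclidean_eqI)
  fix e :: "real ^ 'n"
  have gx: "integrable gauss (\<lambda>x. g x *\<^sub>R x)"
    by (rule integrable_gauss_quadratic[of _ C 0 0]) (use g_bd in \<open>auto intro!: mult_right_mono\<close>)
  have "(LINT x|gauss. A x) \<bullet> e = (LINT x|gauss. A x \<bullet> e)"
    using A_int by simp
  also have "\<dots> = (LINT x|gauss. g x * (x \<bullet> e))"
    by (rule gauss_ibp[OF der A_meas g_bd A_bd, symmetric])
  also have "\<dots> = (LINT x|gauss. g x *\<^sub>R x) \<bullet> e"
    using integral_inner_left[OF gx, of e] by simp
  finally show "(LINT x|gauss. A x) \<bullet> e = (LINT x|gauss. g x *\<^sub>R x) \<bullet> e" .
qed

text \<open>Split \<open>A\<close> into its part outside the ball, its deviation from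
  \<open>g m\<close> inside, and \<open>I g m\<close>. The last has a constant direction, so its L1
  norm is the norm of its integral; writing it as \<open>A\<close> minus the other two parts bounds
  it by the mean of \<open>g\<close> plus the norms of those parts. This is why \<open>?a\<close>
  and \<open>?b\<close> count twice.\<close>

lemma gradient_L1_le:
  fixes w :: "real ^ 'n"
  assumes M: "(LINT x|gauss. g x * (norm x)\<^sup>2) \<le> M" and d: "deficit < d"
    and R: "R > 0" and w: "norm w = 2 * (1 + R)"
  shows "(LINT x|gauss. norm (A x)) \<le> norm (LINT x|gauss. g x *\<^sub>R x) + (fisher_at 0 + M) / R
    + 2 * sqrt (10 * d / (gauss_pdf w * measure lborel (cball (0 :: real ^ 'n) 1)))"
proof -
  define K where "K = 10 * d / (gauss_pdf w * measure lborel (cball (0 :: real ^ 'n) 1))"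
  have K: "K > 0" unfolding K_def using d deficit_nonneg gauss_pdf_pos[of w]
    by (intro divide_pos_pos mult_pos_pos) (auto simp: content_cball_pos)
  \<comment> \<open>The weight that balances the two halves of Young's inequality in
    \<open>b\<close>: \<open>\<eta> / 2 + K / (2 \<eta>) = \<eta>\<close>.\<close>
  define \<eta> where "\<eta> = sqrt K"
  have \<eta>: "\<eta> > 0" "K / \<eta> = \<eta>" using K by (auto simp: \<eta>_def real_div_sqrt)
  define I where "I = (indicator (cball 0 R) :: real ^ 'n \<Rightarrow> real)"
  have I_meas [measurable]: "I \<in> borel_measurable borel" unfolding I_def by measurable
  have I01: "0 \<le> I u" "I u \<le> 1" for u unfolding I_def by (auto simp: indicator_def)
  obtain m where m: "(LINT u|gauss. I u * (g u * (norm ((1 / g u) *\<^sub>R A u - m))\<^sup>2)) \<le> K"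
    using score_almost_constant[OF d w] unfolding K_def I_def by blast
  have gM: "integrable gauss (\<lambda>x. g x * (norm x)\<^sup>2)"
    by (rule integrable_gauss_quadratic[of _ 0 C 0]) (use g_bd in \<open>auto simp: abs_mult intro!: mult_right_mono\<close>)
  have fi: "integrable gauss (\<lambda>x. (norm (A x))\<^sup>2 / g x)"
  proof (rule integrable_gauss_bounded[of _ "C\<^sup>2 / \<kappa>"])
    fix x
    have "norm ((norm (A x))\<^sup>2 / g x) = (norm (A x))\<^sup>2 / g x" using g_pos[of x] by simp
    also have "\<dots> \<le> C\<^sup>2 / \<kappa>"
      by (intro frac_le power_mono A_bd kappa_le kappa_pos) auto
    finally show "norm ((norm (A x))\<^sup>2 / g x) \<le> C\<^sup>2 / \<kappa>" .
  qed simp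
  have bdy: "norm ((1 / g u) *\<^sub>R A u - m) \<le> C / \<kappa> + norm m" for u
    by (rule order_trans[OF norm_triangle_ineq4 add_right_mono[OF norm_A_over_g]])
  have i1: "integrable gauss (\<lambda>u. I u * (g u * (norm ((1 / g u) *\<^sub>R A u - m))\<^sup>2))"
  proof (rule integrable_gauss_bounded[of _ "1 * (C * (C / \<kappa> + norm m)\<^sup>2)"])
    show "norm (I u * (g u * (norm ((1 / g u) *\<^sub>R A u - m))\<^sup>2)) \<le> 1 * (C * (C / \<kappa> + norm m)\<^sup>2)" for u
      unfolding norm_mult norm_power
      by (intro mult_mono power_mono) (use I01[of u] g_bd[of u] C_nonneg bdy[of u] in auto)
  qed measurable
  have i2: "integrable gauss (\<lambda>u. norm (A u))" using A_int by simp
  have i3: "integrable gauss (\<lambda>u. (1 - I u) *\<^sub>R A u)"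
  proof (rule integrable_gauss_bounded[of _ "1 * C"])
    show "norm ((1 - I u) *\<^sub>R A u) \<le> 1 * C" for u
      unfolding norm_scaleR by (intro mult_mono A_bd) (use I01[of u] in auto)
  qed measurable
  have Ay: "A u - g u *\<^sub>R m = g u *\<^sub>R ((1 / g u) *\<^sub>R A u - m)" for u
    using g_pos[of u] by (simp add: scaleR_diff_right)
  have i4: "integrable gauss (\<lambda>u. I u *\<^sub>R (A u - g u *\<^sub>R m))"
  proof (rule integrable_gauss_bounded[of _ "1 * (C * (C / \<kappa> + norm m))"])
    show "norm (I u *\<^sub>R (A u - g u *\<^sub>R m)) \<le> 1 * (C * (C / \<kappa> + norm m))" for u
      unfolding norm_scaleR Ay using I01[of u] g_bd[of u] C_nonneg bdy[of u] 
      by (intro mult_mono) auto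
  qed measurable
  have i5: "integrable gauss (\<lambda>u. I u * g u)"
  proof (rule integrable_gauss_bounded[of _ "1 * C"])
    show "norm (I u * g u) \<le> 1 * C" for u
      unfolding norm_mult by (intro mult_mono) (use I01[of u] g_bd in auto)
  qed measurable
  let ?a = "LINT u|gauss. norm ((1 - I u) *\<^sub>R A u)"
  let ?b = "LINT u|gauss. norm (I u *\<^sub>R (A u - g u *\<^sub>R m))"
  let ?c = "LINT u|gauss. I u * g u"
  have a: "?a \<le> (fisher_at 0 + M) / (2 * R)"
  proof -
    have "?a \<le> (LINT u|gauss. (1 / (2 * R)) * ((norm (A u))\<^sup>2 / g u + g u * (norm u)\<^sup>2))"
    proof (rule integral_mono)
      fix u
      have nn: "0 \<le> (norm (A u))\<^sup>2 / g u + g u * (norm u)\<^sup>2" using g_pos[of u] by simp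
      show "norm ((1 - I u) *\<^sub>R A u) \<le> (1 / (2 * R)) * ((norm (A u))\<^sup>2 / g u + g u * (norm u)\<^sup>2)"
      proof (cases "norm u \<le> R")
        case True
        then show ?thesis using R nn by (simp add: I_def)
      next
        case False
        \<comment> \<open>Outside the ball one inserts \<open>|u| / R \<ge> 1\<close>; the product
          \<open>|A u| |u|\<close> splits into the Fisher integrand and the second moment
          integrand.\<close>
        have "0 \<le> (norm (A u) - g u * norm u)\<^sup>2" by simp
        then have "2 * (norm (A u) * norm u) * g u \<le> (norm (A u))\<^sup>2 + (g u * (norm u)\<^sup>2) * g u"
          by (simp add: power2_eq_square algebra_simps)
        then have "2 * (norm (A u) * norm u) \<le> ((norm (A u))\<^sup>2 + (g u * (norm u)\<^sup>2) * g u) / g u"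
          using g_pos[of u] by (simp add: pos_le_divide_eq)
        also have "\<dots> = (norm (A u))\<^sup>2 / g u + g u * (norm u)\<^sup>2"
          using g_pos[of u] by (simp add: add_divide_distrib)
        finally have "2 * (norm (A u) * norm u) \<le> (norm (A u))\<^sup>2 / g u + g u * (norm u)\<^sup>2" .
        moreover have "norm (A u) * R \<le> norm (A u) * norm u" using False by (intro mult_left_mono) auto
        ultimately have "norm (A u) * (2 * R) \<le> (norm (A u))\<^sup>2 / g u + g u * (norm u)\<^sup>2" by linarith
        then have "norm (A u) \<le> ((norm (A u))\<^sup>2 / g u + g u * (norm u)\<^sup>2) / (2 * R)"
          using R by (simp add: pos_le_divide_eq)
        then show ?thesis using False by (simp add: I_def)
      qed
    qed (use integrable_norm[OF i3] fi gM in simp_all)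
    also have "\<dots> = (1 / (2 * R)) * (fisher_at 0 + (LINT x|gauss. g x * (norm x)\<^sup>2))"
      unfolding fisher_at_0 using fi gM by simp
    also have "\<dots> \<le> (1 / (2 * R)) * (fisher_at 0 + M)" using M R by (intro mult_left_mono) auto
    finally show ?thesis by simp
  qed
  have b: "?b \<le> \<eta>"
  proof -
    have "?b \<le> (LINT u|gauss. \<eta> / 2 * g u + (1 / (2 * \<eta>)) * (I u * (g u * (norm ((1 / g u) *\<^sub>R A u - m))\<^sup>2)))"
    proof (rule integral_mono)
      fix u
      let ?y = "norm ((1 / g u) *\<^sub>R A u - m)"
      have "0 \<le> (\<eta> - ?y)\<^sup>2" by simp
      then have "?y * (2 * \<eta>) \<le> \<eta>\<^sup>2 + ?y\<^sup>2" by (simp add: power2_eq_square algebra_simps)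
      then have "?y \<le> (\<eta>\<^sup>2 + ?y\<^sup>2) / (2 * \<eta>)" using \<eta> by (simp add: pos_le_divide_eq)
      also have "\<dots> = \<eta> / 2 + (1 / (2 * \<eta>)) * ?y\<^sup>2" using \<eta> by (simp add: add_divide_distrib power2_eq_square)
      finally have y: "?y \<le> \<eta> / 2 + (1 / (2 * \<eta>)) * ?y\<^sup>2" .
      have "norm (I u *\<^sub>R (A u - g u *\<^sub>R m)) = (I u * g u) * ?y"
        unfolding norm_scaleR Ay using I01[of u] g_pos[of u] by simp
      also have "\<dots> \<le> (I u * g u) * (\<eta> / 2 + (1 / (2 * \<eta>)) * ?y\<^sup>2)"
        using I01[of u] g_pos[of u] by (intro mult_left_mono y) simp
      also have "\<dots> = \<eta> / 2 * (I u * g u) + (1 / (2 * \<eta>)) * (I u * (g u * ?y\<^sup>2))"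
        by (simp add: algebra_simps)
      also have "\<dots> \<le> \<eta> / 2 * (1 * g u) + (1 / (2 * \<eta>)) * (I u * (g u * ?y\<^sup>2))"
        using I01[of u] g_pos[of u] \<eta> by (intro add_right_mono mult_left_mono mult_right_mono) auto
      finally show "norm (I u *\<^sub>R (A u - g u *\<^sub>R m)) \<le> \<eta> / 2 * g u + (1 / (2 * \<eta>)) * (I u * (g u * ?y\<^sup>2))"
        by simp
    qed (use integrable_norm[OF i4] i1 g_int in simp_all)
    also have "\<dots> = \<eta> / 2 + (1 / (2 * \<eta>)) * (LINT u|gauss. I u * (g u * (norm ((1 / g u) *\<^sub>R A u - m))\<^sup>2))"
      using i1 g_int total by simp
    also have "\<dots> \<le> \<eta> / 2 + (1 / (2 * \<eta>)) * K" using m \<eta> by (intro add_left_mono mult_left_mono) auto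
    also have "(1 / (2 * \<eta>)) * K = (K / \<eta>) / 2" by simp
    finally show ?thesis using \<eta>(2) by simp
  qed
  have c: "?c * norm m \<le> norm (LINT x|gauss. g x *\<^sub>R x) + ?a + ?b"
  proof -
    have c0: "0 \<le> ?c" by (rule Bochner_Integration.integral_nonneg) (use I01 g_pos in \<open>simp add: less_imp_le\<close>)
    have "?c *\<^sub>R m = (LINT u|gauss. (I u * g u) *\<^sub>R m)" using i5 by simp
    also have "\<dots> = (LINT u|gauss. A u - (1 - I u) *\<^sub>R A u - I u *\<^sub>R (A u - g u *\<^sub>R m))"
      by (simp add: algebra_simps)
    also have "\<dots> = (LINT u|gauss. A u) - (LINT u|gauss. (1 - I u) *\<^sub>R A u) - (LINT u|gauss. I u *\<^sub>R (A u - g u *\<^sub>R m))"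
      using A_int i3 i4 by simp
    finally have "norm (?c *\<^sub>R m) \<le> norm (LINT u|gauss. A u) + norm (LINT u|gauss. (1 - I u) *\<^sub>R A u)
        + norm (LINT u|gauss. I u *\<^sub>R (A u - g u *\<^sub>R m))"
      by (smt (verit) norm_triangle_ineq4)
    also have "\<dots> \<le> norm (LINT u|gauss. A u) + ?a + ?b"
      by (intro add_mono integral_norm_bound) simp
    finally show ?thesis using c0 by (simp add: integral_A)
  qed
  have "(LINT x|gauss. norm (A x)) \<le> (LINT u|gauss. norm ((1 - I u) *\<^sub>R A u) + norm (I u *\<^sub>R (A u - g u *\<^sub>R m)) + (I u * g u) * norm m)"
  proof (rule integral_mono)
    fix u
    have "A u = (1 - I u) *\<^sub>R A u + I u *\<^sub>R (A u - g u *\<^sub>R m) + (I u * g u) *\<^sub>R m" by (simp add: algebra_simps)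
    then have "norm (A u) \<le> norm ((1 - I u) *\<^sub>R A u) + norm (I u *\<^sub>R (A u - g u *\<^sub>R m)) + norm ((I u * g u) *\<^sub>R m)"
      by (metis norm_triangle_ineq norm_triangle_mono order_refl)
    then show "norm (A u) \<le> norm ((1 - I u) *\<^sub>R A u) + norm (I u *\<^sub>R (A u - g u *\<^sub>R m)) + (I u * g u) * norm m"
      using I01[of u] g_pos[of u] by (simp add: abs_mult)
  qed (use i2 integrable_norm[OF i3] integrable_norm[OF i4] i5 in simp_all)
  also have "\<dots> = ?a + ?b + ?c * norm m" using integrable_norm[OF i3] integrable_norm[OF i4] i5 by simp
  also have "\<dots> \<le> norm (LINT x|gauss. g x *\<^sub>R x) + 2 * ?a + 2 * ?b" using c by linarith
  also have "\<dots> \<le> norm (LINT x|gauss. g x *\<^sub>R x) + (fisher_at 0 + M) / R + 2 * \<eta>"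
    using a b by simp
  finally show ?thesis unfolding \<eta>_def K_def .
qed

text \<open>Maurey--Pisier interpolation: freeze the sign \<open>\<sigma>\<close> of \<open>g(Z) - g(X)\<close> and differentiate
  \<open>E[\<sigma> g(cos t X + sin t Z)]\<close> in \<open>t\<close>.\<close>

lemma L1_poincare:
  "(LINT x|gauss. \<bar>g x - 1\<bar>) \<le> pi / 2 * (gauss_mom1 TYPE('n) * (LINT x|gauss. norm (A x)))"
proof -
  let ?P = "\<lambda>t (p :: (real ^ 'n) \<times> (real ^ 'n)). cos t *\<^sub>R fst p + sin t *\<^sub>R snd p"
  let ?V = "\<lambda>t (p :: (real ^ 'n) \<times> (real ^ 'n)). cos t *\<^sub>R snd p - sin t *\<^sub>R fst p"
  define \<sigma> where "\<sigma> p = sgn (g (snd p) - g (fst p))" for p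
  have \<sigma>: "\<bar>\<sigma> p\<bar> \<le> 1" for p unfolding \<sigma>_def by (simp add: sgn_if)
  have \<sigma>_meas [measurable]: "\<sigma> \<in> borel_measurable (borel \<Otimes>\<^sub>M borel)" unfolding \<sigma>_def[abs_def] by measurable
  define k where "k t = (LINT p|gauss2. \<sigma> p * g (?P t p))" for t
  define k' where "k' t = (LINT p|gauss2. \<sigma> p * (A (?P t p) \<bullet> ?V t p))" for t
  have ik: "integrable gauss2 (\<lambda>p. \<sigma> p * g (?P t p))" for t
  proof (rule integrable_gauss2_quadratic[of _ 0 0 "1 * C"])
    show "norm (\<sigma> (x, z) * g (?P t (x, z))) \<le> 0 * (norm x)\<^sup>2 + 0 * (norm z)\<^sup>2 + 1 * C" for x z
      unfolding norm_mult using mult_mono[OF \<sigma> g_bd] by simp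
  qed measurable
  have bd: "\<bar>\<sigma> p * (A (?P t p) \<bullet> ?V t p)\<bar> \<le> C * (norm (fst p) + norm (snd p))" for t p
  proof -
    have "\<bar>\<sigma> p * (A (?P t p) \<bullet> ?V t p)\<bar> \<le> 1 * (C * (norm (fst p) + norm (snd p)))"
      unfolding abs_mult
      by (intro mult_mono \<sigma> order_trans[OF Cauchy_Schwarz_ineq2] A_bd norm_rotation_le C_nonneg) auto
    then show ?thesis by simp
  qed
  have k_der: "(k has_real_derivative k' t) (at t)" for t
    unfolding k_def k'_def
  proof (rule has_field_derivative_integral[where r = 1 and A = "\<lambda>t p. \<sigma> p * (A (?P t p) \<bullet> ?V t p)", OF _ ik _ _ bd])
    show "((\<lambda>t. \<sigma> p * g (?P t p)) has_real_derivative \<sigma> p * (A (?P t p) \<bullet> ?V t p)) (at t)" for t p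
    proof -
      have "((\<lambda>t. g (?P t p)) has_derivative (\<lambda>h. A (?P t p) \<bullet> (h *\<^sub>R ?V t p))) (at t)"
      proof (rule has_derivative_compose[where g = g and f = "\<lambda>t. ?P t p"])
        show "((\<lambda>t. ?P t p) has_derivative (\<lambda>h. h *\<^sub>R ?V t p)) (at t)"
          by (auto intro!: derivative_eq_intros simp: algebra_simps)
      qed (rule der)
      moreover have "(\<lambda>h. A (?P t p) \<bullet> (h *\<^sub>R ?V t p)) = (*) (A (?P t p) \<bullet> ?V t p)"
        by (auto simp: mult.commute)
      ultimately have "((\<lambda>t. g (?P t p)) has_real_derivative A (?P t p) \<bullet> ?V t p) (at t)"
        by (simp add: has_field_derivative_def)
      from DERIV_cmult[OF this] show ?thesis .
    qed
    show "integrable gauss2 (\<lambda>p :: (real ^ 'n) \<times> (real ^ 'n). C * (norm (fst p) + norm (snd p)))"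
    proof (rule integrable_gauss2_quadratic[of _ C C "2 * C"])
      fix x z :: "real ^ 'n"
      have *: "r \<le> r\<^sup>2 + 1" for r :: real using sum_squares_bound[of r "1 / 2"] by (simp add: power2_eq_square)
      have "C * (norm x + norm z) \<le> C * (((norm x)\<^sup>2 + 1) + ((norm z)\<^sup>2 + 1))"
        by (intro mult_left_mono add_mono * C_nonneg)
      then show "norm (C * (norm (fst (x, z)) + norm (snd (x, z)))) \<le> C * (norm x)\<^sup>2 + C * (norm z)\<^sup>2 + 2 * C"
        using C_nonneg by (simp add: algebra_simps)
    qed measurable
    show "(\<lambda>p. \<sigma> p * (A (?P t p) \<bullet> ?V t p)) \<in> borel_measurable gauss2" by measurable
  qed simp
  let ?B = "gauss_mom1 TYPE('n) * (LINT x|gauss. norm (A x))"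
  have k'_le: "k' t \<le> ?B" if t: "cos t \<noteq> - 1" for t
  proof -
    \<comment> \<open>After the rotation the two arguments are independent, so the majorant
      factorizes into a Gaussian moment and the L1 norm of \<open>A\<close>, with the same value for
      every angle.\<close>
    define F where "F = (\<lambda>(u, v :: real ^ 'n). norm (A u) * norm v)"
    have F_meas [measurable]: "F \<in> borel_measurable (borel \<Otimes>\<^sub>M borel)" unfolding F_def by measurable
    have F_bd: "norm (F (u, v)) \<le> 0 * (norm u)\<^sup>2 + C * (norm v)\<^sup>2 + C" for u v
    proof -
      have *: "r \<le> r\<^sup>2 + 1" for r :: real using sum_squares_bound[of r "1 / 2"] by (simp add: power2_eq_square)
      have "norm (A u) * norm v \<le> C * ((norm v)\<^sup>2 + 1)" by (intro mult_mono A_bd * C_nonneg) simp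
      then show ?thesis by (simp add: F_def algebra_simps)
    qed
    have iF: "integrable gauss2 F" by (rule integrable_gauss2_quadratic[OF F_meas F_bd])
    have iF': "integrable gauss2 (\<lambda>p. F (rotation t p))"
    proof -
      have "integrable (distr gauss2 (borel \<Otimes>\<^sub>M borel) (rotation t)) F" using iF by (simp only: gauss_rotation[OF t])
      then show ?thesis by (subst (asm) integrable_distr_eq) measurable
    qed
    have "k' t \<le> (LINT p|gauss2. F (rotation t p))"
      unfolding k'_def
    proof (rule integral_mono[OF _ iF'])
      show le: "\<sigma> p * (A (?P t p) \<bullet> ?V t p) \<le> F (rotation t p)" for p
      proof -
        have "\<bar>\<sigma> p * (A (?P t p) \<bullet> ?V t p)\<bar> \<le> 1 * (norm (A (?P t p)) * norm (?V t p))"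
          unfolding abs_mult by (intro mult_mono \<sigma> Cauchy_Schwarz_ineq2) auto
        then show ?thesis by (cases p) (auto simp: F_def rotation_def)
      qed
      have le': "\<bar>\<sigma> p * (A (?P t p) \<bullet> ?V t p)\<bar> \<le> \<bar>F (rotation t p)\<bar>" for p
      proof -
        have "\<bar>\<sigma> p * (A (?P t p) \<bullet> ?V t p)\<bar> \<le> 1 * (norm (A (?P t p)) * norm (?V t p))"
          unfolding abs_mult by (intro mult_mono \<sigma> Cauchy_Schwarz_ineq2) auto
        then show ?thesis by (cases p) (auto simp: F_def rotation_def)
      qed
      show "integrable gauss2 (\<lambda>p. \<sigma> p * (A (?P t p) \<bullet> ?V t p))"
        by (rule Bochner_Integration.integrable_bound[OF iF']) (measurable, intro AE_I2, use le' in simp)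
    qed
    also have "\<dots> = (LINT p|gauss2. F p)" by (rule gauss_rotation_integral[OF t F_meas])
    also have "\<dots> = (LINT u|gauss. LINT v|gauss. F (u, v))" by (rule gauss_pair.integral_fst'[OF iF, symmetric])
    also have "\<dots> = ?B" by (simp add: F_def)
    finally show ?thesis .
  qed
  have "\<exists>t>0. t < pi / 2 \<and> k (pi / 2) - k 0 = (pi / 2 - 0) * k' t"
    by (rule MVT2) (simp_all add: k_der)
  then obtain t where t: "0 < t" "t < pi / 2" "k (pi / 2) - k 0 = pi / 2 * k' t" by auto
  have "cos t \<noteq> - 1" using cos_ge_zero[of t] t by auto
  from k'_le[OF this] have le: "k (pi / 2) - k 0 \<le> pi / 2 * ?B"
    unfolding t(3) by (intro mult_left_mono) auto
  have iabs: "integrable gauss2 (\<lambda>(x, z). \<bar>g z - g x\<bar>)"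
  proof (rule integrable_gauss2_quadratic[of _ 0 0 "2 * C"])
    show "norm (case (x, z) of (x, z) \<Rightarrow> \<bar>g z - g x\<bar>) \<le> 0 * (norm x)\<^sup>2 + 0 * (norm z)\<^sup>2 + 2 * C" for x z
      using g_bd[of x] g_bd[of z] by simp
  qed measurable
  have "k (pi / 2) - k 0 = (LINT p|gauss2. \<sigma> p * g (?P (pi / 2) p) - \<sigma> p * g (?P 0 p))"
    unfolding k_def using ik[of "pi / 2"] ik[of 0] by simp
  also have "\<dots> = (LINT p|gauss2. (case p of (x, z) \<Rightarrow> \<bar>g z - g x\<bar>))"
    by (intro Bochner_Integration.integral_cong refl)
      (auto simp: \<sigma>_def split_beta abs_sgn algebra_simps)
  also have "\<dots> = (LINT x|gauss. LINT z|gauss. \<bar>g z - g x\<bar>)"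
    using gauss_pair.integral_fst'[OF iabs] by simp
  finally have keq: "k (pi / 2) - k 0 = (LINT x|gauss. LINT z|gauss. \<bar>g z - g x\<bar>)" .
  \<comment> \<open>As \<open>g\<close> has mean 1, the number 1 is the average of
    \<open>g z\<close> over an independent copy, and the absolute value moves inside.\<close>
  have "(LINT x|gauss. \<bar>g x - 1\<bar>) \<le> (LINT x|gauss. LINT z|gauss. \<bar>g z - g x\<bar>)"
  proof (rule integral_mono)
    show "integrable gauss (\<lambda>x. \<bar>g x - 1\<bar>)" using g_int by simp
    show "integrable gauss (\<lambda>x. LINT z|gauss. \<bar>g z - g x\<bar>)"
      using gauss_pair.integrable_fst'[OF iabs] by simp
    fix x
    have "\<bar>g x - 1\<bar> = \<bar>LINT z|gauss. g z - g x\<bar>" using g_int total by simp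
    also have "\<dots> \<le> (LINT z|gauss. \<bar>g z - g x\<bar>)" by (rule integral_abs_bound)
    finally show "\<bar>g x - 1\<bar> \<le> (LINT z|gauss. \<bar>g z - g x\<bar>)" .
  qed
  then show ?thesis using le keq by linarith
qed

end

text \<open>The order of quantifiers is the point: \<open>d\<close> is fixed before \<open>C\<close>
  and \<open>\<kappa>\<close>, so it survives an approximation along which these bounds
  degenerate.\<close>

lemma nice_density_L1:
  assumes M: "0 \<le> M" and e: "0 < e"
  obtains d where "0 < d"
    "\<And>(g :: real ^ 'n \<Rightarrow> real) A C \<kappa>. nice_density g A C \<kappa> \<Longrightarrow> (LINT x|gauss. g x * (norm x)\<^sup>2) \<le> M \<Longrightarrow>
      norm (LINT x|gauss. g x *\<^sub>R x) \<le> d \<Longrightarrow>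
      (LINT x|gauss. (norm (A x))\<^sup>2 / g x) / 2 - (LINT x|gauss. g x * ln (g x)) < d \<Longrightarrow>
      (LINT x|gauss. \<bar>g x - 1\<bar>) \<le> e"
proof -
  \<comment> \<open>The Poincare constant; adding 1 makes it positive, so that it can be divided
    by.\<close>
  define c where "c = pi / 2 * gauss_mom1 TYPE('n) + 1"
  have m1: "0 \<le> gauss_mom1 TYPE('n)" and m2: "0 \<le> gauss_mom2 TYPE('n)"
    by (auto intro!: Bochner_Integration.integral_nonneg)
  have c: "c > 0" unfolding c_def using m1 pi_gt_zero by (intro add_nonneg_pos mult_nonneg_nonneg) auto
  \<comment> \<open>The bound of \<open>fisher_le\<close> for a deficit below 1, plus
    \<open>M\<close>.\<close>
  define I0 where "I0 = 10 + 8 * (M + gauss_mom2 TYPE('n)) + M"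
  have I0: "I0 > 0" unfolding I0_def
    by (intro add_pos_nonneg mult_nonneg_nonneg add_nonneg_nonneg M m2) simp_all
  \<comment> \<open>Each of the three terms of \<open>gradient_L1_le\<close> is to be at most
    \<open>e / (3 c)\<close>. \<open>R\<close> settles the tail term; it fixes \<open>w\<close> and
    hence \<open>V\<close>, and only then can \<open>d\<close> settle the other two.\<close>
  define R where "R = 3 * c * I0 / e"
  have R: "R > 0" unfolding R_def using c I0 e by simp
  define w :: "real ^ 'n" where "w = (2 * (1 + R) / norm (SOME i. i \<in> Basis :: real ^ 'n)) *\<^sub>R (SOME i. i \<in> Basis)"
  have w: "norm w = 2 * (1 + R)"
    using R SOME_Basis[where 'a = "real ^ 'n"] by (simp add: w_def)
  define V where "V = gauss_pdf w * measure lborel (cball (0 :: real ^ 'n) 1)"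
  have V: "V > 0" unfolding V_def using gauss_pdf_pos[of w] by (simp add: content_cball_pos)
  define d where "d = min 1 (min (e / (3 * c)) ((e / (6 * c))\<^sup>2 * V / 10))"
  have d: "d > 0" unfolding d_def using e c V by simp
  show thesis
  proof (rule that[OF d])
    fix g :: "real ^ 'n \<Rightarrow> real" and A C \<kappa>
    assume n: "nice_density g A C \<kappa>" and M': "(LINT x|gauss. g x * (norm x)\<^sup>2) \<le> M"
      and b: "norm (LINT x|gauss. g x *\<^sub>R x) \<le> d"
      and def: "(LINT x|gauss. (norm (A x))\<^sup>2 / g x) / 2 - (LINT x|gauss. g x * ln (g x)) < d"
    interpret nice_density g A C \<kappa> by (rule n)
    have D: "deficit < d" using def by (simp add: deficit_def fisher_at_0 ent_0)
    have d1: "d \<le> 1" "d \<le> e / (3 * c)" "d \<le> (e / (6 * c))\<^sup>2 * V / 10" unfolding d_def by auto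
    have "fisher_at 0 + M \<le> I0" using fisher_le[OF M'] D d1(1) by (simp add: I0_def)
    then have 1: "(fisher_at 0 + M) / R \<le> I0 / R" using R by (intro divide_right_mono) auto
    have "10 * d / V \<le> (e / (6 * c))\<^sup>2" using d1(3) V by (simp add: pos_divide_le_eq field_simps)
    then have 2: "sqrt (10 * d / V) \<le> e / (6 * c)" using e c by (intro real_le_lsqrt) auto
    have "(LINT x|gauss. norm (A x)) \<le> d + I0 / R + 2 * (e / (6 * c))"
      using gradient_L1_le[OF M' D R w] 1 2 b unfolding V_def by linarith
    also have "I0 / R = e / (3 * c)" using I0 c e by (simp add: R_def)
    finally have A: "(LINT x|gauss. norm (A x)) \<le> e / c" using d1(2) by (simp add: field_simps)
    have "(LINT x|gauss. \<bar>g x - 1\<bar>) \<le> pi / 2 * (gauss_mom1 TYPE('n) * (LINT x|gauss. norm (A x)))"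
      by (rule L1_poincare)
    also have "\<dots> \<le> c * (LINT x|gauss. norm (A x))"
      using Bochner_Integration.integral_nonneg[of gauss "\<lambda>x. norm (A x)"]
      by (simp add: c_def algebra_simps)
    also have "\<dots> \<le> c * (e / c)" using A c by (intro mult_left_mono) auto
    finally show "(LINT x|gauss. \<bar>g x - 1\<bar>) \<le> e" using c by simp
  qed
qed

section \<open>Smooth cutoff functions\<close>

definition grad :: "(real ^ 'n \<Rightarrow> real) \<Rightarrow> real ^ 'n \<Rightarrow> real ^ 'n" where
  "grad \<phi> x = (\<chi> i. partial_deriv i \<phi> x)"

lemma partial_deriv_eq:
  fixes \<phi> :: "real ^ 'n \<Rightarrow> real"
  assumes "(\<phi> has_derivative (\<lambda>h. a \<bullet> h)) (at x)"
  shows "partial_deriv i \<phi> x = a $ i"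
  using frechet_derivative_at[OF assms, symmetric] by (simp add: inner_axis)

lemma grad_eq:
  fixes \<phi> :: "real ^ 'n \<Rightarrow> real"
  assumes "(\<phi> has_derivative (\<lambda>h. a \<bullet> h)) (at x)"
  shows "grad \<phi> x = a"
  unfolding grad_def partial_deriv_eq[OF assms] by simp

lemma has_derivative_grad:
  fixes \<phi> :: "real ^ 'n \<Rightarrow> real"
  assumes "\<phi> differentiable at x"
  shows "(\<phi> has_derivative (\<lambda>h. grad \<phi> x \<bullet> h)) (at x)"
proof -
  from assms have d: "(\<phi> has_derivative frechet_derivative \<phi> (at x)) (at x)"
    by (simp add: frechet_derivative_works)
  then have l: "linear (frechet_derivative \<phi> (at x))" by (rule has_derivative_linear)
  have "frechet_derivative \<phi> (at x) h = grad \<phi> x \<bullet> h" for h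
  proof -
    have "frechet_derivative \<phi> (at x) h = frechet_derivative \<phi> (at x) (\<Sum>i\<in>UNIV. (h $ i) *\<^sub>R axis i 1)"
      by (simp add: basis_expansion scalar_mult_eq_scaleR[symmetric])
    also have "\<dots> = (\<Sum>i\<in>UNIV. (h $ i) *\<^sub>R frechet_derivative \<phi> (at x) (axis i 1))"
      using l by (simp add: linear_sum linear_cmul)
    also have "\<dots> = grad \<phi> x \<bullet> h" by (simp add: grad_def inner_vec_def mult.commute)
    finally show ?thesis .
  qed
  then have "frechet_derivative \<phi> (at x) = (\<lambda>h. grad \<phi> x \<bullet> h)" by blast
  with d show ?thesis by simp
qed

section \<open>Closure properties of the classes \<open>C_k\<close>\<close>

lemma C_k_Suc_I:
  fixes \<phi> :: "real ^ 'n \<Rightarrow> real"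
  assumes "\<And>x. (\<phi> has_derivative (\<lambda>h. a x \<bullet> h)) (at x)" "\<And>i. C_k k (\<lambda>x. a x $ i)"
  shows "C_k (Suc k) \<phi>"
proof -
  have "partial_deriv i \<phi> = (\<lambda>x. a x $ i)" for i using partial_deriv_eq[OF assms(1)] by auto
  then show ?thesis using assms by (auto simp: differentiable_def)
qed

lemma C_k_Suc_D:
  fixes \<phi> :: "real ^ 'n \<Rightarrow> real"
  assumes "C_k (Suc k) \<phi>"
  shows "(\<phi> has_derivative (\<lambda>h. grad \<phi> x \<bullet> h)) (at x)" "C_k k (\<lambda>x. grad \<phi> x $ i)"
  using assms has_derivative_grad[of \<phi> x] by (auto simp: grad_def)

text \<open>The recursion does not make the levels nested by itself. The product rule needs this,
  since it keeps one undifferentiated factor at the lower level.\<close>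

lemma C_k_SucD: "C_k (Suc k) \<phi> \<Longrightarrow> C_k k \<phi>"
proof (induction k arbitrary: \<phi>)
  case 0
  then have "continuous (at x) \<phi>" for x
    using has_derivative_continuous[OF C_k_Suc_D(1)[OF 0]] by blast
  then show ?case by (simp add: continuous_at_imp_continuous_on)
next
  case (Suc k)
  show ?case
    using Suc.IH[OF C_k_Suc_D(2)[OF Suc.prems]] by (intro C_k_Suc_I[OF C_k_Suc_D(1)[OF Suc.prems]]) simp
qed

lemma C_k_const: "C_k k (\<lambda>x. a)"
proof (induction k arbitrary: a)
  case (Suc k)
  show ?case by (rule C_k_Suc_I[where a = "\<lambda>x. 0"]) (use Suc[of 0] in simp_all)
qed simp

lemma C_k_add:
  assumes "C_k k \<phi>" "C_k k \<psi>"
  shows "C_k k (\<lambda>x. \<phi> x + \<psi> x)"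
  using assms
proof (induction k arbitrary: \<phi> \<psi>)
  case (Suc k)
  show ?case
  proof (rule C_k_Suc_I[where a = "\<lambda>x. grad \<phi> x + grad \<psi> x"])
    show "((\<lambda>x. \<phi> x + \<psi> x) has_derivative (\<lambda>h. (grad \<phi> x + grad \<psi> x) \<bullet> h)) (at x)" for x
      using has_derivative_add[OF C_k_Suc_D(1)[OF Suc.prems(1)] C_k_Suc_D(1)[OF Suc.prems(2)]]
      by (simp add: inner_add_left)
    show "C_k k (\<lambda>x. (grad \<phi> x + grad \<psi> x) $ i)" for i
      using Suc.IH[OF C_k_Suc_D(2)[OF Suc.prems(1)] C_k_Suc_D(2)[OF Suc.prems(2)]] by simp
  qed
qed (auto intro: continuous_intros)

lemma has_gradient_mult:
  fixes \<phi> \<psi> :: "'a::real_inner \<Rightarrow> real"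
  assumes "(\<phi> has_derivative (\<lambda>h. a \<bullet> h)) (at x)" "(\<psi> has_derivative (\<lambda>h. b \<bullet> h)) (at x)"
  shows "((\<lambda>x. \<phi> x * \<psi> x) has_derivative (\<lambda>h. (\<phi> x *\<^sub>R b + \<psi> x *\<^sub>R a) \<bullet> h)) (at x)"
  using has_derivative_mult[OF assms] by (simp add: inner_add_left mult.commute)

lemma C_k_mult:
  assumes "C_k k \<phi>" "C_k k \<psi>"
  shows "C_k k (\<lambda>x. \<phi> x * \<psi> x)"
  using assms
proof (induction k arbitrary: \<phi> \<psi>)
  case (Suc k)
  show ?case
  proof (rule C_k_Suc_I[where a = "\<lambda>x. \<phi> x *\<^sub>R grad \<psi> x + \<psi> x *\<^sub>R grad \<phi> x"])
    show "((\<lambda>x. \<phi> x * \<psi> x) has_derivative (\<lambda>h. (\<phi> x *\<^sub>R grad \<psi> x + \<psi> x *\<^sub>R grad \<phi> x) \<bullet> h)) (at x)" for x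
      by (rule has_gradient_mult[OF C_k_Suc_D(1)[OF Suc.prems(1)] C_k_Suc_D(1)[OF Suc.prems(2)]])
    show "C_k k (\<lambda>x. (\<phi> x *\<^sub>R grad \<psi> x + \<psi> x *\<^sub>R grad \<phi> x) $ i)" for i
      using C_k_add[OF Suc.IH[OF C_k_SucD[OF Suc.prems(1)] C_k_Suc_D(2)[OF Suc.prems(2)]]
        Suc.IH[OF C_k_SucD[OF Suc.prems(2)] C_k_Suc_D(2)[OF Suc.prems(1)]]] by simp
  qed
qed (auto intro: continuous_intros)

lemma C_k_coord: "C_k k (\<lambda>x. x $ j)"
proof (cases k)
  case (Suc k')
  show ?thesis unfolding Suc
    by (rule C_k_Suc_I[where a = "\<lambda>x. axis j 1"])
      (auto simp: inner_axis' C_k_const intro: bounded_linear_imp_has_derivative bounded_linear_vec_nth)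
qed (auto intro: continuous_intros)

lemma C_k_sum: "finite S \<Longrightarrow> (\<And>i. i \<in> S \<Longrightarrow> C_k k (\<phi> i)) \<Longrightarrow> C_k k (\<lambda>x. \<Sum>i\<in>S. \<phi> i x)"
  by (induction S rule: finite_induct) (auto intro: C_k_const C_k_add)

lemma C_k_norm_diff_sq: "C_k k (\<lambda>x :: real ^ 'n. a * (norm (x - b))\<^sup>2 + d)"
proof -
  have eq: "(\<lambda>x :: real ^ 'n. a * (norm (x - b))\<^sup>2 + d) = (\<lambda>x. a * (\<Sum>i\<in>UNIV. (x $ i + - b $ i) * (x $ i + - b $ i)) + d)"
    by (simp add: power2_norm_eq_inner inner_vec_def)
  show ?thesis unfolding eq by (intro C_k_add C_k_mult C_k_const C_k_sum C_k_coord) simp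
qed

text \<open>A family \<open>S\<close> closed under derivatives lets the chain rule stay inside the
  induction. It is used with \<open>{exp}\<close> and with \<open>range flat_exp\<close>.\<close>

lemma C_k_compose:
  fixes q :: "real ^ 'n \<Rightarrow> real"
  assumes S: "\<And>f. f \<in> S \<Longrightarrow> \<exists>f'\<in>S. \<forall>t. (f has_real_derivative f' t) (at t)"
    and q: "\<And>k. C_k k q" and f: "f \<in> S"
  shows "C_k k (\<lambda>x. f (q x))"
  using f
proof (induction k arbitrary: f)
  case 0
  then obtain f' where "\<And>t. (f has_real_derivative f' t) (at t)" using S by blast
  then have "continuous_on UNIV f" using DERIV_isCont continuous_at_imp_continuous_on by blast
  moreover have "continuous_on UNIV q" using q[of 0] by simp
  ultimately show ?case by (auto intro: continuous_on_compose2)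
next
  case (Suc k)
  then obtain f' where f': "f' \<in> S" "\<And>t. (f has_real_derivative f' t) (at t)" using S by blast
  show ?case
  proof (rule C_k_Suc_I[where a = "\<lambda>x. f' (q x) *\<^sub>R grad q x"])
    show "((\<lambda>x. f (q x)) has_derivative (\<lambda>h. (f' (q x) *\<^sub>R grad q x) \<bullet> h)) (at x)" for x
      using has_derivative_compose[OF C_k_Suc_D(1)[OF q[of "Suc 0"]], of f "(*) (f' (q x))" x] f'(2)[of "q x"]
      by (simp add: has_field_derivative_def)
    show "C_k k (\<lambda>x. (f' (q x) *\<^sub>R grad q x) $ i)" for i
      using C_k_mult[OF Suc.IH[OF f'(1)] C_k_Suc_D(2)[OF q[of "Suc k"], of i]] by simp
  qed
qed

text \<open>The flat function \<open>exp (- 1 / t)\<close> with polynomial factors in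
  \<open>1 / t\<close>, a family closed under differentiation. Here \<open>p = 1\<close> is the
  classical example of a smooth function that is not analytic.\<close>

definition flat_exp :: "real poly \<Rightarrow> real \<Rightarrow> real" where
  "flat_exp p t = (if t > 0 then poly p (1 / t) * exp (- (1 / t)) else 0)"

lemma poly_times_exp_tendsto_0: "((\<lambda>y :: real. poly p y * exp (- y)) \<longlongrightarrow> 0) at_top"
proof -
  have "((\<lambda>y. \<Sum>i\<le>degree p. coeff p i * (y ^ i / exp y)) \<longlongrightarrow> (\<Sum>i\<le>degree p. coeff p i * 0)) at_top"
    by (intro tendsto_sum tendsto_mult tendsto_const tendsto_power_div_exp_0)
  moreover have "(\<lambda>y. \<Sum>i\<le>degree p. coeff p i * (y ^ i / exp y)) = (\<lambda>y. poly p y * exp (- y))"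
    by (simp add: poly_altdef sum_distrib_right exp_minus divide_inverse mult.assoc)
  ultimately show ?thesis by simp
qed

text \<open>For \<open>t > 0\<close> differentiation replaces \<open>p\<close> by
  \<open>X^2 (p - p')\<close>. At 0 the right difference quotient is \<open>X p\<close> evaluated at
  \<open>1 / h\<close>, times \<open>exp (- 1 / h)\<close>, and tends to 0.\<close>

lemma flat_exp_derivative:
  "(flat_exp p has_real_derivative flat_exp ([:0, 0, 1:] * (p - pderiv p)) t) (at t)"
proof -
  consider "t > 0" | "t < 0" | "t = 0" by linarith
  then show ?thesis
  proof cases
    case 1
    have "((\<lambda>t. poly p (1 / t) * exp (- (1 / t))) has_real_derivative
        flat_exp ([:0, 0, 1:] * (p - pderiv p)) t) (at t)"
      using 1 by (auto intro!: derivative_eq_intros poly_DERIV[THEN DERIV_chain2] simp: flat_exp_def)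
        (simp add: field_simps power2_eq_square)
    then show ?thesis
      by (rule has_field_derivative_transform_within_open[of _ _ _ "{0<..}"]) (use 1 in \<open>auto simp: flat_exp_def\<close>)
  next
    case 2
    have "((\<lambda>t. 0) has_real_derivative flat_exp ([:0, 0, 1:] * (p - pderiv p)) t) (at t)"
      using 2 by (simp add: flat_exp_def)
    then show ?thesis
      by (rule has_field_derivative_transform_within_open[of _ _ _ "{..<0}"]) (use 2 in \<open>auto simp: flat_exp_def\<close>)
  next
    case 3
    have "((\<lambda>h. flat_exp p h / h) \<longlongrightarrow> 0) (at_right 0)"
    proof -
      have "((\<lambda>h :: real. poly (pCons 0 p) (inverse h) * exp (- inverse h)) \<longlongrightarrow> 0) (at_right 0)"
        by (rule filterlim_compose[OF poly_times_exp_tendsto_0 filterlim_inverse_at_top_right])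
      then show ?thesis
        by (rule Lim_transform_eventually)
          (auto simp: eventually_at_right_less flat_exp_def field_simps intro!: eventually_mono[OF eventually_at_right_less])
    qed
    moreover have "((\<lambda>h. flat_exp p h / h) \<longlongrightarrow> 0) (at_left 0)"
    proof (rule Lim_transform_eventually[OF tendsto_const])
      show "\<forall>\<^sub>F h in at_left 0. 0 = flat_exp p h / h"
        by (rule eventually_mono[OF eventually_at_left_real[of "-1" 0]]) (auto simp: flat_exp_def)
    qed
    ultimately have "((\<lambda>h. flat_exp p h / h) \<longlongrightarrow> 0) (at 0)" by (simp add: filterlim_split_at)
    then show ?thesis using 3 by (simp add: DERIV_def flat_exp_def)
  qed
qed

text \<open>Normalized to the value 1 at the origin and vanishing from radius \<open>R\<close> on.
  It is not constant on any smaller ball, so it tends to 1 only pointwise as \<open>R\<close> grows.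
  The quadratic is written in the shape of \<open>C_k_norm_diff_sq\<close>.\<close>

definition bump :: "real \<Rightarrow> real ^ 'n \<Rightarrow> real" where
  "bump R y = exp 1 * flat_exp 1 (- (1 / R\<^sup>2) * (norm (y - 0))\<^sup>2 + 1)"

lemma C_k_bump: "C_k k (bump R)"
proof -
  have "C_k k (\<lambda>y :: real ^ 'n. flat_exp 1 (- (1 / R\<^sup>2) * (norm (y - 0))\<^sup>2 + 1))"
  proof (rule C_k_compose[of "range flat_exp", OF _ C_k_norm_diff_sq])
    show "\<exists>f'\<in>range flat_exp. \<forall>t. (f has_real_derivative f' t) (at t)" if "f \<in> range flat_exp" for f
      using that flat_exp_derivative by blast
  qed simp
  from C_k_mult[OF C_k_const[of k "exp 1"] this] show ?thesis by (simp add: bump_def[abs_def])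
qed

lemma flat_exp_1_bounds: "0 \<le> flat_exp 1 t" "t \<le> 1 \<Longrightarrow> exp 1 * flat_exp 1 t \<le> 1"
  by (auto simp: flat_exp_def exp_add[symmetric])

lemma bump_bounds: "0 \<le> bump R y" "bump R y \<le> 1"
proof -
  have "- (1 / R\<^sup>2) * (norm (y - 0))\<^sup>2 + 1 \<le> 1" by simp
  then show "bump R y \<le> 1" unfolding bump_def by (rule flat_exp_1_bounds(2))
qed (simp add: bump_def flat_exp_1_bounds(1))

lemma bump_outside:
  assumes "R > 0" "R \<le> norm y"
  shows "bump R y = 0"
proof -
  have "1 * R\<^sup>2 \<le> (norm y)\<^sup>2" using assms power_mono[of R "norm y" 2] by simp
  then have "1 \<le> (norm y)\<^sup>2 / R\<^sup>2" using assms(1) by (subst pos_le_divide_eq) auto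
  then have "\<not> 0 < - (1 / R\<^sup>2) * (norm (y - 0))\<^sup>2 + 1" by simp
  then show ?thesis unfolding bump_def flat_exp_def by simp
qed

lemma bump_tendsto: "(\<lambda>j. bump (real (Suc j)) y) \<longlonglongrightarrow> 1"
proof -
  have "(\<lambda>j. - ((inverse (real (Suc j)))\<^sup>2) * (norm (y - 0))\<^sup>2 + 1) \<longlonglongrightarrow> - (0\<^sup>2) * (norm (y - 0))\<^sup>2 + 1"
    by (intro tendsto_intros LIMSEQ_inverse_real_of_nat)
  then have l: "(\<lambda>j. - (1 / (real (Suc j))\<^sup>2) * (norm (y - 0))\<^sup>2 + 1) \<longlonglongrightarrow> 1"
    by (simp add: inverse_eq_divide power_divide)
  have "isCont (flat_exp 1) 1" by (rule DERIV_isCont[OF flat_exp_derivative])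
  from isCont_tendsto_compose[OF this l]
  have "(\<lambda>j. exp 1 * flat_exp 1 (- (1 / (real (Suc j))\<^sup>2) * (norm (y - 0))\<^sup>2 + 1)) \<longlonglongrightarrow> exp 1 * flat_exp 1 1"
    by (rule tendsto_mult_left)
  also have "exp 1 * flat_exp 1 1 = 1" by (simp add: flat_exp_def exp_add[symmetric])
  finally show ?thesis unfolding bump_def .
qed

text \<open>The derivative of the flat function is \<open>t^-2 exp (- 1 / t) \<le> 2\<close>,
  because \<open>exp s \<ge> s^2 / 2\<close>; the quadratic inside has gradient at most
  \<open>2 / R\<close> on the ball.\<close>

lemma norm_grad_bump:
  assumes R: "R > 0"
  shows "norm (grad (bump R) y) \<le> 4 * exp 1 / R"
proof -
  let ?q = "\<lambda>y :: real ^ 'n. - (1 / R\<^sup>2) * (norm (y - 0))\<^sup>2 + 1"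
  let ?p = "[:0, 0, 1:] * (1 - pderiv 1) :: real poly"
  have q: "(?q has_derivative (\<lambda>h. ((- 2 / R\<^sup>2) *\<^sub>R y) \<bullet> h)) (at y)"
  proof -
    have "((\<lambda>y. (y - 0) \<bullet> (y - 0)) has_derivative (\<lambda>h. (2 *\<^sub>R y) \<bullet> h)) (at y)"
      by (auto intro!: derivative_eq_intros simp: inner_commute)
    from has_derivative_add[OF has_derivative_mult_right[OF this, of "- (1 / R\<^sup>2)"] has_derivative_const[of 1]]
    show ?thesis by (simp add: power2_norm_eq_inner)
  qed
  have "((\<lambda>y. flat_exp 1 (?q y)) has_derivative (\<lambda>h. flat_exp ?p (?q y) * (((- 2 / R\<^sup>2) *\<^sub>R y) \<bullet> h))) (at y)"
    by (rule has_derivative_compose[OF q]) (use flat_exp_derivative[of 1 "?q y"] in \<open>simp add: has_field_derivative_def\<close>)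
  from has_derivative_mult_right[OF this, of "exp 1"]
  have "(bump R has_derivative (\<lambda>h. ((exp 1 * flat_exp ?p (?q y)) *\<^sub>R ((- 2 / R\<^sup>2) *\<^sub>R y)) \<bullet> h)) (at y)"
    unfolding bump_def by (simp add: mult.assoc)
  from grad_eq[OF this] have g: "grad (bump R) y = (exp 1 * flat_exp ?p (?q y)) *\<^sub>R ((- 2 / R\<^sup>2) *\<^sub>R y)" .
  have pb: "0 \<le> flat_exp ?p t \<and> flat_exp ?p t \<le> 2" for t
  proof (cases "t > 0")
    case True
    have "1 + 1 / t + (1 / t)\<^sup>2 / 2 \<le> exp (1 / t)" using True by (intro exp_lower_Taylor_quadratic) simp
    moreover have "1 / t > 0" using True by simp
    ultimately have "(1 / t)\<^sup>2 \<le> 2 * exp (1 / t)" by linarith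
    then have "(1 / t)\<^sup>2 * exp (- (1 / t)) \<le> 2 * exp (1 / t) * exp (- (1 / t))" by (rule mult_right_mono) simp
    also have "\<dots> = 2" by (simp add: exp_minus)
    finally show ?thesis using True by (simp add: flat_exp_def power2_eq_square)
  qed (simp add: flat_exp_def)
  show ?thesis
  proof (cases "norm y < R")
    case True
    have "norm (grad (bump R) y) = exp 1 * flat_exp ?p (?q y) * (2 / R\<^sup>2 * norm y)"
      unfolding g using pb[of "?q y"] by (simp add: abs_mult)
    also have "\<dots> \<le> exp 1 * 2 * (2 / R\<^sup>2 * R)"
      using pb[of "?q y"] True R by (intro mult_mono mult_nonneg_nonneg) auto
    also have "\<dots> = 4 * exp 1 / R" using R by (simp add: power2_eq_square)
    finally show ?thesis .
  next
    case False
    then have "R\<^sup>2 \<le> (norm y)\<^sup>2" using R by (intro power_mono) auto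
    then have "?q y \<le> 0" using R by (simp add: field_simps)
    then have "flat_exp ?p (?q y) = 0" by (simp add: flat_exp_def)
    then show ?thesis unfolding g using R by simp
  qed
qed

lemma test_functionI:
  fixes \<phi> :: "real ^ 'n \<Rightarrow> real"
  assumes "\<And>k. C_k k \<phi>" and "\<And>y. R \<le> norm y \<Longrightarrow> \<phi> y = 0"
  shows "\<phi> \<in> test_functions"
proof -
  have "{x. \<phi> x \<noteq> 0} \<subseteq> cball 0 R" using assms(2) by (auto simp: not_le[symmetric]) (meson less_le_not_le linear)
  then have "closure {x. \<phi> x \<noteq> 0} \<subseteq> cball 0 R" by (rule closure_minimal) simp
  then have "compact (closure {x. \<phi> x \<noteq> 0})"
    by (meson bounded_cball bounded_subset closed_closure compact_eq_bounded_closed)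
  then show ?thesis using assms(1) by (simp add: test_functions_def)
qed

section \<open>Mollification by the Mehler semigroup\<close>

text \<open>Cauchy-Schwarz from \<open>2 a w \<le> a^2 h + f\<close> with the optimal
  \<open>a = w / h\<close>. Read as joint convexity of \<open>|W|^2 / F\<close>, it is what makes
  mollification decrease the Fisher information.\<close>

lemma norm_integral_square_le:
  fixes W :: "'a \<Rightarrow> 'b::{banach, second_countable_topology}"
  assumes W: "integrable M W" and H: "integrable M H" and F: "integrable M F"
    and nn: "\<And>x. x \<in> space M \<Longrightarrow> 0 \<le> H x" "\<And>x. x \<in> space M \<Longrightarrow> 0 \<le> F x"
    and le: "\<And>x. x \<in> space M \<Longrightarrow> (norm (W x))\<^sup>2 \<le> H x * F x"
  shows "(norm (LINT x|M. W x))\<^sup>2 \<le> (LINT x|M. H x) * (LINT x|M. F x)"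
proof -
  define w where "w = (LINT x|M. norm (W x))"
  define h where "h = (LINT x|M. H x)"
  define f where "f = (LINT x|M. F x)"
  have w0: "0 \<le> w" unfolding w_def by (rule Bochner_Integration.integral_nonneg) simp
  have h0: "0 \<le> h" unfolding h_def by (rule Bochner_Integration.integral_nonneg) (use nn in auto)
  have f0: "0 \<le> f" unfolding f_def by (rule Bochner_Integration.integral_nonneg) (use nn in auto)
  have q: "2 * a * w \<le> a\<^sup>2 * h + f" if a: "a \<ge> 0" for a
  proof -
    have "2 * a * w = (LINT x|M. 2 * a * norm (W x))" unfolding w_def by simp
    also have "\<dots> \<le> (LINT x|M. a\<^sup>2 * H x + F x)"
    proof (rule integral_mono)
      fix x assume x: "x \<in> space M"
      have "norm (W x) \<le> sqrt (H x * F x)" by (rule real_le_rsqrt[OF le[OF x]])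
      then have "2 * a * norm (W x) \<le> 2 * a * (sqrt (H x) * sqrt (F x))"
        using a by (intro mult_left_mono) (auto simp: real_sqrt_mult)
      also have "\<dots> \<le> (a * sqrt (H x))\<^sup>2 + (sqrt (F x))\<^sup>2"
        using sum_squares_bound[of "a * sqrt (H x)" "sqrt (F x)"] by (simp add: mult.assoc)
      also have "\<dots> = a\<^sup>2 * H x + F x" using nn[OF x] by (simp add: power_mult_distrib)
      finally show "2 * a * norm (W x) \<le> a\<^sup>2 * H x + F x" .
    qed (use W H F in auto)
    also have "\<dots> = a\<^sup>2 * h + f" unfolding h_def f_def using H F by simp
    finally show ?thesis .
  qed
  have "w\<^sup>2 \<le> h * f"
  proof (cases "h = 0")
    case True
    have "w = 0"
    proof (rule ccontr)
      assume "w \<noteq> 0"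
      then have "w > 0" using w0 by simp
      \<comment> \<open>For \<open>h = 0\<close> any large \<open>a\<close> refutes
        \<open>w > 0\<close>; this one makes the left side \<open>2 (f + 1)\<close>.\<close>
      then have "2 * ((f + 1) / w) * w \<le> f" using q[of "(f + 1) / w"] True f0 by simp
      then show False using \<open>w > 0\<close> f0 by simp
    qed
    then show ?thesis using h0 f0 by simp
  next
    case False
    then have h: "h > 0" using h0 by simp
    have "2 * (w / h) * w \<le> (w / h)\<^sup>2 * h + f" using q[of "w / h"] w0 h by simp
    then have "w\<^sup>2 / h \<le> f" using h by (simp add: power2_eq_square field_simps)
    then show ?thesis using h by (simp add: pos_divide_le_eq mult.commute)
  qed
  moreover have "norm (LINT x|M. W x) \<le> w" unfolding w_def by (rule integral_norm_bound)
  ultimately show ?thesis unfolding h_def[symmetric] f_def[symmetric]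
    by (meson norm_ge_zero order_trans power_mono)
qed

text \<open>The integrand \<open>F (cos t x + sin t z)\<close> is \<open>F\<close> of the first
  rotated coordinate, which is again standard Gaussian. For unbounded \<open>F\<close> the inner
  integral may fail to exist on a null set of \<open>x\<close>.\<close>

lemma
  fixes F :: "real ^ 'n \<Rightarrow> 'b::{banach, second_countable_topology}"
  assumes t: "cos t \<noteq> - 1" and F: "integrable gauss F"
  shows mehler_integrable: "integrable gauss (mehler t F)"
    and mehler_integral: "(LINT x|gauss. mehler t F x) = (LINT x|gauss. F x)"
    and AE_mehler_integrable: "AE x in gauss. integrable gauss (\<lambda>z. F (cos t *\<^sub>R x + sin t *\<^sub>R z))"
proof -
  have [measurable]: "F \<in> borel_measurable borel" using borel_measurable_integrable[OF F] by simp
  have 1: "integrable gauss2 (\<lambda>p. F (fst p))"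
  proof (rule gauss_pair.Fubini_integrable)
    show "integrable gauss (\<lambda>x. LINT y|(gauss :: (real ^ 'n) measure). norm (F (fst (x, y))))"
      using F by simp
    show "AE x in gauss. integrable (gauss :: (real ^ 'n) measure) (\<lambda>y. F (fst (x, y)))" by simp
  qed measurable
  have "integrable (distr gauss2 (borel \<Otimes>\<^sub>M borel) (rotation t)) (\<lambda>p. F (fst p))"
    using 1 by (simp only: gauss_rotation[OF t])
  then have 2: "integrable gauss2 (\<lambda>p. F (fst (rotation t p)))" by (subst (asm) integrable_distr_eq) measurable
  have eq: "F (fst (rotation t (x, z))) = F (cos t *\<^sub>R x + sin t *\<^sub>R z)" for x z by (simp add: rotation_def)
  show "integrable gauss (mehler t F)"
    using gauss_pair.integrable_fst'[OF 2] unfolding eq mehler_def[abs_def] .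
  show "AE x in gauss. integrable gauss (\<lambda>z. F (cos t *\<^sub>R x + sin t *\<^sub>R z))"
    using gauss_pair.AE_integrable_fst'[OF 2] unfolding eq .
  have "(LINT x|gauss. mehler t F x) = (LINT p|gauss2. F (fst (rotation t p)))"
    using gauss_pair.integral_fst'[OF 2] unfolding eq mehler_def .
  also have "\<dots> = (LINT p|gauss2. F (fst p))" by (rule gauss_rotation_integral[OF t]) measurable
  also have "\<dots> = (LINT x|gauss. F x)" using gauss_pair.integral_fst'[OF 1] by simp
  finally show "(LINT x|gauss. mehler t F x) = (LINT x|gauss. F x)" .
qed

lemma mehler_L1_contraction:
  fixes F :: "real ^ 'n \<Rightarrow> 'b::{banach, second_countable_topology}"
  assumes t: "cos t \<noteq> - 1" and F: "integrable gauss F"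
  shows "(LINT x|gauss. norm (mehler t F x)) \<le> (LINT x|gauss. norm (F x))"
proof -
  have "(LINT x|gauss. norm (mehler t F x)) \<le> (LINT x|gauss. mehler t (\<lambda>x. norm (F x)) x)"
  proof (rule integral_mono)
    show "integrable gauss (\<lambda>x. norm (mehler t F x))" using mehler_integrable[OF t F] by simp
    show "integrable gauss (mehler t (\<lambda>x. norm (F x)))" by (rule mehler_integrable[OF t]) (use F in simp)
  qed (simp add: mehler_def)
  also have "\<dots> = (LINT x|gauss. norm (F x))" by (rule mehler_integral[OF t]) (use F in simp)
  finally show ?thesis .
qed

lemma mehler_bounded_continuous_tendsto:
  fixes F :: "real ^ 'n \<Rightarrow> 'b::{banach, second_countable_topology}"
  assumes c: "continuous_on UNIV F" and bd: "\<And>x. norm (F x) \<le> C" and t: "t \<longlonglongrightarrow> 0"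
  shows "(\<lambda>j. LINT x|gauss. norm (mehler (t j) F x - F x)) \<longlonglongrightarrow> 0"
proof -
  have [measurable]: "F \<in> borel_measurable borel" by (rule borel_measurable_continuous_onI[OF c])
  have pt: "(\<lambda>j. mehler (t j) F x) \<longlonglongrightarrow> F x" for x
  proof -
    have "(\<lambda>j. LINT z|gauss. F (cos (t j) *\<^sub>R x + sin (t j) *\<^sub>R z)) \<longlonglongrightarrow> (LINT z|(gauss :: (real ^ 'n) measure). F x)"
    proof (rule integral_dominated_convergence[where w = "\<lambda>_. C"])
      show "AE z in gauss. (\<lambda>j. F (cos (t j) *\<^sub>R x + sin (t j) *\<^sub>R z)) \<longlonglongrightarrow> F x"
      proof (rule AE_I2)
        fix z :: "real ^ 'n"
        have "(\<lambda>j. cos (t j) *\<^sub>R x + sin (t j) *\<^sub>R z) \<longlonglongrightarrow> cos 0 *\<^sub>R x + sin 0 *\<^sub>R z"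
          by (intro tendsto_intros t)
        then have l: "(\<lambda>j. cos (t j) *\<^sub>R x + sin (t j) *\<^sub>R z) \<longlonglongrightarrow> x" by simp
        have "isCont F x" using c by (simp add: continuous_on_eq_continuous_at)
        from isCont_tendsto_compose[OF this l] show "(\<lambda>j. F (cos (t j) *\<^sub>R x + sin (t j) *\<^sub>R z)) \<longlonglongrightarrow> F x" .
      qed
    qed (use bd in auto)
    then show ?thesis by (simp add: mehler_def)
  qed
  have "(\<lambda>j. LINT x|gauss. norm (mehler (t j) F x - F x)) \<longlonglongrightarrow> (LINT x|(gauss :: (real ^ 'n) measure). 0)"
  proof (rule integral_dominated_convergence[where w = "\<lambda>_. C + C"])
    show "AE x in gauss. (\<lambda>j. norm (mehler (t j) F x - F x)) \<longlonglongrightarrow> 0"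
      using pt by (intro AE_I2 tendsto_norm_zero) (simp add: LIM_zero_iff)
    show "AE x in gauss. norm (norm (mehler (t j) F x - F x)) \<le> C + C" for j
    proof (rule AE_I2)
      fix x
      show "norm (norm (mehler (t j) F x - F x)) \<le> C + C"
        using norm_triangle_ineq4[of "mehler (t j) F x" "F x"] norm_mehler_le[of F C "t j" x, OF _ bd] bd[of x] by simp
    qed
  qed auto
  then show ?thesis by simp
qed

text \<open>\<open>T m\<close> is the radial retraction onto a ball. It first truncates
  \<open>F\<close>; then, applied to continuous functions converging to \<open>F\<close> almost
  everywhere, it provides the constant majorant for dominated convergence.\<close>

lemma bounded_continuous_L1_dense:
  fixes F :: "real ^ 'n \<Rightarrow> 'b::euclidean_space"
  assumes F: "integrable gauss F" and e: "e > 0"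
  obtains G C where "continuous_on UNIV G" "\<And>x. norm (G x) \<le> C" "(LINT x|gauss. norm (F x - G x)) < e"
proof -
  have [measurable]: "F \<in> borel_measurable borel" using borel_measurable_integrable[OF F] by simp
  define T where "T m y = (1 / max 1 (norm y / real (Suc m))) *\<^sub>R y" for m and y :: 'b
  have T_cont: "continuous_on UNIV (T m)" for m
    unfolding T_def by (intro continuous_intros) auto
  have T_bd: "norm (T m y) \<le> real (Suc m)" for m y
  proof (cases "norm y \<le> real (Suc m)")
    case True
    then have "max 1 (norm y / real (Suc m)) = 1" by (simp add: max_def field_simps)
    then show ?thesis using True by (simp add: T_def)
  next
    case False
    then have "max 1 (norm y / real (Suc m)) = norm y / real (Suc m)" by (simp add: max_def field_simps)
    then show ?thesis using False by (simp add: T_def)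
  qed
  have T_le: "norm (T m y) \<le> norm y" for m y
  proof -
    have "1 / max 1 (norm y / real (Suc m)) \<le> 1" by (simp add: divide_le_eq)
    then have "1 / max 1 (norm y / real (Suc m)) * norm y \<le> 1 * norm y" by (rule mult_right_mono) simp
    then show ?thesis by (simp add: T_def)
  qed
  have [measurable]: "T m \<in> borel_measurable borel" for m by (rule borel_measurable_continuous_onI[OF T_cont])
  have "(\<lambda>m. LINT x|gauss. norm (F x - T m (F x))) \<longlonglongrightarrow> (LINT x|(gauss :: (real ^ 'n) measure). 0)"
  proof (rule integral_dominated_convergence[where w = "\<lambda>x. 2 * norm (F x)"])
    show "AE x in gauss. (\<lambda>m. norm (F x - T m (F x))) \<longlonglongrightarrow> 0"
    proof (rule AE_I2)
      fix x
      obtain N where N: "norm (F x) \<le> real N" using real_arch_simple by blast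
      have "F x - T m (F x) = 0" if "m \<ge> N" for m
      proof -
        have "norm (F x) \<le> real (Suc m)" using N that by linarith
        then have "max 1 (norm (F x) / real (Suc m)) = 1" by (simp add: max_def field_simps)
        then show ?thesis by (simp add: T_def)
      qed
      then have "eventually (\<lambda>m. norm (F x - T m (F x)) = 0) sequentially"
        by (auto simp: eventually_sequentially)
      then show "(\<lambda>m. norm (F x - T m (F x))) \<longlonglongrightarrow> 0" by (rule tendsto_eventually)
    qed
    show "AE x in gauss. norm (norm (F x - T m (F x))) \<le> 2 * norm (F x)" for m
    proof (rule AE_I2)
      fix x
      show "norm (norm (F x - T m (F x))) \<le> 2 * norm (F x)"
        using norm_triangle_ineq4[of "F x" "T m (F x)"] T_le[of m "F x"] by simp
    qed
  qed (use F in auto)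
  then have "eventually (\<lambda>m. (LINT x|gauss. norm (F x - T m (F x))) < e / 2) sequentially"
    using e by (intro order_tendstoD(2)) auto
  then obtain m where m: "(LINT x|gauss. norm (F x - T m (F x))) < e / 2"
    by (auto simp: eventually_sequentially)
  have "F measurable_on UNIV"
    by (subst measurable_on_iff_borel_measurable) (auto simp: lebesgue_on_UNIV_eq intro: measurable_completion)
  then obtain N f where N: "negligible N" and f: "\<And>n. continuous_on UNIV (f n)"
    and lim: "\<And>x. x \<notin> N \<Longrightarrow> (\<lambda>n. f n x) \<longlonglongrightarrow> F x"
    unfolding measurable_on_def by auto
  have AE_N: "AE x in gauss. x \<notin> N"
  proof -
    have "N \<in> null_sets lebesgue" using N by (simp add: negligible_iff_null_sets)
    then have "AE x in lebesgue. x \<notin> N" by (rule AE_not_in)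
    then show ?thesis by (simp add: AE_gauss_iff AE_completion_iff)
  qed
  have [measurable]: "f n \<in> borel_measurable borel" for n by (rule borel_measurable_continuous_onI[OF f])
  have "(\<lambda>n. LINT x|gauss. norm (T m (F x) - T m (f n x))) \<longlonglongrightarrow> (LINT x|(gauss :: (real ^ 'n) measure). 0)"
  proof (rule integral_dominated_convergence[where w = "\<lambda>_. 2 * real (Suc m)"])
    show "AE x in gauss. (\<lambda>n. norm (T m (F x) - T m (f n x))) \<longlonglongrightarrow> 0"
      using AE_N
    proof eventually_elim
      fix x assume x: "x \<notin> N"
      have "isCont (T m) (F x)" using T_cont by (simp add: continuous_on_eq_continuous_at)
      from isCont_tendsto_compose[OF this lim[OF x]] have "(\<lambda>n. T m (f n x)) \<longlonglongrightarrow> T m (F x)" .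
      from tendsto_diff[OF tendsto_const[of "T m (F x)"] this]
      show "(\<lambda>n. norm (T m (F x) - T m (f n x))) \<longlonglongrightarrow> 0" by (intro tendsto_norm_zero) simp
    qed
    show "AE x in gauss. norm (norm (T m (F x) - T m (f n x))) \<le> 2 * real (Suc m)" for n
    proof (rule AE_I2)
      fix x
      show "norm (norm (T m (F x) - T m (f n x))) \<le> 2 * real (Suc m)"
        using norm_triangle_ineq4[of "T m (F x)" "T m (f n x)"] T_bd[of m "F x"] T_bd[of m "f n x"] by simp
    qed
  qed auto
  then have "eventually (\<lambda>n. (LINT x|gauss. norm (T m (F x) - T m (f n x))) < e / 2) sequentially"
    using e by (intro order_tendstoD(2)) auto
  then obtain n where n: "(LINT x|gauss. norm (T m (F x) - T m (f n x))) < e / 2"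
    by (auto simp: eventually_sequentially)
  have iT: "integrable gauss (\<lambda>x. T m (h x))" if "h \<in> borel_measurable borel" for h :: "real ^ 'n \<Rightarrow> 'b"
    by (rule integrable_gauss_bounded[of _ "real (Suc m)"]) (use that T_bd in auto)
  have i1: "integrable gauss (\<lambda>x. norm (F x - T m (F x)))" "integrable gauss (\<lambda>x. norm (T m (F x) - T m (f n x)))"
    "integrable gauss (\<lambda>x. norm (F x - T m (f n x)))"
    using iT[of F] iT[of "f n"] F by auto
  show thesis
  proof (rule that[of "\<lambda>x. T m (f n x)" "real (Suc m)"])
    show "continuous_on UNIV (\<lambda>x. T m (f n x))" by (rule continuous_on_compose2[OF T_cont f]) simp
    have "(LINT x|gauss. norm (F x - T m (f n x))) \<le> (LINT x|gauss. norm (F x - T m (F x)) + norm (T m (F x) - T m (f n x)))"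
    proof (rule integral_mono)
      show "norm (F x - T m (f n x)) \<le> norm (F x - T m (F x)) + norm (T m (F x) - T m (f n x))" for x
        using norm_triangle_ineq[of "F x - T m (F x)" "T m (F x) - T m (f n x)"] by simp
    qed (use i1 in auto)
    also have "\<dots> = (LINT x|gauss. norm (F x - T m (F x))) + (LINT x|gauss. norm (T m (F x) - T m (f n x)))"
      using i1 by simp
    finally show "(LINT x|gauss. norm (F x - T m (f n x))) < e" using m n by simp
  qed (rule T_bd)
qed

text \<open>Density plus contraction: the error of a bounded continuous approximation does not grow
  under \<open>mehler\<close>, and the approximation itself is handled by
  \<open>mehler_bounded_continuous_tendsto\<close>.\<close>

lemma mehler_L1_tendsto:
  fixes F :: "real ^ 'n \<Rightarrow> 'b::euclidean_space"
  assumes F: "integrable gauss F" and t: "t \<longlonglongrightarrow> 0" and t': "\<And>j. cos (t j) \<noteq> - 1"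
  shows "(\<lambda>j. LINT x|gauss. norm (mehler (t j) F x - F x)) \<longlonglongrightarrow> 0"
proof (rule LIMSEQ_I)
  fix e :: real assume e: "e > 0"
  obtain G C where G: "continuous_on UNIV G" "\<And>x. norm (G x) \<le> C" and FG: "(LINT x|gauss. norm (F x - G x)) < e / 3"
    by (rule bounded_continuous_L1_dense[OF F, of "e / 3"]) (use e in auto)
  have [measurable]: "G \<in> borel_measurable borel" by (rule borel_measurable_continuous_onI[OF G(1)])
  have iG: "integrable gauss G" by (rule integrable_gauss_bounded[of _ C]) (use G in auto)
  from mehler_bounded_continuous_tendsto[OF G t] e
  obtain N where N: "\<And>j. j \<ge> N \<Longrightarrow> (LINT x|gauss. norm (mehler (t j) G x - G x)) < e / 3"
    using order_tendstoD(2)[of _ 0 sequentially "e / 3"] by (auto simp: eventually_sequentially)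
  show "\<exists>N. \<forall>j\<ge>N. norm ((LINT x|gauss. norm (mehler (t j) F x - F x)) - 0) < e"
  proof (intro exI allI impI)
    fix j assume j: "j \<ge> N"
    have iM: "integrable gauss (mehler (t j) F)" "integrable gauss (mehler (t j) G)"
      "integrable gauss (mehler (t j) (\<lambda>x. F x - G x))"
      by (intro mehler_integrable[OF t'] Bochner_Integration.integrable_diff F iG)+
    \<comment> \<open>Linearity in \<open>F\<close> is used only where both inner integrals
      exist.\<close>
    have AE: "AE x in gauss. mehler (t j) (\<lambda>x. F x - G x) x = mehler (t j) F x - mehler (t j) G x"
      using AE_mehler_integrable[OF t' F, of j] AE_mehler_integrable[OF t' iG, of j]
      by eventually_elim (simp add: mehler_def)
    have "(LINT x|gauss. norm (mehler (t j) F x - F x))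
      \<le> (LINT x|gauss. norm (mehler (t j) (\<lambda>x. F x - G x) x) + norm (mehler (t j) G x - G x) + norm (F x - G x))"
    proof (rule integral_mono_AE)
      show "AE x in gauss. norm (mehler (t j) F x - F x)
        \<le> norm (mehler (t j) (\<lambda>x. F x - G x) x) + norm (mehler (t j) G x - G x) + norm (F x - G x)"
        using AE
      proof eventually_elim
        case (elim x)
        have "mehler (t j) F x - F x = (mehler (t j) (\<lambda>x. F x - G x) x + (mehler (t j) G x - G x)) - (F x - G x)"
          unfolding elim by simp
        then show ?case
          using norm_triangle_ineq4[of "mehler (t j) (\<lambda>x. F x - G x) x + (mehler (t j) G x - G x)" "F x - G x"]
            norm_triangle_ineq[of "mehler (t j) (\<lambda>x. F x - G x) x" "mehler (t j) G x - G x"] by simp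
      qed
    qed (use iM F iG in auto)
    also have "\<dots> = (LINT x|gauss. norm (mehler (t j) (\<lambda>x. F x - G x) x)) + (LINT x|gauss. norm (mehler (t j) G x - G x))
        + (LINT x|gauss. norm (F x - G x))"
      using iM F iG by simp
    also have "\<dots> < e"
      using mehler_L1_contraction[OF t', of "\<lambda>x. F x - G x" j] F iG FG N[OF j] by simp
    finally show "norm ((LINT x|gauss. norm (mehler (t j) F x - F x)) - 0) < e" by simp
  qed
qed

section \<open>The Mehler kernel\<close>

lemma lborel_integral_affine:
  fixes H :: "'a::euclidean_space \<Rightarrow> 'b::{banach, second_countable_topology}"
  assumes [measurable]: "H \<in> borel_measurable borel" and s: "s > 0"
  shows "(LINT y|lborel. H y) = (LINT v|lborel. (s ^ DIM('a)) *\<^sub>R H (a + s *\<^sub>R v))"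
proof -
  have "(LINT y|lborel. H y) = (LINT y|density (distr lborel borel (\<lambda>x. a + s *\<^sub>R x)) (\<lambda>_. \<bar>s\<bar> ^ DIM('a)). H y)"
    using s by (subst lborel_affine[of s a]) auto
  also have "\<dots> = (LINT v|lborel. (s ^ DIM('a)) *\<^sub>R H (a + s *\<^sub>R v))"
    using s by (subst integral_density) (auto simp: integral_distr)
  finally show ?thesis .
qed

text \<open>The density in \<open>y\<close> of \<open>cos t x + sin t Z\<close>, taken with respect
  to Lebesgue measure because weak derivatives are tested against it.\<close>

definition mehler_kernel :: "real \<Rightarrow> real ^ 'n \<Rightarrow> real ^ 'n \<Rightarrow> real" where
  "mehler_kernel t x y = gauss_pdf ((1 / sin t) *\<^sub>R (y - cos t *\<^sub>R x)) / sin t ^ CARD('n)"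

lemma mehler_eq_kernel:
  fixes F :: "real ^ 'n \<Rightarrow> 'b::{banach, second_countable_topology}"
  assumes [measurable]: "F \<in> borel_measurable borel" and s: "sin t > 0"
  shows "mehler t F x = (LINT y|lborel. mehler_kernel t x y *\<^sub>R F y)"
proof -
  have [measurable]: "mehler_kernel t x \<in> borel_measurable borel" unfolding mehler_kernel_def by measurable
  have "(LINT y|lborel. mehler_kernel t x y *\<^sub>R F y)
    = (LINT v|lborel. sin t ^ DIM(real ^ 'n) *\<^sub>R (mehler_kernel t x (cos t *\<^sub>R x + sin t *\<^sub>R v) *\<^sub>R F (cos t *\<^sub>R x + sin t *\<^sub>R v)))"
    by (rule lborel_integral_affine[OF _ s]) measurable
  also have "\<dots> = (LINT v|lborel. gauss_pdf v *\<^sub>R F (cos t *\<^sub>R x + sin t *\<^sub>R v))"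
    using s by (intro Bochner_Integration.integral_cong refl) (simp add: mehler_kernel_def)
  also have "\<dots> = mehler t F x" unfolding mehler_def by (subst integral_gauss) auto
  finally show ?thesis by simp
qed

lemma mehler_kernel_measurable [measurable]: "mehler_kernel t x \<in> borel_measurable borel"
  unfolding mehler_kernel_def by measurable

lemma abs_le_abs_pos: "0 < a \<Longrightarrow> a \<le> b \<Longrightarrow> \<bar>a\<bar> \<le> \<bar>b :: real\<bar>"
  by linarith

lemma abs_mult_nonneg: "0 \<le> d \<Longrightarrow> \<bar>p\<bar> * d = norm (d * p :: real)"
  by (simp add: abs_mult)

lemma gauss_pdf_le: "gauss_pdf (x :: real ^ 'n) \<le> gauss_pdf (0 :: real ^ 'n)"
  by (rule gauss_pdf_antimono) simp

lemma norm_gauss_pdf_le: "norm x * gauss_pdf (x :: real ^ 'n) \<le> gauss_pdf (0 :: real ^ 'n)"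
proof -
  have "norm x \<le> 1 + (norm x)\<^sup>2 / 2" using sum_squares_bound[of "norm x" 1] by simp
  also have "\<dots> \<le> exp ((norm x)\<^sup>2 / 2)" by (rule exp_ge_add_one_self)
  finally have "norm x * exp (- (norm x)\<^sup>2 / 2) \<le> exp ((norm x)\<^sup>2 / 2) * exp (- (norm x)\<^sup>2 / 2)"
    by (rule mult_right_mono) simp
  also have "\<dots> = 1" by (simp add: exp_add[symmetric])
  finally have "(2 * pi) powr (- real CARD('n) / 2) * (norm x * exp (- (norm x)\<^sup>2 / 2)) \<le> (2 * pi) powr (- real CARD('n) / 2) * 1"
    by (rule mult_left_mono) simp
  then show ?thesis by (simp add: gauss_pdf_def mult_ac)
qed

context
  fixes t :: real
  assumes s: "0 < sin t" and c: "0 < cos t"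
begin

lemma mehler_kernel_bounds:
  "0 < mehler_kernel t x y" "mehler_kernel t x (y :: real ^ 'n) \<le> gauss_pdf (0 :: real ^ 'n) / sin t ^ CARD('n)"
  using s by (auto simp: mehler_kernel_def gauss_pdf_pos intro!: divide_right_mono gauss_pdf_le)

lemma mehler_kernel_gradient_fst:
  "((\<lambda>x. mehler_kernel t x y) has_derivative (\<lambda>h. ((cos t / (sin t)\<^sup>2 * mehler_kernel t x y) *\<^sub>R (y - cos t *\<^sub>R x)) \<bullet> h)) (at x)"
proof -
  let ?v = "\<lambda>x. (1 / sin t) *\<^sub>R (y - cos t *\<^sub>R x)"
  have "((\<lambda>x. gauss_pdf (?v x)) has_derivative (\<lambda>h. - (gauss_pdf (?v x) *\<^sub>R ?v x) \<bullet> ((1 / sin t) *\<^sub>R (- (cos t *\<^sub>R h))))) (at x)"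
  proof (rule has_derivative_compose[where g = gauss_pdf and f = ?v])
    show "(?v has_derivative (\<lambda>h. (1 / sin t) *\<^sub>R (- (cos t *\<^sub>R h)))) (at x)"
      by (auto intro!: derivative_eq_intros)
  qed (rule gauss_pdf_has_derivative)
  from has_derivative_mult_right[OF this, of "1 / sin t ^ CARD('n)"]
  show ?thesis using s
    by (simp add: mehler_kernel_def power2_eq_square algebra_simps)
qed

text \<open>The gradient in \<open>x\<close> is \<open>- cos t\<close> times this one. That
  proportionality moves derivatives from \<open>x\<close> to \<open>y\<close>, where the weak
  gradient can be used.\<close>

lemma mehler_kernel_gradient_snd:
  "((\<lambda>y. mehler_kernel t x y) has_derivative (\<lambda>h. ((- (1 / (sin t)\<^sup>2) * mehler_kernel t x y) *\<^sub>R (y - cos t *\<^sub>R x)) \<bullet> h)) (at y)"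
proof -
  let ?v = "\<lambda>y. (1 / sin t) *\<^sub>R (y - cos t *\<^sub>R x)"
  have "((\<lambda>y. gauss_pdf (?v y)) has_derivative (\<lambda>h. - (gauss_pdf (?v y) *\<^sub>R ?v y) \<bullet> ((1 / sin t) *\<^sub>R h))) (at y)"
  proof (rule has_derivative_compose[where g = gauss_pdf and f = ?v])
    show "(?v has_derivative (\<lambda>h. (1 / sin t) *\<^sub>R h)) (at y)"
      by (auto intro!: derivative_eq_intros)
  qed (rule gauss_pdf_has_derivative)
  from has_derivative_mult_right[OF this, of "1 / sin t ^ CARD('n)"]
  show ?thesis using s
    by (simp add: mehler_kernel_def power2_eq_square algebra_simps)
qed

lemma norm_mehler_kernel_gradient:
  "norm ((cos t / (sin t)\<^sup>2 * mehler_kernel t x y) *\<^sub>R (y - cos t *\<^sub>R x :: real ^ 'n))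
    \<le> cos t / sin t ^ (Suc CARD('n)) * gauss_pdf (0 :: real ^ 'n)"
proof -
  let ?v = "(1 / sin t) *\<^sub>R (y - cos t *\<^sub>R x)"
  have "norm ((cos t / (sin t)\<^sup>2 * mehler_kernel t x y) *\<^sub>R (y - cos t *\<^sub>R x))
     = cos t / sin t ^ (Suc CARD('n)) * (norm ?v * gauss_pdf ?v)"
  proof -
    have "norm ((cos t / (sin t)\<^sup>2 * (p / sin t ^ CARD('n))) *\<^sub>R d) = cos t / sin t ^ (Suc CARD('n)) * (norm ((1 / sin t) *\<^sub>R d) * p)"
      if "p > 0" for p and d :: "real ^ 'n"
      using s c that by (simp add: abs_mult power2_eq_square mult_ac)
    from this[OF gauss_pdf_pos[of ?v]] show ?thesis by (simp only: mehler_kernel_def)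
  qed
  also have "\<dots> \<le> cos t / sin t ^ (Suc CARD('n)) * gauss_pdf (0 :: real ^ 'n)"
    using s c by (intro mult_left_mono norm_gauss_pdf_le) auto
  finally show ?thesis .
qed

lemma C_k_mehler_kernel: "C_k k (mehler_kernel t (x :: real ^ 'n))"
proof -
  have "C_k k (\<lambda>y. exp (- (1 / (2 * (sin t)\<^sup>2)) * (norm (y - cos t *\<^sub>R x))\<^sup>2 + 0))"
    by (rule C_k_compose[of "{exp}", OF _ C_k_norm_diff_sq]) (auto intro!: derivative_eq_intros)
  from C_k_mult[OF C_k_const[of k "(2 * pi) powr (- real CARD('n) / 2) / sin t ^ CARD('n)"] this]
  show ?thesis using s
    by (simp add: mehler_kernel_def[abs_def] gauss_pdf_def power_mult_distrib power_divide mult_ac)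
qed

end

text \<open>Compact support of \<open>\<zeta>\<close> makes the products with the locally integrable
  \<open>F\<close> and \<open>G\<close> integrable, and makes \<open>\<zeta>\<close> times a Mehler
  kernel a test function.\<close>

locale cutoff =
  fixes F :: "real ^ 'n \<Rightarrow> real" and G :: "real ^ 'n \<Rightarrow> real ^ 'n" and \<zeta> :: "real ^ 'n \<Rightarrow> real" and B R :: real
  assumes wg: "has_weak_gradient F G"
    and F_meas [measurable]: "F \<in> borel_measurable borel" and G_meas [measurable]: "G \<in> borel_measurable borel"
    and \<zeta>: "\<And>k. C_k k \<zeta>" and \<zeta>_bd: "\<And>y. \<bar>\<zeta> y\<bar> \<le> B" "\<And>y. norm (grad \<zeta> y) \<le> B"
    and \<zeta>_0: "\<And>y. R \<le> norm y \<Longrightarrow> \<zeta> y = 0" "\<And>y. R \<le> norm y \<Longrightarrow> grad \<zeta> y = 0"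
begin

text \<open>\<open>W\<close> is the weak gradient of \<open>P\<close>.\<close>

definition "P y = \<zeta> y * F y"
definition "W y = \<zeta> y *\<^sub>R G y + F y *\<^sub>R grad \<zeta> y"

lemma \<zeta>_meas [measurable]: "\<zeta> \<in> borel_measurable borel"
  using \<zeta>[of 0] by (simp add: borel_measurable_continuous_onI)

lemma grad_\<zeta>_meas [measurable]: "grad \<zeta> \<in> borel_measurable borel"
proof (rule borel_measurable_continuous_onI)
  have "continuous_on UNIV (\<lambda>x. grad \<zeta> x $ i)" for i using C_k_Suc_D(2)[OF \<zeta>[of "Suc 0"], of i] by simp
  then have "continuous_on UNIV (\<lambda>x. \<chi> i. grad \<zeta> x $ i)" by (intro continuous_on_vec_lambda)
  then show "continuous_on UNIV (grad \<zeta>)" by simp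
qed

lemma P_meas [measurable]: "P \<in> borel_measurable borel" unfolding P_def[abs_def] by measurable
lemma W_meas [measurable]: "W \<in> borel_measurable borel" unfolding W_def[abs_def] by measurable

lemma loc_int:
  "integrable lborel (\<lambda>y. indicator (cball 0 R) y *\<^sub>R F y)" "integrable lborel (\<lambda>y. indicator (cball 0 R) y *\<^sub>R G y)"
  using wg compact_cball[of "0 :: real ^ 'n" R]
  unfolding has_weak_gradient_def locally_integrable_def set_integrable_def by blast+

lemma int_parts:
  fixes q :: "real ^ 'n \<Rightarrow> 'b::euclidean_space" and \<omega> :: "real ^ 'n \<Rightarrow> real"
  assumes [measurable]: "q \<in> borel_measurable borel"
    and q: "integrable lborel (\<lambda>y. indicator (cball 0 R) y *\<^sub>R q y)"
    and \<omega>: "\<And>y. \<bar>\<omega> y\<bar> \<le> D" "\<And>y. R \<le> norm y \<Longrightarrow> \<omega> y = 0" and [measurable]: "\<omega> \<in> borel_measurable borel"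
  shows "integrable lborel (\<lambda>y. \<omega> y *\<^sub>R q y)"
proof (rule Bochner_Integration.integrable_bound)
  show "integrable lborel (\<lambda>y. D *\<^sub>R (indicator (cball 0 R) y *\<^sub>R q y))" by (intro integrable_scaleR_right q)
  show "AE y in lborel. norm (\<omega> y *\<^sub>R q y) \<le> norm (D *\<^sub>R (indicator (cball 0 R) y *\<^sub>R q y))"
  proof (rule AE_I2)
    fix y
    have D: "0 \<le> D" using order_trans[OF abs_ge_zero \<omega>(1)] .
    show "norm (\<omega> y *\<^sub>R q y) \<le> norm (D *\<^sub>R (indicator (cball 0 R) y *\<^sub>R q y))"
      using mult_right_mono[OF \<omega>(1)[of y], of "norm (q y)"] \<omega>(2)[of y] D
      by (cases "norm y \<le> R") (auto simp: indicator_def)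
  qed
qed measurable

lemma P_int: "integrable lborel P"
  using int_parts[OF F_meas loc_int(1) \<zeta>_bd(1) \<zeta>_0(1)] by (simp add: P_def[abs_def])

lemma W_int: "integrable lborel W"
proof -
  have 1: "integrable lborel (\<lambda>y. \<zeta> y *\<^sub>R G y)"
    by (rule int_parts[OF G_meas loc_int(2) \<zeta>_bd(1) \<zeta>_0(1)]) auto
  have 2: "integrable lborel (\<lambda>y. F y *\<^sub>R grad \<zeta> y)"
  proof (rule Bochner_Integration.integrable_bound)
    have n: "integrable lborel (\<lambda>y. norm (grad \<zeta> y) *\<^sub>R F y)"
      by (rule int_parts[OF F_meas loc_int(1), of _ B]) (use \<zeta>_bd(2) \<zeta>_0(2) in auto)
    then show "integrable lborel (\<lambda>y. norm (grad \<zeta> y) *\<^sub>R F y)" .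
  qed (auto intro!: AE_I2 simp: abs_mult)
  show ?thesis unfolding W_def[abs_def] using 1 2 by simp
qed

context
  fixes t :: real
  assumes s: "0 < sin t" and c: "0 < cos t"
begin

text \<open>Test the weak gradient of \<open>F\<close> against \<open>\<zeta>\<close> times the
  kernel, with \<open>x\<close> as a parameter. Differentiating the kernel in \<open>y\<close> gives
  the left side up to the factor \<open>- 1 / cos t\<close>; differentiating \<open>\<zeta>\<close>
  gives the term that completes \<open>G\<close> to \<open>W\<close>.\<close>

lemma weak_identity:
  "(LINT y|lborel. P y *\<^sub>R ((cos t / (sin t)\<^sup>2 * mehler_kernel t x y) *\<^sub>R (y - cos t *\<^sub>R x)))
    = cos t *\<^sub>R mehler t W x" (is "?L = _")
  and weak_identity_int:
  "integrable lborel (\<lambda>y. P y *\<^sub>R ((cos t / (sin t)\<^sup>2 * mehler_kernel t x y) *\<^sub>R (y - cos t *\<^sub>R x)))"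
proof -
  let ?k = "mehler_kernel t x"
  let ?g = "\<lambda>y. (cos t / (sin t)\<^sup>2 * ?k y) *\<^sub>R (y - cos t *\<^sub>R x)"
  show iL: "integrable lborel (\<lambda>y. P y *\<^sub>R ?g y)"
  proof (rule Bochner_Integration.integrable_bound)
    let ?D = "cos t / sin t ^ (Suc CARD('n)) * gauss_pdf (0 :: real ^ 'n)"
    show "integrable lborel (\<lambda>y. ?D * P y)" using P_int by simp
    show "AE y in lborel. norm (P y *\<^sub>R ?g y) \<le> norm (?D * P y)"
    proof (rule AE_I2)
      fix y
      have D: "0 \<le> ?D" using s c by (simp add: less_imp_le[OF gauss_pdf_pos])
      have "norm (P y *\<^sub>R ?g y) = \<bar>P y\<bar> * norm (?g y)" by (rule norm_scaleR)
      also have "\<dots> \<le> \<bar>P y\<bar> * ?D" by (rule mult_left_mono[OF norm_mehler_kernel_gradient[OF s c]]) simp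
      also have "\<dots> = norm (?D * P y)" by (rule abs_mult_nonneg[OF D])
      finally show "norm (P y *\<^sub>R ?g y) \<le> norm (?D * P y)" .
    qed
  qed measurable
  have iW: "integrable lborel (\<lambda>y. ?k y *\<^sub>R W y)"
  proof (rule Bochner_Integration.integrable_bound)
    let ?D = "gauss_pdf (0 :: real ^ 'n) / sin t ^ CARD('n)"
    show "integrable lborel (\<lambda>y. ?D *\<^sub>R W y)" using W_int by simp
    show "AE y in lborel. norm (?k y *\<^sub>R W y) \<le> norm (?D *\<^sub>R W y)"
    proof (rule AE_I2)
      fix y show "norm (?k y *\<^sub>R W y) \<le> norm (?D *\<^sub>R W y)"
        unfolding norm_scaleR
        by (rule mult_right_mono[OF abs_le_abs_pos[OF mehler_kernel_bounds[OF s c]] norm_ge_zero])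
    qed
  qed measurable
  have "?L = cos t *\<^sub>R (LINT y|lborel. ?k y *\<^sub>R W y)"
  proof (rule vec_eq_iff[THEN iffD2], rule allI)
    fix i
    define \<psi> where "\<psi> y = \<zeta> y * ?k y" for y
    have \<psi>: "\<psi> \<in> test_functions"
      unfolding \<psi>_def by (rule test_functionI[of _ R]) (auto intro: C_k_mult \<zeta> C_k_mehler_kernel[OF s c] simp: \<zeta>_0)
    have d\<psi>: "partial_deriv i \<psi> y = - (1 / (sin t)\<^sup>2) * (\<zeta> y * ?k y * (y - cos t *\<^sub>R x) $ i) + ?k y * grad \<zeta> y $ i" for y
    proof -
      have "(\<psi> has_derivative (\<lambda>h. (\<zeta> y *\<^sub>R ((- (1 / (sin t)\<^sup>2) * ?k y) *\<^sub>R (y - cos t *\<^sub>R x)) + ?k y *\<^sub>R grad \<zeta> y) \<bullet> h)) (at y)"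
        unfolding \<psi>_def
        by (rule has_gradient_mult[OF C_k_Suc_D(1)[OF \<zeta>[of "Suc 0"]] mehler_kernel_gradient_snd[OF s c]])
      from partial_deriv_eq[OF this] show ?thesis by (simp add: algebra_simps)
    qed
    have cp: "integrable lborel (\<lambda>y. f y $ i)" "(LINT y|lborel. f y) $ i = (LINT y|lborel. f y $ i)"
      if "integrable lborel f" for f :: "real ^ 'n \<Rightarrow> real ^ 'n"
      using that integrable_inner_left[of "axis i 1" lborel f] integral_inner_left[of "axis i (1 :: real)" lborel f]
      by (auto simp: inner_axis)
    have weak: "(LINT y|lborel. F y * partial_deriv i \<psi> y) = - (LINT y|lborel. G y $ i * \<psi> y)"
      using wg \<psi> unfolding has_weak_gradient_def by blast
    have iL': "integrable lborel (\<lambda>y. (1 / cos t) * (P y *\<^sub>R ?g y) $ i)"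
      by (intro integrable_mult_right cp(1)[OF iL])
    have ikG: "integrable lborel (\<lambda>y. (?k y * \<zeta> y) *\<^sub>R G y)"
    proof (rule int_parts[OF G_meas loc_int(2), of _ "gauss_pdf (0 :: real ^ 'n) / sin t ^ CARD('n) * B"])
      show "\<bar>?k y * \<zeta> y\<bar> \<le> gauss_pdf (0 :: real ^ 'n) / sin t ^ CARD('n) * B" for y
        unfolding abs_mult using mehler_kernel_bounds[OF s c, of x y] by (intro mult_mono \<zeta>_bd) auto
    qed (auto simp: \<zeta>_0)
    have iG: "integrable lborel (\<lambda>y. G y $ i * \<psi> y)"
      using cp(1)[OF ikG] by (simp add: \<psi>_def mult_ac)
    \<comment> \<open>Obtained as a difference: a component of the kernel times \<open>W\<close>,
      minus its \<open>G\<close> part.\<close>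
    have iFk: "integrable lborel (\<lambda>y. F y * (?k y * grad \<zeta> y $ i))"
      using Bochner_Integration.integrable_diff[OF cp(1)[OF iW] iG]
      by (simp add: W_def \<psi>_def algebra_simps)
    have "(LINT y|lborel. F y * partial_deriv i \<psi> y)
      = (LINT y|lborel. F y * (?k y * grad \<zeta> y $ i) - (1 / cos t) * (P y *\<^sub>R ?g y) $ i)"
    proof (intro Bochner_Integration.integral_cong refl)
      have alg: "a * (- (1 / (sin t)\<^sup>2) * (z * k * d) + k * e) = a * (k * e) - (1 / cos t) * ((z * a) * (cos t / (sin t)\<^sup>2 * k * d))"
        for a z k d e using c by (simp add: field_simps)
      show "F y * partial_deriv i \<psi> y = F y * (?k y * grad \<zeta> y $ i) - (1 / cos t) * (P y *\<^sub>R ?g y) $ i" for y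
        by (simp only: d\<psi> P_def vector_scaleR_component real_scaleR_def alg)
    qed
    also have "\<dots> = (LINT y|lborel. F y * (?k y * grad \<zeta> y $ i)) - (1 / cos t) * ?L $ i"
      unfolding Bochner_Integration.integral_diff[OF iFk iL'] cp(2)[OF iL] integral_mult_right_zero ..
    finally have "?L $ i = cos t * ((LINT y|lborel. F y * (?k y * grad \<zeta> y $ i)) + (LINT y|lborel. G y $ i * \<psi> y))"
      using weak c by (simp add: field_simps)
    also have "\<dots> = cos t * (LINT y|lborel. F y * (?k y * grad \<zeta> y $ i) + G y $ i * \<psi> y)"
      using iFk iG by simp
    also have "(LINT y|lborel. F y * (?k y * grad \<zeta> y $ i) + G y $ i * \<psi> y) = (LINT y|lborel. ?k y *\<^sub>R W y) $ i"
      unfolding cp(2)[OF iW] by (intro Bochner_Integration.integral_cong refl) (simp add: W_def \<psi>_def algebra_simps)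
    finally show "?L $ i = (cos t *\<^sub>R (LINT y|lborel. ?k y *\<^sub>R W y)) $ i" by simp
  qed
  then show "?L = cos t *\<^sub>R mehler t W x" by (simp add: mehler_eq_kernel[OF W_meas s])
qed

text \<open>The derivative falls on the kernel, which is Lipschitz in \<open>x\<close> uniformly in
  \<open>y\<close>, so integrability of \<open>P\<close> suffices as majorant;
  \<open>weak_identity\<close> then evaluates the result.\<close>

lemma mehler_cutoff_gradient:
  "(mehler t P has_derivative (\<lambda>h. (cos t *\<^sub>R mehler t W x) \<bullet> h)) (at x)"
proof -
  let ?D = "cos t / sin t ^ (Suc CARD('n)) * gauss_pdf (0 :: real ^ 'n)"
  let ?g = "\<lambda>x y. (cos t / (sin t)\<^sup>2 * mehler_kernel t x y) *\<^sub>R (y - cos t *\<^sub>R x)"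
  have D: "0 \<le> ?D" using s c by (simp add: less_imp_le[OF gauss_pdf_pos])
  have lip: "\<bar>mehler_kernel t x' y - mehler_kernel t x y\<bar> \<le> ?D * norm (x' - x)" for x' y
  proof -
    have "norm (mehler_kernel t x' y - mehler_kernel t x y) \<le> ?D * norm (x' - x)"
    proof (rule differentiable_bound[of UNIV "\<lambda>x. mehler_kernel t x y" "\<lambda>x h. ?g x y \<bullet> h" ?D])
      show "onorm ((\<bullet>) (?g x y)) \<le> ?D" for x
      proof (rule onorm_bound[OF D])
        show "norm (?g x y \<bullet> h) \<le> ?D * norm h" for h
          using Cauchy_Schwarz_ineq2[of "?g x y" h] mult_right_mono[OF norm_mehler_kernel_gradient[OF s c, of x y], of "norm h"]
          by simp
      qed
    qed (use mehler_kernel_gradient_fst[OF s c] in \<open>simp_all add: has_derivative_at_withinI\<close>)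
    then show ?thesis by simp
  qed
  have "((\<lambda>x. LINT y|lborel. mehler_kernel t x y * P y) has_derivative (\<lambda>h. (LINT y|lborel. P y *\<^sub>R ?g x y) \<bullet> h)) (at x)"
  proof (rule has_derivative_integral(2)[where r = 1 and B = "\<lambda>y. ?D * \<bar>P y\<bar>"])
    show "integrable lborel (\<lambda>y. mehler_kernel t x' y * P y)" for x'
    proof (rule Bochner_Integration.integrable_bound)
      let ?D' = "gauss_pdf (0 :: real ^ 'n) / sin t ^ CARD('n)"
      show "integrable lborel (\<lambda>y. ?D' * P y)" using P_int by simp
      show "AE y in lborel. norm (mehler_kernel t x' y * P y) \<le> norm (?D' * P y)"
      proof (rule AE_I2)
        fix y show "norm (mehler_kernel t x' y * P y) \<le> norm (?D' * P y)"
          unfolding real_norm_def abs_mult[of _ "P y"]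
          by (rule mult_right_mono[OF abs_le_abs_pos[OF mehler_kernel_bounds[OF s c]] abs_ge_zero])
      qed
    qed measurable
    show "((\<lambda>x. mehler_kernel t x y * P y) has_derivative (\<lambda>h. (P y *\<^sub>R ?g x y) \<bullet> h)) (at x)" for y
      using has_derivative_mult_left[OF mehler_kernel_gradient_fst[OF s c, of y x], of "P y"]
      by (simp add: mult_ac)
    show "norm (P y *\<^sub>R ?g x y) \<le> ?D * \<bar>P y\<bar>" for y
      using mult_left_mono[OF norm_mehler_kernel_gradient[OF s c, of x y], of "\<bar>P y\<bar>"]
      by (simp only: norm_scaleR mult.commute)
    show "\<bar>mehler_kernel t x' y * P y - mehler_kernel t x y * P y\<bar> \<le> ?D * \<bar>P y\<bar> * norm (x' - x)" for x' y
      using mult_right_mono[OF lip[of x' y], of "\<bar>P y\<bar>"]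
      by (simp only: left_diff_distrib[symmetric] abs_mult) (simp only: mult_ac)
    show "integrable lborel (\<lambda>y. ?D * \<bar>P y\<bar>)" using P_int by (intro integrable_mult_right integrable_abs)
  qed (auto intro!: borel_measurable_integrable weak_identity_int)
  then show ?thesis
    unfolding weak_identity by (simp add: mehler_eq_kernel[OF P_meas s, abs_def])
qed

lemma mehler_cutoff_bounded:
  obtains K where "\<And>x. \<bar>mehler t P x\<bar> \<le> K" "\<And>x. norm (mehler t W x) \<le> K"
proof -
  let ?D = "gauss_pdf (0 :: real ^ 'n) / sin t ^ CARD('n)"
  have bd: "norm (mehler t q x) \<le> ?D * (LINT y|lborel. norm (q y))"
    if q: "integrable lborel q" for q :: "real ^ 'n \<Rightarrow> 'b::euclidean_space" and x
  proof -
    have [measurable]: "q \<in> borel_measurable borel" using borel_measurable_integrable[OF q] by simp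
    have "norm (mehler t q x) \<le> (LINT y|lborel. norm (mehler_kernel t x y *\<^sub>R q y))"
      unfolding mehler_eq_kernel[OF \<open>q \<in> borel_measurable borel\<close> s] by (rule integral_norm_bound)
    also have "\<dots> \<le> (LINT y|lborel. ?D * norm (q y))"
    proof (rule integral_mono')
      show "integrable lborel (\<lambda>y. ?D * norm (q y))" using q by simp
      show "norm (mehler_kernel t x y *\<^sub>R q y) \<le> ?D * norm (q y)" for y
        unfolding norm_scaleR using mehler_kernel_bounds[OF s c, of x y]
        by (intro mult_right_mono) auto
      show "0 \<le> ?D * norm (q y)" for y using s by (simp add: less_imp_le[OF gauss_pdf_pos])
    qed
    finally show ?thesis by simp
  qed
  show thesis
  proof (rule that[of "max (?D * (LINT y|lborel. norm (P y))) (?D * (LINT y|lborel. norm (W y)))"])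
    show "\<bar>mehler t P x\<bar> \<le> max (?D * (LINT y|lborel. norm (P y))) (?D * (LINT y|lborel. norm (W y)))" for x
      using bd[OF P_int, of x] by simp
    show "norm (mehler t W x) \<le> max (?D * (LINT y|lborel. norm (P y))) (?D * (LINT y|lborel. norm (W y)))" for x
      using bd[OF W_int, of x] by simp
  qed
qed

lemma mehler_cutoff_bounded_gradient:
  obtains K where "bounded_gradient (mehler t P) (\<lambda>x. cos t *\<^sub>R mehler t W x) K"
proof -
  obtain K where K: "\<And>x. \<bar>mehler t P x\<bar> \<le> K" "\<And>x. norm (mehler t W x) \<le> K"
    using mehler_cutoff_bounded by blast
  have "bounded_gradient (mehler t P) (\<lambda>x. cos t *\<^sub>R mehler t W x) K"
  proof
    show "norm (cos t *\<^sub>R mehler t W x) \<le> K" for x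
      using mult_mono[OF abs_cos_le_one[of t] K(2)[of x]] by simp
  qed (use K in \<open>simp_all add: mehler_cutoff_gradient[unfolded inner_scaleR_left]\<close>)
  then show thesis by (rule that)
qed

end

end

section \<open>Limits of quadratic expressions as the angle tends to 0\<close>

lemma mehler_jensen:
  fixes w :: "real ^ 'n \<Rightarrow> 'b::{banach, second_countable_topology}"
  assumes t: "cos t \<noteq> - 1" and w: "integrable gauss w" and H: "integrable gauss H" and le: "\<And>x. (norm (w x))\<^sup>2 \<le> H x"
  shows "AE x in gauss. (norm (mehler t w x))\<^sup>2 \<le> mehler t H x"
  using AE_mehler_integrable[OF t w] AE_mehler_integrable[OF t H]
proof eventually_elim
  case (elim x)
  have "(norm (LINT z|gauss. w (cos t *\<^sub>R x + sin t *\<^sub>R z)))\<^sup>2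
    \<le> (LINT z|gauss. H (cos t *\<^sub>R x + sin t *\<^sub>R z)) * (LINT z|(gauss :: (real ^ 'n) measure). 1)"
    by (rule norm_integral_square_le[OF elim]) (use le order_trans[OF zero_le_power2 le] in auto)
  then show ?case by (simp add: mehler_def)
qed

lemma vec_nth_measurable [measurable (raw)]:
  fixes f :: "'a \<Rightarrow> real ^ 'n"
  assumes "f \<in> borel_measurable M"
  shows "(\<lambda>x. f x $ i) \<in> borel_measurable M"
  using borel_measurable_inner[OF assms borel_measurable_const, of "axis i 1"] by (simp add: inner_axis)

text \<open>Clipping \<open>X m\<close> to \<open>[- H0, H0]\<close> changes it by at most \<open>|H m - H0|\<close>.\<close>

lemma tendsto_integral_generalized_dominated:
  fixes X :: "nat \<Rightarrow> 'a \<Rightarrow> real"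
  assumes X [measurable]: "\<And>m. X m \<in> borel_measurable M" and X0 [measurable]: "X0 \<in> borel_measurable M"
    and H: "\<And>m. integrable M (H m)" and H0: "integrable M H0"
    and lim: "AE x in M. (\<lambda>m. X m x) \<longlonglongrightarrow> X0 x"
    and bd: "\<And>m. AE x in M. \<bar>X m x\<bar> \<le> H m x" and bd0: "AE x in M. \<bar>X0 x\<bar> \<le> H0 x"
    and HH: "(\<lambda>m. LINT x|M. \<bar>H m x - H0 x\<bar>) \<longlonglongrightarrow> 0"
  shows "(\<lambda>m. LINT x|M. X m x) \<longlonglongrightarrow> (LINT x|M. X0 x)"
proof -
  have [measurable]: "H m \<in> borel_measurable M" "H0 \<in> borel_measurable M" for m using H H0 by auto
  define Y where "Y m x = max (- H0 x) (min (H0 x) (X m x))" for m x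
  have [measurable]: "Y m \<in> borel_measurable M" for m unfolding Y_def by measurable
  have Y: "(\<lambda>m. LINT x|M. Y m x) \<longlonglongrightarrow> (LINT x|M. X0 x)"
  proof (rule integral_dominated_convergence[where w = H0])
    show "AE x in M. (\<lambda>m. Y m x) \<longlonglongrightarrow> X0 x"
      using lim bd0
    proof eventually_elim
      case (elim x)
      have "(\<lambda>m. Y m x) \<longlonglongrightarrow> max (- H0 x) (min (H0 x) (X0 x))"
        unfolding Y_def by (intro tendsto_intros elim)
      then show ?case using elim(2) by (simp add: max_def min_def abs_le_iff split: if_splits)
    qed
    show "AE x in M. norm (Y m x) \<le> H0 x" for m
      using bd0 by eventually_elim (auto simp: Y_def)
  qed (use H0 in auto)
  have iX: "integrable M (X m)" for m
    by (rule Bochner_Integration.integrable_bound[OF H[of m]]) (use bd[of m] in \<open>auto elim!: eventually_mono\<close>)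
  have iY: "integrable M (Y m)" for m
    by (rule Bochner_Integration.integrable_bound[OF H0]) (use bd0 in \<open>auto elim!: eventually_mono simp: Y_def\<close>)
  have le: "\<bar>(LINT x|M. X m x) - (LINT x|M. Y m x)\<bar> \<le> (LINT x|M. \<bar>H m x - H0 x\<bar>)" for m
  proof -
    have "\<bar>(LINT x|M. X m x) - (LINT x|M. Y m x)\<bar> = \<bar>LINT x|M. X m x - Y m x\<bar>" using iX iY by simp
    also have "\<dots> \<le> (LINT x|M. \<bar>X m x - Y m x\<bar>)" by (rule integral_abs_bound)
    also have "\<dots> \<le> (LINT x|M. \<bar>H m x - H0 x\<bar>)"
    proof (rule integral_mono_AE)
      show "AE x in M. \<bar>X m x - Y m x\<bar> \<le> \<bar>H m x - H0 x\<bar>"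
        using bd[of m] bd0 by eventually_elim (auto simp: Y_def)
    qed (use iX iY H H0 in auto)
    finally show ?thesis .
  qed
  have "(\<lambda>m. (LINT x|M. X m x) - (LINT x|M. Y m x)) \<longlonglongrightarrow> 0"
    by (rule Lim_null_comparison[OF _ HH]) (use le in auto)
  from tendsto_add[OF this Y] show ?thesis by simp
qed

lemma integrable_of_square:
  fixes w :: "real ^ 'n \<Rightarrow> 'b::{banach, second_countable_topology}"
  assumes [measurable]: "w \<in> borel_measurable borel" and sq: "integrable gauss (\<lambda>x. (norm (w x))\<^sup>2)"
  shows "integrable gauss w"
proof (rule Bochner_Integration.integrable_bound)
  show "integrable gauss (\<lambda>x. (norm (w x))\<^sup>2 + 1)" using sq by simp
  show "AE x in gauss. norm (w x) \<le> norm ((norm (w x))\<^sup>2 + 1)"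
  proof (rule AE_I2)
    fix x show "norm (w x) \<le> norm ((norm (w x))\<^sup>2 + 1)"
      using sum_squares_bound[of "norm (w x)" "1 / 2"] by (simp add: power2_eq_square add_nonneg_nonneg)
  qed
qed simp

text \<open>The products have no fixed majorant, but by Jensen they are dominated by
  \<open>mehler\<close> of \<open>H\<close>, which converges in L1; hence the generalized dominated
  convergence. One subsequence serves all weights and all components.\<close>

lemma mehler_square_limit:
  fixes v :: "real ^ 'n \<Rightarrow> real" and p :: "real ^ 'n \<Rightarrow> real ^ 'n"
  assumes [measurable]: "v \<in> borel_measurable borel" "p \<in> borel_measurable borel"
    and v2: "integrable gauss (\<lambda>x. (v x)\<^sup>2)" and p2: "integrable gauss (\<lambda>x. (norm (p x))\<^sup>2)"
    and t: "t \<longlonglongrightarrow> 0" and t': "\<And>j. cos (t j) \<noteq> - 1"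
  obtains r :: "nat \<Rightarrow> nat" where "strict_mono r"
    "\<And>\<omega> C. \<omega> \<in> borel_measurable borel \<Longrightarrow> (\<And>x. \<bar>\<omega> x\<bar> \<le> C) \<Longrightarrow>
       (\<lambda>m. LINT x|gauss. (mehler (t (r m)) v x)\<^sup>2 * \<omega> x) \<longlonglongrightarrow> (LINT x|gauss. (v x)\<^sup>2 * \<omega> x)"
    "\<And>\<omega> C i. \<omega> \<in> borel_measurable borel \<Longrightarrow> (\<And>x. \<bar>\<omega> x\<bar> \<le> C) \<Longrightarrow>
       (\<lambda>m. LINT x|gauss. mehler (t (r m)) v x * mehler (t (r m)) p x $ i * \<omega> x) \<longlonglongrightarrow> (LINT x|gauss. v x * p x $ i * \<omega> x)"
proof -
  have v: "integrable gauss v" by (rule integrable_of_square) (use v2 in simp_all)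
  have p: "integrable gauss p" by (rule integrable_of_square) (use p2 in simp_all)
  define H where "H x = (v x)\<^sup>2 + (norm (p x))\<^sup>2" for x
  have H: "integrable gauss H" unfolding H_def[abs_def] using v2 p2 by simp
  have [measurable]: "H \<in> borel_measurable borel" unfolding H_def[abs_def] by measurable
  \<comment> \<open>A single sum, so that one subsequence gives almost everywhere convergence of the
    mollifications of \<open>v\<close> and \<open>p\<close> at once.\<close>
  define D where "D m x = norm (mehler (t m) v x - v x) + norm (mehler (t m) p x - p x) + norm (mehler (t m) H x - H x)" for m x
  have iM: "integrable gauss (mehler (t m) v)" "integrable gauss (mehler (t m) p)" "integrable gauss (mehler (t m) H)" for m
    by (intro mehler_integrable[OF t'] v p H)+
  have iD: "integrable gauss (D m)" for m unfolding D_def[abs_def] using iM v p H by simp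
  have "(\<lambda>m. LINT x|gauss. norm (D m x)) \<longlonglongrightarrow> 0"
  proof -
    have "(LINT x|gauss. norm (D m x)) = (LINT x|gauss. norm (mehler (t m) v x - v x))
      + (LINT x|gauss. norm (mehler (t m) p x - p x)) + (LINT x|gauss. norm (mehler (t m) H x - H x))" for m
      unfolding D_def using iM v p H by simp
    then show ?thesis
      using tendsto_add[OF tendsto_add[OF mehler_L1_tendsto[OF v t t'] mehler_L1_tendsto[OF p t t']] mehler_L1_tendsto[OF H t t']]
      by simp
  qed
  from tendsto_L1_AE_subseq[OF iD this] obtain r :: "nat \<Rightarrow> nat"
    where r: "strict_mono r" and D: "AE x in gauss. (\<lambda>m. D (r m) x) \<longlonglongrightarrow> 0" by blast
  have AE: "AE x in gauss. (\<lambda>m. mehler (t (r m)) v x) \<longlonglongrightarrow> v x \<and> (\<lambda>m. mehler (t (r m)) p x) \<longlonglongrightarrow> p x"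
    using D
  proof eventually_elim
    case (elim x)
    have 1: "(\<lambda>m. mehler (t (r m)) v x - v x) \<longlonglongrightarrow> 0"
      by (rule Lim_null_comparison[OF _ elim]) (auto simp: D_def intro!: always_eventually)
    have 2: "(\<lambda>m. mehler (t (r m)) p x - p x) \<longlonglongrightarrow> 0"
      by (rule Lim_null_comparison[OF _ elim]) (auto simp: D_def intro!: always_eventually)
    show ?case using 1 2 by (simp add: LIM_zero_iff)
  qed
  have bdv: "AE x in gauss. (norm (mehler (t m) v x))\<^sup>2 \<le> mehler (t m) H x" for m
    by (rule mehler_jensen[OF t' v H]) (simp add: H_def)
  have bdp: "AE x in gauss. (norm (mehler (t m) p x))\<^sup>2 \<le> mehler (t m) H x" for m
    by (rule mehler_jensen[OF t' p H]) (simp add: H_def)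
  have HH: "(\<lambda>m. LINT x|gauss. \<bar>C * mehler (t (r m)) H x - C * H x\<bar>) \<longlonglongrightarrow> 0" for C
  proof -
    have "(\<lambda>m. \<bar>C\<bar> * (LINT x|gauss. norm (mehler (t (r m)) H x - H x))) \<longlonglongrightarrow> \<bar>C\<bar> * 0"
      using LIMSEQ_subseq_LIMSEQ[OF mehler_L1_tendsto[OF H t t'] r] by (intro tendsto_mult_left) (simp add: o_def)
    moreover have "\<bar>C\<bar> * (LINT x|gauss. norm (mehler (t (r m)) H x - H x)) = (LINT x|gauss. \<bar>C * mehler (t (r m)) H x - C * H x\<bar>)" for m
      by (subst integral_mult_right_zero[symmetric]) (simp add: abs_mult[symmetric] right_diff_distrib)
    ultimately show ?thesis by simp
  qed
  show thesis
  proof (rule that[OF r])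
    fix \<omega> :: "real ^ 'n \<Rightarrow> real" and C
    assume [measurable]: "\<omega> \<in> borel_measurable borel" and \<omega>: "\<And>x. \<bar>\<omega> x\<bar> \<le> C"
    have C: "0 \<le> C" using order_trans[OF abs_ge_zero \<omega>] .
    show "(\<lambda>m. LINT x|gauss. (mehler (t (r m)) v x)\<^sup>2 * \<omega> x) \<longlonglongrightarrow> (LINT x|gauss. (v x)\<^sup>2 * \<omega> x)"
    proof (rule tendsto_integral_generalized_dominated[OF _ _ _ _ _ _ _ HH[of C]])
      show "AE x in gauss. (\<lambda>m. (mehler (t (r m)) v x)\<^sup>2 * \<omega> x) \<longlonglongrightarrow> (v x)\<^sup>2 * \<omega> x"
        using AE by eventually_elim (auto intro!: tendsto_intros)
      show "AE x in gauss. \<bar>(mehler (t (r m)) v x)\<^sup>2 * \<omega> x\<bar> \<le> C * mehler (t (r m)) H x" for m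
        using bdv[of "r m"]
      proof eventually_elim
        case (elim x)
        have "\<bar>\<omega> x\<bar> * (mehler (t (r m)) v x)\<^sup>2 \<le> C * mehler (t (r m)) H x"
          using elim by (intro mult_mono \<omega> C) auto
        then show ?case by (simp add: abs_mult mult.commute)
      qed
      show "AE x in gauss. \<bar>(v x)\<^sup>2 * \<omega> x\<bar> \<le> C * H x"
      proof (rule AE_I2)
        fix x
        have "\<bar>\<omega> x\<bar> * (v x)\<^sup>2 \<le> C * H x" by (intro mult_mono \<omega> C) (auto simp: H_def)
        then show "\<bar>(v x)\<^sup>2 * \<omega> x\<bar> \<le> C * H x" by (simp add: abs_mult mult.commute)
      qed
    qed (use iM H in auto)
    fix i
    have prod: "\<bar>a * b $ i * \<omega> x\<bar> \<le> C * h" if "(norm a)\<^sup>2 \<le> h" "(norm b)\<^sup>2 \<le> h" for a :: real and b :: "real ^ 'n" and h x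
    proof -
      have "\<bar>a\<bar> * \<bar>b $ i\<bar> \<le> norm a * norm b" using component_le_norm_cart[of b i] by (intro mult_mono) auto
      also have "\<dots> \<le> h" using sum_squares_bound[of "norm a" "norm b"] that by linarith
      finally have "\<bar>\<omega> x\<bar> * (\<bar>a\<bar> * \<bar>b $ i\<bar>) \<le> C * h" by (intro mult_mono \<omega> C) auto
      then show ?thesis by (simp add: abs_mult mult_ac)
    qed
    show "(\<lambda>m. LINT x|gauss. mehler (t (r m)) v x * mehler (t (r m)) p x $ i * \<omega> x) \<longlonglongrightarrow> (LINT x|gauss. v x * p x $ i * \<omega> x)"
    proof (rule tendsto_integral_generalized_dominated[OF _ _ _ _ _ _ _ HH[of C]])
      show "AE x in gauss. (\<lambda>m. mehler (t (r m)) v x * mehler (t (r m)) p x $ i * \<omega> x) \<longlonglongrightarrow> v x * p x $ i * \<omega> x"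
        using AE by eventually_elim (auto intro!: tendsto_intros)
      show "AE x in gauss. \<bar>mehler (t (r m)) v x * mehler (t (r m)) p x $ i * \<omega> x\<bar> \<le> C * mehler (t (r m)) H x" for m
        using bdv[of "r m"] bdp[of "r m"] by eventually_elim (rule prod)
      show "AE x in gauss. \<bar>v x * p x $ i * \<omega> x\<bar> \<le> C * H x"
        by (rule AE_I2, rule prod) (simp_all add: H_def)
    qed (use iM H in auto)
  qed
qed

section \<open>Local integrability, test functions and the concrete cutoffs\<close>

lemma locally_integrable_gauss:
  fixes F :: "real ^ 'n \<Rightarrow> 'b::euclidean_space"
  assumes "integrable gauss F"
  shows "locally_integrable F"
  unfolding locally_integrable_def set_integrable_def
proof (intro allI impI)
  fix K :: "(real ^ 'n) set" assume K: "compact K"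
  have F [measurable]: "F \<in> borel_measurable borel" using borel_measurable_integrable[OF assms] by simp
  have [measurable]: "K \<in> sets borel" using K by (simp add: borel_compact)
  obtain R where R: "\<And>x. x \<in> K \<Longrightarrow> norm x \<le> R" using compact_imp_bounded[OF K] by (auto simp: bounded_iff)
  define c where "c = (2 * pi) powr (- real CARD('n) / 2) * exp (- R\<^sup>2 / 2)"
  have c: "c > 0" by (simp add: c_def)
  have pdf: "c \<le> gauss_pdf x" if "x \<in> K" for x
    unfolding c_def gauss_pdf_def using power_mono[OF R[OF that] norm_ge_zero, of 2] by (intro mult_left_mono) auto
  show "integrable lborel (\<lambda>x. indicator K x *\<^sub>R F x)"
  proof (rule Bochner_Integration.integrable_bound)
    show "integrable lborel (\<lambda>x. (1 / c) *\<^sub>R (gauss_pdf x *\<^sub>R F x))"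
      using assms by (subst (asm) integrable_gauss_iff[OF F]) (intro integrable_scaleR_right)
    show "AE x in lborel. norm (indicator K x *\<^sub>R F x) \<le> norm ((1 / c) *\<^sub>R (gauss_pdf x *\<^sub>R F x))"
    proof (rule AE_I2)
      fix x
      show "norm (indicator K x *\<^sub>R F x) \<le> norm ((1 / c) *\<^sub>R (gauss_pdf x *\<^sub>R F x))"
      proof (cases "x \<in> K")
        case True
        have "1 * norm (F x) \<le> (1 / c * gauss_pdf x) * norm (F x)"
          using pdf[OF True] c by (intro mult_right_mono) auto
        then show ?thesis using True c by (simp add: abs_of_pos[OF gauss_pdf_pos])
      qed simp
    qed
  qed measurable
qed

text \<open>A gradient picked by \<open>SOME\<close> is known only through
  \<open>has_weak_gradient\<close>; this supplies its measurability.\<close>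

lemma locally_integrable_measurable:
  fixes F :: "real ^ 'n \<Rightarrow> 'b::euclidean_space"
  assumes "locally_integrable F"
  shows "F \<in> borel_measurable borel"
proof (rule borel_measurable_LIMSEQ_metric)
  show "(\<lambda>x. indicator (cball 0 (real m)) x *\<^sub>R F x) \<in> borel_measurable borel" for m
    using assms borel_measurable_integrable[of lborel "\<lambda>x. indicator (cball 0 (real m)) x *\<^sub>R F x"]
    unfolding locally_integrable_def set_integrable_def by simp
  fix x :: "real ^ 'n"
  obtain N where N: "norm x \<le> real N" using real_arch_simple by blast
  have "indicator (cball 0 (real m)) x *\<^sub>R F x = F x" if "m \<ge> N" for m
    using N that by (auto simp: indicator_def)
  then have "eventually (\<lambda>m. indicator (cball 0 (real m)) x *\<^sub>R F x = F x) sequentially"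
    by (auto simp: eventually_sequentially)
  then show "(\<lambda>m. indicator (cball 0 (real m)) x *\<^sub>R F x) \<longlonglongrightarrow> F x" by (rule tendsto_eventually)
qed

lemma grad_zero_at_min:
  fixes \<phi> :: "real ^ 'n \<Rightarrow> real"
  assumes d: "\<phi> differentiable at x" and min: "\<And>y. \<phi> x \<le> \<phi> y"
  shows "grad \<phi> x = 0"
proof -
  have "(\<lambda>h. grad \<phi> x \<bullet> h) = (\<lambda>h. 0)"
    by (rule differential_zero_maxmin[OF _ open_UNIV has_derivative_grad[OF d]]) (use min in auto)
  then have "grad \<phi> x \<bullet> grad \<phi> x = 0" by metis
  then show ?thesis by simp
qed

lemma test_functionD:
  fixes \<phi> :: "real ^ 'n \<Rightarrow> real"
  assumes \<phi>: "\<phi> \<in> test_functions"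
  obtains B R where "0 \<le> B" "\<And>y. \<bar>\<phi> y\<bar> \<le> B" "\<And>y. norm (grad \<phi> y) \<le> B"
    "\<And>y. R \<le> norm y \<Longrightarrow> \<phi> y = 0" "\<And>y. R \<le> norm y \<Longrightarrow> grad \<phi> y = 0"
    "\<And>y. (\<phi> has_derivative (\<lambda>h. grad \<phi> y \<bullet> h)) (at y)" "continuous_on UNIV \<phi>" "continuous_on UNIV (grad \<phi>)"
proof -
  let ?S = "closure {x. \<phi> x \<noteq> 0}"
  have C: "C_k k \<phi>" for k using \<phi> by (simp add: test_functions_def)
  have S: "compact ?S" using \<phi> by (simp add: test_functions_def)
  have der: "(\<phi> has_derivative (\<lambda>h. grad \<phi> y \<bullet> h)) (at y)" for y by (rule C_k_Suc_D(1)[OF C[of "Suc 0"]])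
  have cont: "continuous_on UNIV \<phi>" using C[of 0] by simp
  have gcont: "continuous_on UNIV (grad \<phi>)"
  proof -
    have "continuous_on UNIV (\<lambda>x. grad \<phi> x $ i)" for i using C_k_Suc_D(2)[OF C[of "Suc 0"], of i] by simp
    then have "continuous_on UNIV (\<lambda>x. \<chi> i. grad \<phi> x $ i)" by (intro continuous_on_vec_lambda)
    then show ?thesis by simp
  qed
  have out: "\<phi> y = 0" "grad \<phi> y = 0" if y: "y \<notin> ?S" for y
  proof -
    show "\<phi> y = 0" using y closure_subset[of "{x. \<phi> x \<noteq> 0}"] by auto
    have "((\<lambda>x. 0) has_derivative (\<lambda>h. grad \<phi> y \<bullet> h)) (at y)"
    proof (rule has_derivative_transform_within_open[OF der])
      show "open (- ?S)" by (intro open_Compl closed_closure)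
      show "\<phi> z = 0" if "z \<in> - ?S" for z using that closure_subset[of "{x. \<phi> x \<noteq> 0}"] by auto
    qed (use y in simp)
    then have "(\<lambda>h. grad \<phi> y \<bullet> h) = (\<lambda>h. 0)" by (rule has_derivative_unique) simp
    then have "grad \<phi> y \<bullet> grad \<phi> y = 0" by metis
    then show "grad \<phi> y = 0" by simp
  qed
  obtain R0 where R0: "\<And>x. x \<in> ?S \<Longrightarrow> norm x \<le> R0" using compact_imp_bounded[OF S] by (auto simp: bounded_iff)
  have "bounded (\<phi> ` ?S)" "bounded (grad \<phi> ` ?S)"
    by (intro compact_imp_bounded compact_continuous_image S continuous_on_subset[OF cont] continuous_on_subset[OF gcont] subset_UNIV)+
  then obtain B1 B2 where B: "\<And>y. y \<in> ?S \<Longrightarrow> norm (\<phi> y) \<le> B1" "\<And>y. y \<in> ?S \<Longrightarrow> norm (grad \<phi> y) \<le> B2"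
    unfolding bounded_iff by auto
  \<comment> \<open>One unit of margin: a point of norm exactly \<open>R0\<close> may still lie in
    the support.\<close>
  have outR: "y \<notin> ?S" if "R0 + 1 \<le> norm y" for y using R0[of y] that by auto
  show thesis
  proof (rule that[of "max 0 (max B1 B2)" "R0 + 1"])
    show "\<bar>\<phi> y\<bar> \<le> max 0 (max B1 B2)" for y
      using B(1)[of y] out(1)[of y] by (cases "y \<in> ?S") auto
    show "norm (grad \<phi> y) \<le> max 0 (max B1 B2)" for y
      using B(2)[of y] out(2)[of y] by (cases "y \<in> ?S") auto
    show "\<phi> y = 0" "grad \<phi> y = 0" if "R0 + 1 \<le> norm y" for y
      by (rule out[OF outR[OF that]])+
  qed (use der cont gcont in simp_all)
qed

text \<open>From radius \<open>R\<close> on, \<open>bump R\<close> attains its minimum 0, which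
  settles the boundary sphere as well.\<close>

lemma grad_bump_outside: "R > 0 \<Longrightarrow> R \<le> norm y \<Longrightarrow> grad (bump R) y = 0"
  by (rule grad_zero_at_min)
    (use C_k_bump[of "Suc 0" R] bump_bounds(1) bump_outside[of R y] in auto)

lemma cutoff_bump:
  assumes "has_weak_gradient F G" "F \<in> borel_measurable borel" "G \<in> borel_measurable borel" and R: "R > 0"
  shows "cutoff F G (bump R) (max 1 (4 * exp 1 / R)) R"
proof
  show "norm (grad (bump R) y) \<le> max 1 (4 * exp 1 / R)" for y :: "real ^ 'n" using norm_grad_bump[OF R, of y] by simp
  show "\<bar>bump R y\<bar> \<le> max 1 (4 * exp 1 / R)" for y :: "real ^ 'n" using bump_bounds[of R y] by simp
qed (use assms in \<open>auto intro: C_k_bump bump_outside grad_bump_outside\<close>)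

lemma grad_bump_square:
  "grad (\<lambda>y. bump R y * bump R y) y = (2 * bump R y) *\<^sub>R grad (bump R) (y :: real ^ 'n)"
proof -
  have "((\<lambda>y. bump R y * bump R y) has_derivative (\<lambda>h. (bump R y *\<^sub>R grad (bump R) y + bump R y *\<^sub>R grad (bump R) y) \<bullet> h)) (at y)"
    using C_k_Suc_D(1)[OF C_k_bump[of "Suc 0" R]] by (intro has_gradient_mult)
  from grad_eq[OF this] show ?thesis by (simp add: scaleR_add_left[symmetric])
qed

text \<open>Squaring the bump makes the cut-off density the square of \<open>bump R * u\<close> when
  \<open>F\<close> is the square of \<open>u\<close>, so its Fisher integrand is that of a cut-off
  root.\<close>

lemma cutoff_bump_square:
  assumes "has_weak_gradient F G" "F \<in> borel_measurable borel" "G \<in> borel_measurable borel" and R: "R > 0"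
  shows "cutoff F G (\<lambda>y. bump R y * bump R y) (max 1 (8 * exp 1 / R)) R"
proof
  show "norm (grad (\<lambda>y. bump R y * bump R y) y) \<le> max 1 (8 * exp 1 / R)" for y :: "real ^ 'n"
  proof -
    have "2 * bump R y * norm (grad (bump R) y) \<le> 2 * (4 * exp 1 / R)"
      using norm_grad_bump[OF R, of y] bump_bounds[of R y] by (intro mult_mono) auto
    then show ?thesis using bump_bounds[of R y] by (simp add: grad_bump_square)
  qed
  show "\<bar>bump R y * bump R y\<bar> \<le> max 1 (8 * exp 1 / R)" for y :: "real ^ 'n"
    using bump_bounds[of R y] mult_le_one[of "bump R y" "bump R y"] by simp
qed (use assms in \<open>auto intro: C_k_mult C_k_bump simp: bump_outside grad_bump_outside grad_bump_square\<close>)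

section \<open>Squares of Sobolev functions and uniqueness of weak gradients\<close>

text \<open>Serves as a sequence of angles in \<open>(0, pi / 2)\<close> and, further on, as a
  vanishing positive error.\<close>

definition tseq :: "nat \<Rightarrow> real" where "tseq m = inverse (real (Suc m))"

lemma tseq_tendsto: "tseq \<longlonglongrightarrow> 0"
  unfolding tseq_def by (rule LIMSEQ_inverse_real_of_nat)

lemma tseq_bounds: "0 < tseq m" "tseq m < pi / 2"
proof -
  show "0 < tseq m" by (simp add: tseq_def)
  have "tseq m \<le> 1" by (simp add: tseq_def inverse_le_1_iff)
  then show "tseq m < pi / 2" using pi_gt3 by linarith
qed

lemma sin_tseq: "0 < sin (tseq m)" and cos_tseq: "0 < cos (tseq m)" and cos_tseq': "cos (tseq m) \<noteq> - 1"
proof -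
  show "0 < sin (tseq m)" by (rule sin_gt_zero) (use tseq_bounds[of m] in linarith)+
  show "0 < cos (tseq m)" by (rule cos_gt_zero) (use tseq_bounds[of m] in linarith)+
  then show "cos (tseq m) \<noteq> - 1" by simp
qed

lemma cos_tseq_tendsto: "(\<lambda>m. cos (tseq m)) \<longlonglongrightarrow> 1"
  using tendsto_cos[OF tseq_tendsto] by simp

lemma integrable_compact_support:
  fixes F :: "'a::euclidean_space \<Rightarrow> 'b::{banach, second_countable_topology}"
  assumes [measurable]: "F \<in> borel_measurable borel" and bd: "\<And>x. norm (F x) \<le> D" and out: "\<And>x. R < norm x \<Longrightarrow> F x = 0"
  shows "integrable lborel F"
proof (rule Bochner_Integration.integrable_bound)
  have "emeasure lborel (cball (0 :: 'a) R) < \<infinity>" by (rule emeasure_bounded_finite) simp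
  then show "integrable lborel (\<lambda>x :: 'a. D * indicator (cball 0 R) x)"
    by (intro integrable_mult_right) simp
  show "AE x in lborel. norm (F x) \<le> norm (D * indicator (cball 0 R) x)"
  proof (rule AE_I2)
    fix x show "norm (F x) \<le> norm (D * indicator (cball 0 R) x)"
      using bd[of x] out[of x] by (cases "norm x \<le> R") (auto simp: indicator_def)
  qed
qed simp

lemma weak_ibp_square:
  fixes \<phi> :: "real ^ 'n \<Rightarrow> real"
  assumes v: "bounded_gradient v p K" and \<phi>: "\<phi> \<in> test_functions"
  shows "(LINT x|lborel. (v x)\<^sup>2 * partial_deriv i \<phi> x) = - (LINT x|lborel. (2 * v x * p x $ i) * \<phi> x)"
proof -
  interpret bounded_gradient v p K by (rule v)
  obtain B R where B: "0 \<le> B" "\<And>y. \<bar>\<phi> y\<bar> \<le> B" "\<And>y. norm (grad \<phi> y) \<le> B"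
    and R: "\<And>y. R \<le> norm y \<Longrightarrow> \<phi> y = 0" "\<And>y. R \<le> norm y \<Longrightarrow> grad \<phi> y = 0"
    and der\<phi>: "\<And>y. (\<phi> has_derivative (\<lambda>h. grad \<phi> y \<bullet> h)) (at y)"
    and cont: "continuous_on UNIV \<phi>" "continuous_on UNIV (grad \<phi>)"
    using test_functionD[OF \<phi>] by blast
  have [measurable]: "\<phi> \<in> borel_measurable borel" "grad \<phi> \<in> borel_measurable borel"
    using cont by (auto intro: borel_measurable_continuous_onI)
  define A where "A x = (v x * v x) *\<^sub>R grad \<phi> x + \<phi> x *\<^sub>R (v x *\<^sub>R p x + v x *\<^sub>R p x)" for x
  have [measurable]: "A \<in> borel_measurable borel" unfolding A_def[abs_def] by measurable
  define D where "D = (K * K) * B + B * (K * K + K * K)"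
  have D: "0 \<le> D" unfolding D_def using B(1) C_nonneg by simp
  have A_le: "norm (A x) \<le> D" for x
  proof -
    have "norm (A x) \<le> \<bar>v x * v x\<bar> * norm (grad \<phi> x) + \<bar>\<phi> x\<bar> * (\<bar>v x\<bar> * norm (p x) + \<bar>v x\<bar> * norm (p x))"
    proof -
      have "norm (v x *\<^sub>R p x + v x *\<^sub>R p x) \<le> \<bar>v x\<bar> * norm (p x) + \<bar>v x\<bar> * norm (p x)"
        using norm_triangle_ineq[of "v x *\<^sub>R p x" "v x *\<^sub>R p x"] by (simp only: norm_scaleR)
      then have "norm (\<phi> x *\<^sub>R (v x *\<^sub>R p x + v x *\<^sub>R p x)) \<le> \<bar>\<phi> x\<bar> * (\<bar>v x\<bar> * norm (p x) + \<bar>v x\<bar> * norm (p x))"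
        by (simp only: norm_scaleR mult_left_mono abs_ge_zero)
      then show ?thesis
        unfolding A_def using norm_triangle_ineq[of "(v x * v x) *\<^sub>R grad \<phi> x" "\<phi> x *\<^sub>R (v x *\<^sub>R p x + v x *\<^sub>R p x)"]
        by (simp only: norm_scaleR)
    qed
    also have "\<dots> \<le> D"
      unfolding D_def abs_mult by (intro add_mono mult_mono B g_bd A_bd) (use C_nonneg in auto)
    finally show ?thesis .
  qed
  have A_out: "A x = 0" if "R \<le> norm x" for x using R[OF that] by (simp add: A_def)
  have "(LINT x|lborel. A x \<bullet> axis i 1) = 0"
  proof (rule integral_gradient_eq_0[where K = "\<lambda>x. v x * v x * \<phi> x" and B = "\<lambda>x. D * indicator (cball 0 (R + 1)) x"])
    show "((\<lambda>x. v x * v x * \<phi> x) has_derivative (\<lambda>h. A x \<bullet> h)) (at x)" for x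
      unfolding A_def by (intro has_gradient_mult der der\<phi>)
    show "integrable lborel (\<lambda>x. v x * v x * \<phi> x)"
    proof (rule integrable_compact_support[of _ "K * K * B" R])
      show "norm (v x * v x * \<phi> x) \<le> K * K * B" for x
        unfolding real_norm_def abs_mult by (intro mult_mono B g_bd) (use C_nonneg in auto)
    qed (auto simp: R)
    show "integrable lborel (\<lambda>x :: real ^ 'n. D * indicator (cball 0 (R + 1)) x)"
      by (rule integrable_compact_support[of _ D "R + 1"]) (use D in \<open>auto simp: indicator_def\<close>)
    fix x :: "real ^ 'n" and t :: real assume t: "\<bar>t\<bar> < 1"
    let ?y = "x + t *\<^sub>R axis i 1"
    \<comment> \<open>A shift by less than 1 moves the support of \<open>A\<close> by at most 1,
      hence the radius \<open>R + 1\<close>.\<close>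
    show "\<bar>A ?y \<bullet> axis i 1\<bar> \<le> D * indicator (cball 0 (R + 1)) x"
    proof (cases "norm x \<le> R + 1")
      case True
      have "\<bar>A ?y \<bullet> axis i 1\<bar> \<le> norm (A ?y) * norm (axis i (1 :: real) :: real ^ 'n)" by (rule Cauchy_Schwarz_ineq2)
      also have "\<dots> \<le> D" using A_le[of ?y] by (simp add: norm_axis_1)
      finally show ?thesis using True by simp
    next
      case False
      have "norm x = norm (?y - t *\<^sub>R axis i 1)" by simp
      also have "\<dots> \<le> norm ?y + norm (t *\<^sub>R (axis i (1 :: real) :: real ^ 'n))" by (rule norm_triangle_ineq4)
      also have "norm (t *\<^sub>R (axis i (1 :: real) :: real ^ 'n)) \<le> 1" using t by (simp add: norm_axis_1)
      finally have "R \<le> norm ?y" using False by simp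
      then show ?thesis using D by (simp add: A_out)
    qed
  qed simp
  moreover have "(LINT x|lborel. A x \<bullet> axis i 1) = (LINT x|lborel. (v x)\<^sup>2 * partial_deriv i \<phi> x + (2 * v x * p x $ i) * \<phi> x)"
    by (intro Bochner_Integration.integral_cong refl)
      (simp add: A_def inner_axis grad_def algebra_simps power2_eq_square)
  moreover have "integrable lborel (\<lambda>x. (v x)\<^sup>2 * partial_deriv i \<phi> x)"
  proof (rule integrable_compact_support[of _ "K\<^sup>2 * B" R])
    have pd: "partial_deriv i \<phi> x = grad \<phi> x $ i" for x by (simp add: grad_def)
    show "(\<lambda>x. (v x)\<^sup>2 * partial_deriv i \<phi> x) \<in> borel_measurable borel" unfolding pd by measurable
    show "norm ((v x)\<^sup>2 * partial_deriv i \<phi> x) \<le> K\<^sup>2 * B" for x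
      unfolding norm_mult norm_power unfolding real_norm_def pd
      by (intro mult_mono power_mono g_bd order_trans[OF component_le_norm_cart B(3)]) auto
    show "(v x)\<^sup>2 * partial_deriv i \<phi> x = 0" if "R < norm x" for x unfolding pd using that R(2)[of x] by simp
  qed
  moreover have "integrable lborel (\<lambda>x. (2 * v x * p x $ i) * \<phi> x)"
  proof (rule integrable_compact_support[of _ "(2 * K * K) * B" R])
    show "norm ((2 * v x * p x $ i) * \<phi> x) \<le> (2 * K * K) * B" for x
      unfolding real_norm_def abs_mult
      by (intro mult_mono g_bd B(2) order_trans[OF component_le_norm_cart A_bd]) (use C_nonneg in auto)
  qed (auto simp: R)
  ultimately show ?thesis by simp
qed

text \<open>Turns a test against Lebesgue measure into a Gaussian integral. The weight
  \<open>q / gauss_pdf\<close> is bounded when \<open>q\<close> is bounded with bounded support,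
  which lets Gaussian convergence results apply.\<close>

lemma lborel_test_integral:
  fixes F q :: "real ^ 'n \<Rightarrow> real"
  assumes "F \<in> borel_measurable borel" "q \<in> borel_measurable borel"
  shows "(LINT x|lborel. F x * q x) = (LINT x|gauss. F x * (q x / gauss_pdf x))"
  using assms
  by (subst integral_gauss) (auto intro!: Bochner_Integration.integral_cong simp: less_imp_neq[OF gauss_pdf_pos, symmetric])

lemma test_weight_bounded:
  fixes q :: "real ^ 'n \<Rightarrow> real"
  assumes "0 \<le> B" "\<And>y. \<bar>q y\<bar> \<le> B" "\<And>y. R \<le> norm y \<Longrightarrow> q y = 0"
  obtains D where "0 \<le> D" "\<And>y. \<bar>q y / gauss_pdf y\<bar> \<le> D"
proof -
  define c where "c = (2 * pi) powr (- real CARD('n) / 2) * exp (- R\<^sup>2 / 2)"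
  have c: "c > 0" by (simp add: c_def)
  show thesis
  proof (rule that[of "B / c"])
    show "0 \<le> B / c" using assms(1) c by simp
    show "\<bar>q y / gauss_pdf y\<bar> \<le> B / c" for y
    proof (cases "norm y \<le> R")
      case True
      have "c \<le> gauss_pdf y"
        unfolding c_def gauss_pdf_def using power_mono[OF True norm_ge_zero, of 2] by (intro mult_left_mono) auto
      then have "\<bar>q y\<bar> / gauss_pdf y \<le> B / c" using assms c by (intro frac_le) auto
      then show ?thesis by (simp add: abs_of_pos[OF gauss_pdf_pos])
    qed (use assms c in auto)
  qed
qed

text \<open>Cut off, then mollify: the mollified \<open>v j\<close> has a bounded classical
  gradient, for which the product rule is \<open>weak_ibp_square\<close>. The angle goes to 0 first,
  with \<open>j\<close> fixed; the cutoff is removed afterwards.\<close>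

lemma weak_gradient_square:
  fixes u :: "real ^ 'n \<Rightarrow> real" and p :: "real ^ 'n \<Rightarrow> real ^ 'n"
  assumes [measurable]: "u \<in> borel_measurable borel" "p \<in> borel_measurable borel"
    and u2: "integrable gauss (\<lambda>x. (u x)\<^sup>2)" and p2: "integrable gauss (\<lambda>x. (norm (p x))\<^sup>2)"
    and wg: "has_weak_gradient u p"
  shows "has_weak_gradient (\<lambda>x. (u x)\<^sup>2) (\<lambda>x. (2 * u x) *\<^sub>R p x)"
proof -
  let ?E = "4 * exp 1 :: real"
  have ab: "\<bar>a\<bar> * \<bar>b\<bar> \<le> a\<^sup>2 + b\<^sup>2" for a b :: real
  proof -
    have "2 * (\<bar>a\<bar> * \<bar>b\<bar>) \<le> a\<^sup>2 + b\<^sup>2" using sum_squares_bound[of "\<bar>a\<bar>" "\<bar>b\<bar>"] by (simp add: mult.assoc)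
    moreover have "0 \<le> \<bar>a\<bar> * \<bar>b\<bar>" by simp
    ultimately show ?thesis by linarith
  qed
  have "integrable gauss (\<lambda>x. (2 * u x) *\<^sub>R p x)"
  proof (rule Bochner_Integration.integrable_bound)
    show "integrable gauss (\<lambda>x. (u x)\<^sup>2 + (norm (p x))\<^sup>2)" using u2 p2 by simp
    show "AE x in gauss. norm ((2 * u x) *\<^sub>R p x) \<le> norm ((u x)\<^sup>2 + (norm (p x))\<^sup>2)"
    proof (rule AE_I2)
      fix x show "norm ((2 * u x) *\<^sub>R p x) \<le> norm ((u x)\<^sup>2 + (norm (p x))\<^sup>2)"
        using sum_squares_bound[of "\<bar>u x\<bar>" "norm (p x)"] by (simp add: abs_mult)
    qed
  qed measurable
  then have loc: "locally_integrable (\<lambda>x. (u x)\<^sup>2)" "locally_integrable (\<lambda>x. (2 * u x) *\<^sub>R p x)"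
    using u2 by (auto intro: locally_integrable_gauss)
  have "(LINT x|lborel. (u x)\<^sup>2 * partial_deriv i \<phi> x) = - (LINT x|lborel. ((2 * u x) *\<^sub>R p x) $ i * \<phi> x)"
    if \<phi>: "\<phi> \<in> test_functions" for \<phi> i
  proof -
    obtain B R where B: "0 \<le> B" "\<And>y. \<bar>\<phi> y\<bar> \<le> B" "\<And>y. norm (grad \<phi> y) \<le> B"
      and R: "\<And>y. R \<le> norm y \<Longrightarrow> \<phi> y = 0" "\<And>y. R \<le> norm y \<Longrightarrow> grad \<phi> y = 0"
      and "\<And>y. (\<phi> has_derivative (\<lambda>h. grad \<phi> y \<bullet> h)) (at y)"
      and cont: "continuous_on UNIV \<phi>" "continuous_on UNIV (grad \<phi>)"
      using test_functionD[OF \<phi>] by blast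
    have pd: "partial_deriv i \<phi> = (\<lambda>x. grad \<phi> x $ i)" and pdx: "partial_deriv i \<phi> y = grad \<phi> y $ i" for y
      by (auto simp: grad_def)
    have [measurable]: "\<phi> \<in> borel_measurable borel" "grad \<phi> \<in> borel_measurable borel"
      using cont by (auto intro: borel_measurable_continuous_onI)
    have [measurable]: "partial_deriv i \<phi> \<in> borel_measurable borel" unfolding pd by measurable
    define \<omega>1 where "\<omega>1 x = partial_deriv i \<phi> x / gauss_pdf x" for x
    define \<omega>2 where "\<omega>2 x = \<phi> x / gauss_pdf x" for x
    have \<omega>m [measurable]: "\<omega>1 \<in> borel_measurable borel" "\<omega>2 \<in> borel_measurable borel"
      unfolding \<omega>1_def[abs_def] \<omega>2_def[abs_def] by measurable
    have "\<bar>partial_deriv i \<phi> y\<bar> \<le> B" "R \<le> norm y \<Longrightarrow> partial_deriv i \<phi> y = 0" for y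
      using order_trans[OF component_le_norm_cart B(3), of y i] R(2)[of y] by (simp_all add: pdx)
    then obtain D1 where D1: "0 \<le> D1" "\<And>y. \<bar>\<omega>1 y\<bar> \<le> D1"
      using test_weight_bounded[OF B(1), of "partial_deriv i \<phi>" R] unfolding \<omega>1_def by blast
    obtain D2 where D2: "0 \<le> D2" "\<And>y. \<bar>\<omega>2 y\<bar> \<le> D2"
      using test_weight_bounded[of B \<phi> R, OF B(1,2) R(1)] unfolding \<omega>2_def by blast
    define v where "v j x = bump (real (Suc j)) x * u x" for j x
    define q where "q j x = bump (real (Suc j)) x *\<^sub>R p x + u x *\<^sub>R grad (bump (real (Suc j))) x" for j x
    have v_le: "\<bar>v j x\<bar> \<le> \<bar>u x\<bar>" for j x
      using mult_right_mono[of "bump (real (Suc j)) x" 1 "\<bar>u x\<bar>"] bump_bounds[of "real (Suc j)" x] by (simp add: v_def abs_mult)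
    have grad_le: "norm (grad (bump (real (Suc j))) (x :: real ^ 'n)) \<le> ?E / real (Suc j)" for j x
      by (rule norm_grad_bump) simp
    have E1: "?E / real (Suc j) \<le> ?E" for j by (simp add: divide_le_eq)
    have q_le: "norm (q j x) \<le> norm (p x) + ?E * \<bar>u x\<bar>" for j x
    proof -
      have "norm (q j x) \<le> bump (real (Suc j)) x * norm (p x) + \<bar>u x\<bar> * norm (grad (bump (real (Suc j))) x)"
        unfolding q_def using norm_triangle_ineq[of "bump (real (Suc j)) x *\<^sub>R p x" "u x *\<^sub>R grad (bump (real (Suc j))) x"] bump_bounds[of "real (Suc j)" x]
        by simp
      also have "\<dots> \<le> 1 * norm (p x) + \<bar>u x\<bar> * ?E"
        by (intro add_mono mult_right_mono mult_left_mono bump_bounds order_trans[OF grad_le E1]) auto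
      finally show ?thesis by (simp add: mult.commute)
    qed
    \<comment> \<open>The limit in the angle at a fixed cutoff; the factor \<open>cos\<close> from
      differentiating the mollification tends to 1.\<close>
    have claim1: "(LINT x|gauss. (v j x)\<^sup>2 * \<omega>1 x) = - (2 * (LINT x|gauss. v j x * q j x $ i * \<omega>2 x))" for j
    proof -
      interpret cutoff u p "bump (real (Suc j))" "max 1 (4 * exp 1 / real (Suc j))" "real (Suc j)"
        by (rule cutoff_bump[OF wg]) auto
      have P: "P = v j" and W: "W = q j" by (rule ext, simp only: P_def v_def W_def q_def)+
      have [measurable]: "v j \<in> borel_measurable borel" "q j \<in> borel_measurable borel"
        using P_meas W_meas unfolding P W .
      have v2: "integrable gauss (\<lambda>x. (v j x)\<^sup>2)"
      proof (rule Bochner_Integration.integrable_bound[OF u2])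
        show "AE x in gauss. norm ((v j x)\<^sup>2) \<le> norm ((u x)\<^sup>2)"
          using v_le by (intro AE_I2) (simp add: abs_le_square_iff[symmetric])
      qed measurable
      have q2: "integrable gauss (\<lambda>x. (norm (q j x))\<^sup>2)"
      proof (rule Bochner_Integration.integrable_bound)
        show "integrable gauss (\<lambda>x. 2 * (norm (p x))\<^sup>2 + (2 * ?E\<^sup>2) * (u x)\<^sup>2)" using u2 p2 by simp
        show "AE x in gauss. norm ((norm (q j x))\<^sup>2) \<le> norm (2 * (norm (p x))\<^sup>2 + (2 * ?E\<^sup>2) * (u x)\<^sup>2)"
        proof (rule AE_I2)
          fix x
          have "(norm (q j x))\<^sup>2 \<le> (norm (p x) + ?E * \<bar>u x\<bar>)\<^sup>2" by (intro power_mono q_le) simp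
          also have "\<dots> \<le> 2 * (norm (p x))\<^sup>2 + 2 * (?E * \<bar>u x\<bar>)\<^sup>2"
            using sum_squares_bound[of "norm (p x)" "?E * \<bar>u x\<bar>"] by (simp add: power2_sum)
          finally show "norm ((norm (q j x))\<^sup>2) \<le> norm (2 * (norm (p x))\<^sup>2 + (2 * ?E\<^sup>2) * (u x)\<^sup>2)"
            by (simp add: power_mult_distrib)
        qed
      qed measurable
      obtain r :: "nat \<Rightarrow> nat" where r: "strict_mono r"
        and l1: "(\<lambda>m. LINT x|gauss. (mehler (tseq (r m)) (v j) x)\<^sup>2 * \<omega>1 x) \<longlonglongrightarrow> (LINT x|gauss. (v j x)\<^sup>2 * \<omega>1 x)"
        and l2: "(\<lambda>m. LINT x|gauss. mehler (tseq (r m)) (v j) x * mehler (tseq (r m)) (q j) x $ i * \<omega>2 x) \<longlonglongrightarrow> (LINT x|gauss. v j x * q j x $ i * \<omega>2 x)"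
      proof -
        obtain r :: "nat \<Rightarrow> nat" where r: "strict_mono r"
          "\<And>\<omega> C. \<omega> \<in> borel_measurable borel \<Longrightarrow> (\<And>x. \<bar>\<omega> x\<bar> \<le> C) \<Longrightarrow>
            (\<lambda>m. LINT x|gauss. (mehler (tseq (r m)) (v j) x)\<^sup>2 * \<omega> x) \<longlonglongrightarrow> (LINT x|gauss. (v j x)\<^sup>2 * \<omega> x)"
          "\<And>\<omega> C i. \<omega> \<in> borel_measurable borel \<Longrightarrow> (\<And>x. \<bar>\<omega> x\<bar> \<le> C) \<Longrightarrow>
            (\<lambda>m. LINT x|gauss. mehler (tseq (r m)) (v j) x * mehler (tseq (r m)) (q j) x $ i * \<omega> x) \<longlonglongrightarrow> (LINT x|gauss. v j x * q j x $ i * \<omega> x)"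
          using mehler_square_limit[OF \<open>v j \<in> _\<close> \<open>q j \<in> _\<close> v2 q2 tseq_tendsto cos_tseq'] by blast
        show thesis by (rule that[OF r(1) r(2)[OF \<omega>m(1) D1(2)] r(3)[OF \<omega>m(2) D2(2)]])
      qed
      have eq: "(LINT x|gauss. (mehler (tseq (r m)) (v j) x)\<^sup>2 * \<omega>1 x)
        = - (2 * (cos (tseq (r m)) * (LINT x|gauss. mehler (tseq (r m)) (v j) x * mehler (tseq (r m)) (q j) x $ i * \<omega>2 x)))" for m
      proof -
        let ?t = "tseq (r m)"
        obtain K where K: "bounded_gradient (mehler ?t (v j)) (\<lambda>x. cos ?t *\<^sub>R mehler ?t (q j) x) K"
          using mehler_cutoff_bounded_gradient[OF sin_tseq cos_tseq] unfolding P W by blast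
        have "(LINT x|gauss. (mehler ?t (v j) x)\<^sup>2 * \<omega>1 x) = (LINT x|lborel. (mehler ?t (v j) x)\<^sup>2 * partial_deriv i \<phi> x)"
          unfolding \<omega>1_def by (subst lborel_test_integral) auto
        also have "\<dots> = - (LINT x|lborel. (2 * mehler ?t (v j) x * (cos ?t *\<^sub>R mehler ?t (q j) x) $ i) * \<phi> x)"
          by (rule weak_ibp_square[OF K \<phi>])
        also have "\<dots> = - (LINT x|gauss. (2 * mehler ?t (v j) x * (cos ?t *\<^sub>R mehler ?t (q j) x) $ i) * \<omega>2 x)"
          unfolding \<omega>2_def by (subst lborel_test_integral) auto
        also have "(LINT x|gauss. (2 * mehler ?t (v j) x * (cos ?t *\<^sub>R mehler ?t (q j) x) $ i) * \<omega>2 x)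
          = (LINT x|gauss. (2 * cos ?t) * (mehler ?t (v j) x * mehler ?t (q j) x $ i * \<omega>2 x))"
          by (intro Bochner_Integration.integral_cong refl) (simp add: mult_ac)
        also have "\<dots> = 2 * cos ?t * (LINT x|gauss. mehler ?t (v j) x * mehler ?t (q j) x $ i * \<omega>2 x)"
          by (rule integral_mult_right_zero)
        finally show ?thesis by (simp add: mult.assoc)
      qed
      have "(\<lambda>m. - (2 * (cos (tseq (r m)) * (LINT x|gauss. mehler (tseq (r m)) (v j) x * mehler (tseq (r m)) (q j) x $ i * \<omega>2 x))))
        \<longlonglongrightarrow> - (2 * (1 * (LINT x|gauss. v j x * q j x $ i * \<omega>2 x)))"
        using LIMSEQ_subseq_LIMSEQ[OF cos_tseq_tendsto r] by (intro tendsto_intros l2) (simp add: o_def)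
      then show ?thesis using LIMSEQ_unique[OF l1] unfolding eq by simp
    qed
    have bump1: "(\<lambda>j. bump (real (Suc j)) x) \<longlonglongrightarrow> 1" for x :: "real ^ 'n" by (rule bump_tendsto)
    have grad0: "(\<lambda>j. grad (bump (real (Suc j))) x) \<longlonglongrightarrow> 0" for x :: "real ^ 'n"
    proof (rule Lim_null_comparison)
      show "\<forall>\<^sub>F j in sequentially. norm (grad (bump (real (Suc j))) x) \<le> ?E / real (Suc j)"
        using grad_le by (intro always_eventually) auto
      have "(\<lambda>j. ?E * inverse (real (Suc j))) \<longlonglongrightarrow> ?E * 0" by (intro tendsto_intros LIMSEQ_inverse_real_of_nat)
      then show "(\<lambda>j. ?E / real (Suc j)) \<longlonglongrightarrow> 0" by (simp add: divide_inverse)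
    qed
    have vlim: "(\<lambda>j. v j x) \<longlonglongrightarrow> u x" for x
      using tendsto_mult[OF bump1 tendsto_const[of "u x"], of x] by (simp add: v_def)
    have qlim: "(\<lambda>j. q j x) \<longlonglongrightarrow> p x" for x
      using tendsto_add[OF tendsto_scaleR[OF bump1 tendsto_const[of "p x"]] tendsto_scaleR[OF tendsto_const[of "u x"] grad0], of x x]
      by (simp add: q_def)
    have vq_meas [measurable]: "v j \<in> borel_measurable borel" "q j \<in> borel_measurable borel" for j
    proof -
      interpret cutoff u p "bump (real (Suc j))" "max 1 (4 * exp 1 / real (Suc j))" "real (Suc j)"
        by (rule cutoff_bump[OF wg]) auto
      have "P = v j" "W = q j" by (rule ext, simp only: P_def v_def W_def q_def)+
      then show "v j \<in> borel_measurable borel" "q j \<in> borel_measurable borel" using P_meas W_meas by argo+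
    qed
    \<comment> \<open>Removal of the cutoff: the squares of \<open>u\<close> and \<open>p\<close>
      supply majorants that are independent of \<open>j\<close>.\<close>
    have L1: "(\<lambda>j. LINT x|gauss. (v j x)\<^sup>2 * \<omega>1 x) \<longlonglongrightarrow> (LINT x|gauss. (u x)\<^sup>2 * \<omega>1 x)"
    proof (rule integral_dominated_convergence[where w = "\<lambda>x. D1 * (u x)\<^sup>2"])
      show "AE x in gauss. (\<lambda>j. (v j x)\<^sup>2 * \<omega>1 x) \<longlonglongrightarrow> (u x)\<^sup>2 * \<omega>1 x"
        by (intro AE_I2 tendsto_intros vlim)
      show "AE x in gauss. norm ((v j x)\<^sup>2 * \<omega>1 x) \<le> D1 * (u x)\<^sup>2" for j
      proof (rule AE_I2)
        fix x
        have "\<bar>\<omega>1 x\<bar> * (v j x)\<^sup>2 \<le> D1 * (u x)\<^sup>2"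
          using v_le[of j x] by (intro mult_mono D1) (auto simp: abs_le_square_iff)
        then show "norm ((v j x)\<^sup>2 * \<omega>1 x) \<le> D1 * (u x)\<^sup>2" by (simp add: abs_mult mult.commute)
      qed
    qed (use u2 in auto)
    have L2: "(\<lambda>j. LINT x|gauss. v j x * q j x $ i * \<omega>2 x) \<longlonglongrightarrow> (LINT x|gauss. u x * p x $ i * \<omega>2 x)"
    proof (rule integral_dominated_convergence[where w = "\<lambda>x. D2 * ((1 + ?E) * (u x)\<^sup>2 + (norm (p x))\<^sup>2)"])
      show "AE x in gauss. (\<lambda>j. v j x * q j x $ i * \<omega>2 x) \<longlonglongrightarrow> u x * p x $ i * \<omega>2 x"
        by (intro AE_I2 tendsto_intros vlim qlim)
      show "AE x in gauss. norm (v j x * q j x $ i * \<omega>2 x) \<le> D2 * ((1 + ?E) * (u x)\<^sup>2 + (norm (p x))\<^sup>2)" for j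
      proof (rule AE_I2)
        fix x
        have "\<bar>v j x\<bar> * \<bar>q j x $ i\<bar> \<le> \<bar>u x\<bar> * (norm (p x) + ?E * \<bar>u x\<bar>)"
          by (intro mult_mono v_le order_trans[OF component_le_norm_cart q_le]) auto
        also have "\<dots> = \<bar>u x\<bar> * \<bar>norm (p x)\<bar> + ?E * (u x)\<^sup>2" by (simp add: algebra_simps power2_eq_square)
        also have "\<dots> \<le> (1 + ?E) * (u x)\<^sup>2 + (norm (p x))\<^sup>2"
          using ab[of "u x" "norm (p x)"] by (simp add: algebra_simps)
        finally have "\<bar>\<omega>2 x\<bar> * (\<bar>v j x\<bar> * \<bar>q j x $ i\<bar>) \<le> D2 * ((1 + ?E) * (u x)\<^sup>2 + (norm (p x))\<^sup>2)"
          by (intro mult_mono D2) auto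
        then show "norm (v j x * q j x $ i * \<omega>2 x) \<le> D2 * ((1 + ?E) * (u x)\<^sup>2 + (norm (p x))\<^sup>2)"
          by (simp add: abs_mult mult_ac)
      qed
    qed (use u2 p2 in auto)
    have "(\<lambda>j. - (2 * (LINT x|gauss. v j x * q j x $ i * \<omega>2 x))) \<longlonglongrightarrow> - (2 * (LINT x|gauss. u x * p x $ i * \<omega>2 x))"
      by (intro tendsto_intros L2)
    then have main: "(LINT x|gauss. (u x)\<^sup>2 * \<omega>1 x) = - (2 * (LINT x|gauss. u x * p x $ i * \<omega>2 x))"
      using LIMSEQ_unique[OF L1] unfolding claim1 by simp
    have "(LINT x|lborel. (u x)\<^sup>2 * partial_deriv i \<phi> x) = (LINT x|gauss. (u x)\<^sup>2 * \<omega>1 x)"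
      unfolding \<omega>1_def by (rule lborel_test_integral) auto
    also have "\<dots> = - (LINT x|gauss. 2 * (u x * p x $ i * \<omega>2 x))" unfolding main by simp
    also have "(LINT x|gauss. 2 * (u x * p x $ i * \<omega>2 x)) = (LINT x|gauss. ((2 * u x) *\<^sub>R p x) $ i * \<omega>2 x)"
      by (intro Bochner_Integration.integral_cong refl) (simp add: mult_ac)
    also have "\<dots> = (LINT x|lborel. ((2 * u x) *\<^sub>R p x) $ i * \<phi> x)"
      unfolding \<omega>2_def by (rule lborel_test_integral[symmetric]) auto
    finally show ?thesis .
  qed
  then show ?thesis using loc unfolding has_weak_gradient_def by blast
qed

text \<open>Testing against cutoffs of Mehler kernels shows that all mollifications of the localized difference
  vanish.\<close>

lemma weak_gradient_unique:
  assumes wg: "has_weak_gradient F G" and wg': "has_weak_gradient F G'"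
  shows "AE x in gauss. G x = (G' x :: real ^ 'n)"
proof -
  have F [measurable]: "F \<in> borel_measurable borel" and G [measurable]: "G \<in> borel_measurable borel" and G' [measurable]: "G' \<in> borel_measurable borel"
    using wg wg' unfolding has_weak_gradient_def by (auto intro: locally_integrable_measurable)
  have "AE x in gauss. bump (real (Suc j)) x *\<^sub>R (G x - G' x) = 0" for j
  proof -
    let ?b = "bump (real (Suc j)) :: real ^ 'n \<Rightarrow> real"
    interpret c: cutoff F G ?b "max 1 (4 * exp 1 / real (Suc j))" "real (Suc j)"
      by (rule cutoff_bump[OF wg F G]) simp
    interpret c': cutoff F G' ?b "max 1 (4 * exp 1 / real (Suc j))" "real (Suc j)"
      by (rule cutoff_bump[OF wg' F G']) simp
    define w where "w x = ?b x *\<^sub>R (G x - G' x)" for x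
    have w: "w x = c.W x - c'.W x" for x unfolding w_def c.W_def c'.W_def by (simp add: algebra_simps)
    have w_meas [measurable]: "w \<in> borel_measurable borel" unfolding w_def[abs_def] by measurable
    have iw: "integrable lborel w" unfolding w using c.W_int c'.W_int by simp
    have iwg: "integrable gauss w"
    proof (subst integrable_gauss_iff[OF w_meas], rule Bochner_Integration.integrable_bound)
      show "integrable lborel (\<lambda>x. gauss_pdf (0 :: real ^ 'n) *\<^sub>R w x)" using iw by simp
      show "AE x in lborel. norm (gauss_pdf x *\<^sub>R w x) \<le> norm (gauss_pdf (0 :: real ^ 'n) *\<^sub>R w x)"
        unfolding norm_scaleR
        by (intro AE_I2 mult_right_mono abs_le_abs_pos gauss_pdf_pos gauss_pdf_le) simp
    qed measurable
    have zero: "mehler (tseq m) w x = 0" for m x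
    proof -
      let ?t = "tseq m"
      have i: "integrable lborel (\<lambda>y. mehler_kernel ?t x y *\<^sub>R q y)" if "integrable lborel q" for q :: "real ^ 'n \<Rightarrow> real ^ 'n"
      proof (rule Bochner_Integration.integrable_bound)
        let ?D = "gauss_pdf (0 :: real ^ 'n) / sin ?t ^ CARD('n)"
        show "integrable lborel (\<lambda>y. ?D *\<^sub>R q y)" using that by simp
        show "(\<lambda>y. mehler_kernel ?t x y *\<^sub>R q y) \<in> borel_measurable lborel"
          using borel_measurable_integrable[OF that] by measurable
        show "AE y in lborel. norm (mehler_kernel ?t x y *\<^sub>R q y) \<le> norm (?D *\<^sub>R q y)"
          unfolding norm_scaleR
          by (intro AE_I2 mult_right_mono[OF abs_le_abs_pos[OF mehler_kernel_bounds[OF sin_tseq cos_tseq]] norm_ge_zero])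
      qed
      \<comment> \<open>By \<open>weak_identity\<close> both sides equal the same integral of the
        kernel gradient against \<open>P\<close>, and \<open>P\<close> depends on \<open>F\<close>
        only.\<close>
      have "cos ?t *\<^sub>R mehler ?t c.W x = cos ?t *\<^sub>R mehler ?t c'.W x"
        unfolding c.weak_identity[OF sin_tseq cos_tseq, symmetric] c'.weak_identity[OF sin_tseq cos_tseq, symmetric] ..
      then have "mehler ?t c.W x = mehler ?t c'.W x" using cos_tseq[of m] by simp
      moreover have "mehler ?t w x = mehler ?t c.W x - mehler ?t c'.W x"
        unfolding mehler_eq_kernel[OF w_meas sin_tseq] mehler_eq_kernel[OF c.W_meas sin_tseq] mehler_eq_kernel[OF c'.W_meas sin_tseq]
        unfolding w scaleR_diff_right by (rule Bochner_Integration.integral_diff[OF i[OF c.W_int] i[OF c'.W_int]])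
      ultimately show ?thesis by simp
    qed
    have "(\<lambda>m. LINT x|gauss. norm (mehler (tseq m) w x - w x)) \<longlonglongrightarrow> 0"
      by (rule mehler_L1_tendsto[OF iwg tseq_tendsto cos_tseq'])
    then have "(LINT x|gauss. norm (w x)) = 0" unfolding zero by (simp add: LIMSEQ_const_iff)
    then have "AE x in gauss. norm (w x) = 0"
      using integral_nonneg_eq_0_iff_AE[of gauss "\<lambda>x. norm (w x)"] iwg by simp
    then show ?thesis by (simp add: w_def)
  qed
  then have "AE x in gauss. \<forall>j. bump (real (Suc j)) x *\<^sub>R (G x - G' x) = 0" unfolding AE_all_countable by blast
  then show ?thesis
  proof eventually_elim
    case (elim x)
    have "(\<lambda>j. bump (real (Suc j)) x *\<^sub>R (G x - G' x)) \<longlonglongrightarrow> 1 *\<^sub>R (G x - G' x)"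
      by (intro tendsto_intros bump_tendsto)
    moreover have "(\<lambda>j. bump (real (Suc j)) x *\<^sub>R (G x - G' x)) = (\<lambda>j. 0)" using elim by blast
    ultimately have "(\<lambda>j :: nat. 0) \<longlonglongrightarrow> G x - G' x" by (simp only: scaleR_one)
    then show ?case by (simp add: LIMSEQ_const_iff)
  qed
qed

section \<open>Approximation by regular densities\<close>

lemma integral_gauss_id: "(LINT v|gauss. v) = (0 :: real ^ 'n)"
proof (rule euclidean_eqI)
  fix e :: "real ^ 'n"
  have i: "integrable gauss (\<lambda>v :: real ^ 'n. v)" by (rule integrable_gauss_quadratic[of _ 1 0 0]) auto
  have "(LINT v|gauss. 1 * (v \<bullet> e)) = (LINT v|(gauss :: (real ^ 'n) measure). 0 \<bullet> e)"
    by (rule gauss_ibp[where \<psi> = "\<lambda>_. 1" and P = "\<lambda>_. 0" and a = 1 and b = 0]) auto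
  then show "(LINT v|gauss. v) \<bullet> e = 0 \<bullet> e" using integral_inner_left[OF i, of e] by simp
qed

text \<open>In rotated coordinates \<open>x = cos t u - sin t v\<close>, with weight
  \<open>P u\<close> and \<open>v\<close> an independent Gaussian. Squaring gives the two second
  moments; in the mean, the part from \<open>v\<close> vanishes.\<close>

lemma
  fixes P :: "real ^ 'n \<Rightarrow> real"
  assumes t: "cos t \<noteq> - 1" and P: "integrable gauss P" and nn: "\<And>x. 0 \<le> P x"
    and P2: "integrable gauss (\<lambda>x. P x * (norm x)\<^sup>2)"
  shows mehler_second_moment: "(LINT x|gauss. mehler t P x * (norm x)\<^sup>2)
      \<le> 2 * (LINT x|gauss. P x * (norm x)\<^sup>2) + 2 * gauss_mom2 TYPE('n) * (LINT x|gauss. P x)"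
    and mehler_second_moment_integrable: "integrable gauss (\<lambda>x. mehler t P x * (norm x)\<^sup>2)"
    and mehler_mean: "(LINT x|gauss. mehler t P x *\<^sub>R x) = cos t *\<^sub>R (LINT x|gauss. P x *\<^sub>R x)"
    and mehler_mean_integrable: "integrable gauss (\<lambda>x. mehler t P x *\<^sub>R x)"
proof -
  let ?c = "cos t" and ?s = "sin t"
  have P_meas [measurable]: "P \<in> borel_measurable borel" using borel_measurable_integrable[OF P] by simp
  have cs: "?c *\<^sub>R (?c *\<^sub>R x + ?s *\<^sub>R z) - ?s *\<^sub>R (?c *\<^sub>R z - ?s *\<^sub>R x) = x" for x z :: "real ^ 'n"
    using rotation_inverse[of t "(x, z)"] by (simp add: rotation_def)
  define y where "y p = ?c *\<^sub>R fst p - ?s *\<^sub>R snd p" for p :: "(real ^ 'n) \<times> (real ^ 'n)"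
  have [measurable]: "y \<in> borel_measurable (borel \<Otimes>\<^sub>M borel)" unfolding y_def[abs_def] by measurable
  define B where "B p = 2 * (P (fst p) * (norm (fst p))\<^sup>2) + 2 * P (fst p) * (norm (snd p))\<^sup>2"
    for p :: "(real ^ 'n) \<times> (real ^ 'n)"
  have [measurable]: "B \<in> borel_measurable (borel \<Otimes>\<^sub>M borel)" unfolding B_def[abs_def] by measurable
  have m2: "integrable gauss (\<lambda>v :: real ^ 'n. (norm v)\<^sup>2)" by (rule integrable_gauss_norm2)
  have Bin: "(LINT v|gauss. B (x, v)) = 2 * (P x * (norm x)\<^sup>2) + 2 * P x * gauss_mom2 TYPE('n)"
    and Bi: "integrable gauss (\<lambda>v. B (x, v))" for x
  proof -
    have 1: "integrable gauss (\<lambda>v :: real ^ 'n. 2 * (P x * (norm x)\<^sup>2))" by simp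
    have 2: "integrable gauss (\<lambda>v :: real ^ 'n. 2 * P x * (norm v)\<^sup>2)" by (intro integrable_mult_right m2)
    show "integrable gauss (\<lambda>v. B (x, v))" unfolding B_def fst_conv snd_conv by (rule Bochner_Integration.integrable_add[OF 1 2])
    show "(LINT v|gauss. B (x, v)) = 2 * (P x * (norm x)\<^sup>2) + 2 * P x * gauss_mom2 TYPE('n)"
      unfolding B_def fst_conv snd_conv Bochner_Integration.integral_add[OF 1 2] by simp
  qed
  have B_nn: "0 \<le> B p" for p unfolding B_def using nn[of "fst p"] by simp
  have iB: "integrable gauss2 B"
  proof (rule gauss_pair.Fubini_integrable)
    show "integrable gauss (\<lambda>x. LINT v|gauss. norm (B (x, v)))"
      using P P2 B_nn by (simp add: Bin)
  qed (use Bi in auto)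
  have yB: "P (fst p) * (norm (y p))\<^sup>2 \<le> B p" for p
  proof -
    have "norm (y p) \<le> norm (fst p) + norm (snd p)"
      using norm_rotation_le(2)[of t "snd p" "fst p"] norm_rotation_le(1)[of "- t" "fst p" "snd p"] by (simp add: y_def)
    then have "(norm (y p))\<^sup>2 \<le> (norm (fst p) + norm (snd p))\<^sup>2" by (intro power_mono) auto
    also have "\<dots> \<le> 2 * (norm (fst p))\<^sup>2 + 2 * (norm (snd p))\<^sup>2"
      using sum_squares_bound[of "norm (fst p)" "norm (snd p)"] by (simp add: power2_sum)
    finally show ?thesis
      using mult_left_mono[OF _ nn[of "fst p"]] by (fastforce simp: B_def algebra_simps)
  qed
  define F where "F p = P (fst p) * (norm (y p))\<^sup>2" for p
  define G where "G p = P (fst p) *\<^sub>R y p" for p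
  have FG_meas [measurable]: "F \<in> borel_measurable (borel \<Otimes>\<^sub>M borel)" "G \<in> borel_measurable (borel \<Otimes>\<^sub>M borel)"
    unfolding F_def[abs_def] G_def[abs_def] by measurable
  have iF: "integrable gauss2 F"
    by (rule Bochner_Integration.integrable_bound[OF iB])
      (measurable, use yB nn B_nn in \<open>auto intro!: AE_I2 simp: F_def abs_mult\<close>)
  have iP: "integrable gauss2 (\<lambda>p :: (real ^ 'n) \<times> (real ^ 'n). P (fst p))"
    by (rule gauss_pair.Fubini_integrable) (use P in auto)
  have iG: "integrable gauss2 G"
  proof (rule Bochner_Integration.integrable_bound)
    show "integrable gauss2 (\<lambda>p. P (fst p) + F p)" using iP iF by simp
    show "AE p in gauss2. norm (G p) \<le> norm (P (fst p) + F p)"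
    proof (rule AE_I2)
      fix p
      have "norm (y p) \<le> 1 + (norm (y p))\<^sup>2" using sum_squares_bound[of "norm (y p)" "1 / 2"] by (simp add: power2_eq_square)
      then have "P (fst p) * norm (y p) \<le> P (fst p) * (1 + (norm (y p))\<^sup>2)" by (rule mult_left_mono[OF _ nn])
      then show "norm (G p) \<le> norm (P (fst p) + F p)" using nn[of "fst p"] by (simp add: G_def F_def algebra_simps)
    qed
  qed measurable
  have rot: "integrable gauss2 (\<lambda>p. q (rotation t p))" if "integrable gauss2 q" "q \<in> borel_measurable (borel \<Otimes>\<^sub>M borel)"
    for q :: "(real ^ 'n) \<times> (real ^ 'n) \<Rightarrow> 'b::{banach, second_countable_topology}"
  proof -
    have "integrable (distr gauss2 (borel \<Otimes>\<^sub>M borel) (rotation t)) q" using that(1) by (simp only: gauss_rotation[OF t])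
    then show ?thesis using that(2) by (subst (asm) integrable_distr_eq) measurable
  qed
  have Frot: "F (rotation t (x, z)) = P (?c *\<^sub>R x + ?s *\<^sub>R z) * (norm x)\<^sup>2" for x z
    by (simp add: F_def y_def rotation_def cs)
  have Grot: "G (rotation t (x, z)) = P (?c *\<^sub>R x + ?s *\<^sub>R z) *\<^sub>R x" for x z
    by (simp add: G_def y_def rotation_def cs)
  have eF: "(LINT z|gauss. F (rotation t (x, z))) = mehler t P x * (norm x)\<^sup>2" for x
    unfolding Frot mehler_def by simp
  have AE: "AE x in gauss. integrable gauss (\<lambda>z. P (?c *\<^sub>R x + ?s *\<^sub>R z))" by (rule AE_mehler_integrable[OF t P])
  have eG: "AE x in gauss. (LINT z|gauss. G (rotation t (x, z))) = mehler t P x *\<^sub>R x"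
    using AE unfolding Grot mehler_def by eventually_elim simp
  show "integrable gauss (\<lambda>x. mehler t P x * (norm x)\<^sup>2)"
    using gauss_pair.integrable_fst'[OF rot[OF iF FG_meas(1)]] by (simp add: eF)
  show "integrable gauss (\<lambda>x. mehler t P x *\<^sub>R x)"
    using gauss_pair.integrable_fst'[OF rot[OF iG FG_meas(2)]]
    by (subst (asm) integrable_cong_AE[OF _ _ eG]) auto
  have "(LINT x|gauss. mehler t P x * (norm x)\<^sup>2) = (LINT p|gauss2. F p)"
    using gauss_pair.integral_fst'[OF rot[OF iF FG_meas(1)]] gauss_rotation_integral[OF t FG_meas(1)] by (simp add: eF)
  also have "\<dots> \<le> (LINT p|gauss2. B p)" by (rule integral_mono[OF iF iB]) (simp add: F_def yB)
  also have "\<dots> = (LINT x|gauss. LINT v|gauss. B (x, v))" by (rule gauss_pair.integral_fst'[OF iB, symmetric])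
  also have "\<dots> = (LINT x|gauss. 2 * (P x * (norm x)\<^sup>2) + (2 * gauss_mom2 TYPE('n)) * P x)"
    unfolding Bin by (simp add: mult_ac)
  also have "\<dots> = 2 * (LINT x|gauss. P x * (norm x)\<^sup>2) + 2 * gauss_mom2 TYPE('n) * (LINT x|gauss. P x)"
    by (subst Bochner_Integration.integral_add) (use P P2 in auto)
  finally show "(LINT x|gauss. mehler t P x * (norm x)\<^sup>2)
      \<le> 2 * (LINT x|gauss. P x * (norm x)\<^sup>2) + 2 * gauss_mom2 TYPE('n) * (LINT x|gauss. P x)" .
  have "(LINT x|gauss. mehler t P x *\<^sub>R x) = (LINT x|gauss. LINT z|gauss. G (rotation t (x, z)))"
    by (rule integral_cong_AE) (use eG in \<open>auto elim!: eventually_mono\<close>)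
  also have "\<dots> = (LINT p|gauss2. G p)"
    using gauss_pair.integral_fst'[OF rot[OF iG FG_meas(2)]] gauss_rotation_integral[OF t FG_meas(2)] by simp
  also have "\<dots> = (LINT u|gauss. LINT v|gauss. G (u, v))" by (rule gauss_pair.integral_fst'[OF iG, symmetric])
  also have "\<dots> = (LINT u|gauss. ?c *\<^sub>R (P u *\<^sub>R u))"
  proof (rule Bochner_Integration.integral_cong[OF refl])
    fix u :: "real ^ 'n"
    have i: "integrable gauss (\<lambda>v :: real ^ 'n. v)" by (rule integrable_gauss_quadratic[of _ 1 0 0]) auto
    have "(LINT v|gauss. G (u, v)) = (LINT v|gauss. (P u * ?c) *\<^sub>R u - (P u * ?s) *\<^sub>R v)"
      by (simp add: G_def y_def scaleR_diff_right)
    also have "\<dots> = (P u * ?c) *\<^sub>R u - (P u * ?s) *\<^sub>R (LINT v|gauss. v)"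
      using i by (subst Bochner_Integration.integral_diff) auto
    finally show "(LINT v|gauss. G (u, v)) = ?c *\<^sub>R (P u *\<^sub>R u)" by (simp add: integral_gauss_id mult.commute)
  qed
  also have "\<dots> = ?c *\<^sub>R (LINT u|gauss. P u *\<^sub>R u)" by (rule integral_scaleR_right)
  finally show "(LINT x|gauss. mehler t P x *\<^sub>R x) = ?c *\<^sub>R (LINT x|gauss. P x *\<^sub>R x)" .
qed

lemma x_ln_x_ge: "x > 0 \<Longrightarrow> - 1 \<le> x * ln (x :: real)"
proof -
  assume x: "x > 0"
  have "ln (1 / x) \<le> 1 / x - 1" using x by (intro ln_le_minus_one) simp
  then have "1 - 1 / x \<le> ln x" using x by (simp add: ln_div)
  then have "x * (1 - 1 / x) \<le> x * ln x" using x by (intro mult_left_mono) auto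
  then show ?thesis using x by (simp add: algebra_simps)
qed

text \<open>Positive approximants allow the one-sided limit at 0, and the default
  \<open>ln 0\<close> is harmless there because it is multiplied by 0.\<close>

lemma x_ln_x_tendsto:
  assumes g: "g \<longlonglongrightarrow> (a :: real)" and pos: "\<And>j. g j > 0"
  shows "(\<lambda>j. g j * ln (g j)) \<longlonglongrightarrow> a * ln a"
proof (cases "a = 0")
  case True
  have "((\<lambda>x :: real. x * ln x) \<longlongrightarrow> 0) (at_right 0)" by real_asymp
  moreover have "filterlim g (at_right 0) sequentially"
    using g pos True less_imp_neq[OF pos] by (auto simp: filterlim_at intro!: always_eventually)
  ultimately show ?thesis using True by (auto dest: filterlim_compose)
next
  case False
  have "0 \<le> a" by (rule LIMSEQ_le_const[OF g]) (use pos in \<open>auto intro: less_imp_le\<close>)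
  then show ?thesis using False by (intro tendsto_intros g) auto
qed

text \<open>The density is the square of \<open>u\<close>. The sign of \<open>u\<close> is left
  free, since \<open>sqrt (f x)\<close> may be negative on a null set.\<close>

locale sobolev_root =
  fixes u :: "real ^ 'n \<Rightarrow> real" and p :: "real ^ 'n \<Rightarrow> real ^ 'n"
  assumes u_meas [measurable]: "u \<in> borel_measurable borel" and p_meas [measurable]: "p \<in> borel_measurable borel"
    and p2: "integrable gauss (\<lambda>x. (norm (p x))\<^sup>2)"
    and wg: "has_weak_gradient u p"
    and u2: "integrable gauss (\<lambda>x. (u x)\<^sup>2)" and mass: "(LINT x|gauss. (u x)\<^sup>2) = 1"
    and mom: "integrable gauss (\<lambda>x. (u x)\<^sup>2 * (norm x)\<^sup>2)"
    and mean: "(LINT x|gauss. (u x)\<^sup>2 *\<^sub>R x) = 0"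
begin

text \<open>With \<open>v = b j u\<close> we have \<open>\<nabla>v = q j\<close>, \<open>P j = v\<^sup>2\<close> and \<open>W j = \<nabla>(v\<^sup>2)\<close>; \<open>H j\<close> is the Fisher integrand
  \<open>|W j|\<^sup>2 / P j\<close>.\<close>

definition "b j = (bump (real (Suc j)) :: real ^ 'n \<Rightarrow> real)"
definition "P j x = b j x * b j x * (u x)\<^sup>2"
definition "q j x = b j x *\<^sub>R p x + u x *\<^sub>R grad (b j) x"
definition "W j x = (2 * (b j x * u x)) *\<^sub>R q j x"
definition "H j x = (if b j x * u x = 0 then 0 else 4 * (norm (q j x))\<^sup>2)"

lemma b_bounds: "0 \<le> b j x" "b j x \<le> 1"
  unfolding b_def by (rule bump_bounds)+

lemma wg2: "has_weak_gradient (\<lambda>x. (u x)\<^sup>2) (\<lambda>x. (2 * u x) *\<^sub>R p x)"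
  by (rule weak_gradient_square[OF u_meas p_meas u2 p2 wg])

lemma cutoff: "cutoff (\<lambda>x. (u x)\<^sup>2) (\<lambda>x. (2 * u x) *\<^sub>R p x) (\<lambda>y. bump (real (Suc j)) y * bump (real (Suc j)) y)
    (max 1 (8 * exp 1 / real (Suc j))) (real (Suc j))"
  by (rule cutoff_bump_square[OF wg2]) auto

lemma cutoff_P: "cutoff.P (\<lambda>x. (u x)\<^sup>2) (\<lambda>y. bump (real (Suc j)) y * bump (real (Suc j)) y) = P j"
proof -
  interpret c: cutoff "\<lambda>x. (u x)\<^sup>2" "\<lambda>x. (2 * u x) *\<^sub>R p x" "\<lambda>y. bump (real (Suc j)) y * bump (real (Suc j)) y"
    "max 1 (8 * exp 1 / real (Suc j))" "real (Suc j)" by (rule cutoff)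
  show ?thesis by (rule ext) (simp only: c.P_def P_def b_def)
qed

lemma cutoff_W: "cutoff.W (\<lambda>x. (u x)\<^sup>2) (\<lambda>x. (2 * u x) *\<^sub>R p x) (\<lambda>y. bump (real (Suc j)) y * bump (real (Suc j)) y) = W j"
proof -
  interpret c: cutoff "\<lambda>x. (u x)\<^sup>2" "\<lambda>x. (2 * u x) *\<^sub>R p x" "\<lambda>y. bump (real (Suc j)) y * bump (real (Suc j)) y"
    "max 1 (8 * exp 1 / real (Suc j))" "real (Suc j)" by (rule cutoff)
  show ?thesis
    by (rule ext) (simp only: c.W_def W_def q_def b_def grad_bump_square, simp add: algebra_simps power2_eq_square)
qed

lemma PW_meas [measurable]: "P j \<in> borel_measurable borel" "W j \<in> borel_measurable borel"
  unfolding cutoff_P[symmetric] cutoff_W[symmetric]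
  by (rule cutoff.P_meas[OF cutoff] cutoff.W_meas[OF cutoff])+

lemma b_meas [measurable]: "b j \<in> borel_measurable borel" "grad (b j) \<in> borel_measurable borel"
proof -
  interpret c: cutoff u p "bump (real (Suc j))" "max 1 (4 * exp 1 / real (Suc j))" "real (Suc j)"
    by (rule cutoff_bump[OF wg]) auto
  show "b j \<in> borel_measurable borel" "grad (b j) \<in> borel_measurable borel"
    unfolding b_def by (rule c.\<zeta>_meas c.grad_\<zeta>_meas)+
qed

lemma H_meas [measurable]: "H j \<in> borel_measurable borel"
  unfolding H_def[abs_def] q_def by measurable

lemma P_nonneg: "0 \<le> P j x" and P_le: "P j x \<le> (u x)\<^sup>2"
proof -
  show "0 \<le> P j x" using b_bounds[of j x] by (simp add: P_def)
  have "b j x * b j x \<le> 1" using b_bounds[of j x] by (simp add: mult_le_one)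
  then show "P j x \<le> (u x)\<^sup>2" using mult_right_mono[of "b j x * b j x" 1 "(u x)\<^sup>2"] by (simp add: P_def)
qed

lemma P_int: "integrable gauss (P j)"
  by (rule Bochner_Integration.integrable_bound[OF u2]) (measurable, use P_nonneg P_le in \<open>auto intro!: AE_I2\<close>)

lemma P_mom_int: "integrable gauss (\<lambda>x. P j x * (norm x)\<^sup>2)"
  by (rule Bochner_Integration.integrable_bound[OF mom])
    (measurable, use P_nonneg P_le in \<open>auto intro!: AE_I2 mult_right_mono simp: abs_mult\<close>)

lemma norm_grad_b: "norm (grad (b j) x) \<le> 4 * exp 1 / real (Suc j)"
  unfolding b_def by (rule norm_grad_bump) simp

lemma q_le: "norm (q j x) \<le> norm (p x) + 4 * exp 1 * \<bar>u x\<bar>"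
proof -
  have "4 * exp 1 / real (Suc j) \<le> 4 * exp 1" by (simp add: divide_le_eq)
  then have g: "norm (grad (b j) x) \<le> 4 * exp 1" using norm_grad_b[of j x] by linarith
  have "norm (q j x) \<le> b j x * norm (p x) + \<bar>u x\<bar> * norm (grad (b j) x)"
    unfolding q_def using norm_triangle_ineq[of "b j x *\<^sub>R p x" "u x *\<^sub>R grad (b j) x"] b_bounds[of j x] by simp
  also have "\<dots> \<le> 1 * norm (p x) + \<bar>u x\<bar> * (4 * exp 1)"
    by (intro add_mono mult_right_mono mult_left_mono b_bounds g) auto
  finally show ?thesis by (simp add: mult.commute)
qed

lemma H_nonneg: "0 \<le> H j x" by (simp add: H_def)

lemma H_le: "H j x \<le> 8 * (norm (p x))\<^sup>2 + 8 * (4 * exp 1)\<^sup>2 * (u x)\<^sup>2"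
proof -
  have "(norm (q j x))\<^sup>2 \<le> (norm (p x) + 4 * exp 1 * \<bar>u x\<bar>)\<^sup>2" by (intro power_mono q_le) simp
  also have "\<dots> \<le> 2 * (norm (p x))\<^sup>2 + 2 * (4 * exp 1 * \<bar>u x\<bar>)\<^sup>2"
    using sum_squares_bound[of "norm (p x)" "4 * exp 1 * \<bar>u x\<bar>"] by (simp add: power2_sum)
  finally show ?thesis by (simp add: H_def power_mult_distrib)
qed

lemma H_bound_int: "integrable gauss (\<lambda>x. 8 * (norm (p x))\<^sup>2 + 8 * (4 * exp 1)\<^sup>2 * (u x)\<^sup>2)"
  using u2 p2 by simp

lemma H_int: "integrable gauss (H j)"
  by (rule Bochner_Integration.integrable_bound[OF H_bound_int])
    (measurable, use H_nonneg H_le in \<open>auto intro!: AE_I2 simp del: power_mult_distrib\<close>)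

lemma W_square: "(norm (W j x))\<^sup>2 \<le> H j x * P j x"
  by (simp add: W_def H_def P_def power_mult_distrib) (simp add: power2_eq_square mult_ac)

lemma W_int: "integrable gauss (W j)"
proof (rule Bochner_Integration.integrable_bound)
  show "integrable gauss (\<lambda>x. H j x + P j x)" using H_int P_int by simp
  show "AE x in gauss. norm (W j x) \<le> norm (H j x + P j x)"
  proof (rule AE_I2)
    fix x
    have "norm (W j x) \<le> sqrt (H j x * P j x)" by (rule real_le_rsqrt[OF W_square])
    also have "\<dots> \<le> (H j x + P j x) / 2" using arith_geo_mean_sqrt[OF H_nonneg P_nonneg] .
    finally show "norm (W j x) \<le> norm (H j x + P j x)" using H_nonneg[of j x] P_nonneg[of j x] by simp
  qed
qed measurable

text \<open>On \<open>u = 0\<close> the Fisher integrand has the form \<open>a / 0\<close>, with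
  value 0, and the zero branch reproduces this. Elsewhere \<open>|2 u p|^2 / u^2\<close> is
  \<open>4 |p|^2\<close>.\<close>

definition "I0 = (LINT x|gauss. (if u x = 0 then 0 else 4 * (norm (p x))\<^sup>2))"

lemma b_tendsto: "(\<lambda>j. b j x) \<longlonglongrightarrow> 1"
  unfolding b_def by (rule bump_tendsto)

lemma grad_b_tendsto: "(\<lambda>j. grad (b j) x) \<longlonglongrightarrow> 0"
proof (rule Lim_null_comparison)
  show "\<forall>\<^sub>F j in sequentially. norm (grad (b j) x) \<le> 4 * exp 1 / real (Suc j)"
    using norm_grad_b by (intro always_eventually) auto
  have "(\<lambda>j. 4 * exp 1 * inverse (real (Suc j))) \<longlonglongrightarrow> 4 * exp 1 * 0" by (intro tendsto_intros LIMSEQ_inverse_real_of_nat)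
  then show "(\<lambda>j. 4 * exp 1 / real (Suc j)) \<longlonglongrightarrow> (0 :: real)" by (simp add: divide_inverse)
qed

lemma H_tendsto: "(\<lambda>j. LINT x|gauss. H j x) \<longlonglongrightarrow> I0"
  unfolding I0_def
proof (rule integral_dominated_convergence[OF _ _ H_bound_int])
  show "AE x in gauss. (\<lambda>j. H j x) \<longlonglongrightarrow> (if u x = 0 then 0 else 4 * (norm (p x))\<^sup>2)"
  proof (rule AE_I2)
    fix x
    have q: "(\<lambda>j. q j x) \<longlonglongrightarrow> p x"
      using tendsto_add[OF tendsto_scaleR[OF b_tendsto tendsto_const[of "p x"]] tendsto_scaleR[OF tendsto_const[of "u x"] grad_b_tendsto], of x x]
      by (simp add: q_def)
    show "(\<lambda>j. H j x) \<longlonglongrightarrow> (if u x = 0 then 0 else 4 * (norm (p x))\<^sup>2)"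
    proof (cases "u x = 0")
      case False
      \<comment> \<open>Once \<open>b j x\<close> is positive, the zero branch of \<open>H j\<close>
        is decided by \<open>u x\<close> alone.\<close>
      have "eventually (\<lambda>j. b j x > 0) sequentially" using b_tendsto[of x] by (rule order_tendstoD(1)) simp
      then have "eventually (\<lambda>j. 4 * (norm (q j x))\<^sup>2 = H j x) sequentially"
        by eventually_elim (use False in \<open>auto simp: H_def\<close>)
      moreover have "(\<lambda>j. 4 * (norm (q j x))\<^sup>2) \<longlonglongrightarrow> 4 * (norm (p x))\<^sup>2" by (intro tendsto_intros q)
      ultimately have "(\<lambda>j. H j x) \<longlonglongrightarrow> 4 * (norm (p x))\<^sup>2" by (rule Lim_transform_eventually[rotated])
      then show ?thesis using False by simp
    qed (simp add: H_def)
  qed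
  show "AE x in gauss. norm (H j x) \<le> 8 * (norm (p x))\<^sup>2 + 8 * (4 * exp 1)\<^sup>2 * (u x)\<^sup>2" for j
    using H_le H_nonneg by (intro AE_I2) simp
qed measurable

lemma P_tendsto: "(\<lambda>j. P j x) \<longlonglongrightarrow> (u x)\<^sup>2"
  using tendsto_mult[OF tendsto_mult[OF b_tendsto b_tendsto] tendsto_const[of "(u x)\<^sup>2"], of x x] by (simp add: P_def)

lemma P_L1: "(\<lambda>j. LINT x|gauss. \<bar>P j x - (u x)\<^sup>2\<bar>) \<longlonglongrightarrow> 0"
proof -
  have "(\<lambda>j. LINT x|gauss. \<bar>P j x - (u x)\<^sup>2\<bar>) \<longlonglongrightarrow> (LINT x|(gauss :: (real ^ 'n) measure). 0)"
  proof (rule integral_dominated_convergence[where w = "\<lambda>x. (u x)\<^sup>2"])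
    show "AE x in gauss. (\<lambda>j. \<bar>P j x - (u x)\<^sup>2\<bar>) \<longlonglongrightarrow> 0"
      using P_tendsto by (intro AE_I2 tendsto_rabs_zero) (simp add: LIM_zero_iff)
    show "AE x in gauss. norm \<bar>P j x - (u x)\<^sup>2\<bar> \<le> (u x)\<^sup>2" for j
    proof (rule AE_I2)
      fix x show "norm \<bar>P j x - (u x)\<^sup>2\<bar> \<le> (u x)\<^sup>2" using P_le[of j x] P_nonneg[of j x] by simp
    qed
  qed (use u2 in auto)
  then show ?thesis by simp
qed

lemma P_mass: "(\<lambda>j. LINT x|gauss. P j x) \<longlonglongrightarrow> 1"
  unfolding mass[symmetric]
  by (rule integral_dominated_convergence[where w = "\<lambda>x. (u x)\<^sup>2"])
    (use u2 P_tendsto P_le P_nonneg in \<open>auto intro!: AE_I2\<close>)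

lemma P_mean: "(\<lambda>j. LINT x|gauss. P j x *\<^sub>R x) \<longlonglongrightarrow> 0"
  unfolding mean[symmetric]
proof (rule integral_dominated_convergence[where w = "\<lambda>x. (u x)\<^sup>2 + (u x)\<^sup>2 * (norm x)\<^sup>2"])
  show "AE x in gauss. (\<lambda>j. P j x *\<^sub>R x) \<longlonglongrightarrow> (u x)\<^sup>2 *\<^sub>R x"
    by (intro AE_I2 tendsto_intros P_tendsto)
  show "AE x in gauss. norm (P j x *\<^sub>R x) \<le> (u x)\<^sup>2 + (u x)\<^sup>2 * (norm x)\<^sup>2" for j
  proof (rule AE_I2)
    fix x :: "real ^ 'n"
    have "norm x \<le> 1 + (norm x)\<^sup>2" using sum_squares_bound[of "norm x" "1 / 2"] by (simp add: power2_eq_square)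
    then have "P j x * norm x \<le> (u x)\<^sup>2 * (1 + (norm x)\<^sup>2)"
      by (intro mult_mono P_le) auto
    then show "norm (P j x *\<^sub>R x) \<le> (u x)\<^sup>2 + (u x)\<^sup>2 * (norm x)\<^sup>2"
      using P_nonneg[of j x] by (simp add: algebra_simps)
  qed
qed (use u2 mom in auto)

section \<open>The regularized densities \<open>g j\<close>\<close>

lemma mehler_index: "\<exists>m. (LINT x|gauss. norm (mehler (tseq m) (P j) x - P j x)) < tseq j"
proof -
  have "eventually (\<lambda>m. (LINT x|gauss. norm (mehler (tseq m) (P j) x - P j x)) < tseq j) sequentially"
    by (rule order_tendstoD(2)[OF mehler_L1_tendsto[OF P_int tseq_tendsto cos_tseq']]) (rule tseq_bounds)
  then show ?thesis by (auto simp: eventually_sequentially)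
qed

text \<open>A diagonal choice: the angle is so small that mollifying the \<open>j\<close>-th cut-off
  density costs less than \<open>tseq j\<close> in L1.\<close>

definition "\<tau> j = tseq (SOME m. (LINT x|gauss. norm (mehler (tseq m) (P j) x - P j x)) < tseq j)"

lemma \<tau>: "(LINT x|gauss. norm (mehler (\<tau> j) (P j) x - P j x)) < tseq j"
  unfolding \<tau>_def using someI_ex[OF mehler_index[of j]] .

lemma sin_\<tau>: "0 < sin (\<tau> j)" and cos_\<tau>: "0 < cos (\<tau> j)" and cos_\<tau>': "cos (\<tau> j) \<noteq> - 1"
  unfolding \<tau>_def by (rule sin_tseq cos_tseq cos_tseq')+

text \<open>Adding \<open>tseq j\<close> bounds the density away from 0. Dividing by
  \<open>Z j\<close> restores mass 1, because \<open>mehler\<close> preserves integrals;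
  \<open>A j\<close> is the gradient of \<open>g j\<close>.\<close>

definition "Z j = (LINT x|gauss. P j x) + tseq j"
definition "g j x = (mehler (\<tau> j) (P j) x + tseq j) / Z j"
definition "A j x = (cos (\<tau> j) / Z j) *\<^sub>R mehler (\<tau> j) (W j) x"

lemma Z_pos: "0 < Z j"
proof -
  have "0 \<le> (LINT x|gauss. P j x)" by (rule Bochner_Integration.integral_nonneg) (rule P_nonneg)
  then show ?thesis unfolding Z_def using tseq_bounds(1)[of j] by linarith
qed

lemma Z_tendsto: "Z \<longlonglongrightarrow> 1"
  unfolding Z_def[abs_def] using tendsto_add[OF P_mass tseq_tendsto] by simp

lemma mehler_P_nonneg: "0 \<le> mehler t (P j) x"
  unfolding mehler_def by (rule Bochner_Integration.integral_nonneg) (rule P_nonneg)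

lemma mehler_P_int: "integrable gauss (mehler (\<tau> j) (P j))"
  by (rule mehler_integrable[OF cos_\<tau>' P_int])

lemma nice: "\<exists>C. nice_density (g j) (A j) C (tseq j / Z j)"
proof -
  obtain K where "bounded_gradient (mehler (\<tau> j) (P j)) (\<lambda>x. cos (\<tau> j) *\<^sub>R mehler (\<tau> j) (W j) x) K"
    using cutoff.mehler_cutoff_bounded_gradient[OF cutoff sin_\<tau> cos_\<tau>] unfolding cutoff_P cutoff_W by blast
  then interpret B: bounded_gradient "mehler (\<tau> j) (P j)" "\<lambda>x. cos (\<tau> j) *\<^sub>R mehler (\<tau> j) (W j) x" K .
  have "nice_density (g j) (A j) ((K + tseq j) / Z j) (tseq j / Z j)"
  proof
    show "(g j has_derivative (\<lambda>h. A j x \<bullet> h)) (at x)" for x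
    proof -
      have "((\<lambda>x. (1 / Z j) * (mehler (\<tau> j) (P j) x + tseq j)) has_derivative
        (\<lambda>h. (1 / Z j) * ((cos (\<tau> j) *\<^sub>R mehler (\<tau> j) (W j) x) \<bullet> h + 0))) (at x)"
        by (intro has_derivative_mult_right has_derivative_add B.der has_derivative_const)
      then show ?thesis by (simp add: g_def[abs_def] A_def)
    qed
    show "A j \<in> borel_measurable borel" unfolding A_def[abs_def] by measurable
    have t: "0 < tseq j" by (rule tseq_bounds)
    show "\<bar>g j x\<bar> \<le> (K + tseq j) / Z j" for x
      using B.g_bd[of x] mehler_P_nonneg[of "\<tau> j" j x] Z_pos[of j] t by (simp add: g_def divide_right_mono)
    show "norm (A j x) \<le> (K + tseq j) / Z j" for x
    proof -
      have "norm (A j x) = norm (cos (\<tau> j) *\<^sub>R mehler (\<tau> j) (W j) x) / Z j"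
        using Z_pos[of j] by (simp add: A_def)
      also have "\<dots> \<le> (K + tseq j) / Z j" using B.A_bd[of x] t Z_pos[of j] by (intro divide_right_mono) auto
      finally show ?thesis .
    qed
    show "0 < tseq j / Z j" using t Z_pos[of j] by simp
    show "tseq j / Z j \<le> g j x" for x
      using mehler_P_nonneg[of "\<tau> j" j x] Z_pos[of j] by (simp add: g_def divide_right_mono)
    have "(LINT x|gauss. g j x) = ((LINT x|gauss. mehler (\<tau> j) (P j) x) + tseq j) / Z j"
      unfolding g_def using mehler_P_int[of j] by simp
    also have "\<dots> = 1" unfolding mehler_integral[OF cos_\<tau>' P_int] using Z_pos[of j] by (simp add: Z_def)
    finally show "(LINT x|gauss. g j x) = 1" .
  qed
  then show ?thesis ..
qed

lemma g_pos: "0 < g j x"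
proof -
  obtain C where "nice_density (g j) (A j) C (tseq j / Z j)" using nice by blast
  then show ?thesis by (rule nice_density.g_pos)
qed

lemma gA_meas [measurable]: "g j \<in> borel_measurable borel" "A j \<in> borel_measurable borel"
  unfolding g_def[abs_def] A_def[abs_def] by measurable

lemma g_int: "integrable gauss (g j)"
  unfolding g_def[abs_def] using mehler_P_int[of j] by simp

lemma g_L1: "(\<lambda>j. LINT x|gauss. \<bar>g j x - (u x)\<^sup>2\<bar>) \<longlonglongrightarrow> 0"
proof (rule Lim_null_comparison)
  show "\<forall>\<^sub>F j in sequentially. norm (LINT x|gauss. \<bar>g j x - (u x)\<^sup>2\<bar>)
    \<le> (tseq j + (LINT x|gauss. \<bar>P j x - (u x)\<^sup>2\<bar>) + tseq j + \<bar>1 - Z j\<bar>) / Z j"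
  proof (intro always_eventually allI)
    fix j
    note i = mehler_P_int[of j] P_int[of j] u2 g_int[of j]
    have "(LINT x|gauss. \<bar>g j x - (u x)\<^sup>2\<bar>) \<le> (LINT x|gauss. (norm (mehler (\<tau> j) (P j) x - P j x)
       + \<bar>P j x - (u x)\<^sup>2\<bar> + tseq j + \<bar>1 - Z j\<bar> * (u x)\<^sup>2) / Z j)"
    proof (rule integral_mono)
      fix x
      have "g j x - (u x)\<^sup>2 = ((mehler (\<tau> j) (P j) x - P j x) + (P j x - (u x)\<^sup>2) + tseq j + (1 - Z j) * (u x)\<^sup>2) / Z j"
        using Z_pos[of j] by (simp add: g_def field_simps)
      then have "\<bar>g j x - (u x)\<^sup>2\<bar> = \<bar>(mehler (\<tau> j) (P j) x - P j x) + (P j x - (u x)\<^sup>2) + tseq j + (1 - Z j) * (u x)\<^sup>2\<bar> / Z j"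
        using Z_pos[of j] by simp
      also have "\<dots> \<le> (norm (mehler (\<tau> j) (P j) x - P j x) + \<bar>P j x - (u x)\<^sup>2\<bar> + tseq j + \<bar>1 - Z j\<bar> * (u x)\<^sup>2) / Z j"
      proof (intro divide_right_mono)
        have "\<bar>(1 - Z j) * (u x)\<^sup>2\<bar> = \<bar>1 - Z j\<bar> * (u x)\<^sup>2" by (simp add: abs_mult)
        then show "\<bar>(mehler (\<tau> j) (P j) x - P j x) + (P j x - (u x)\<^sup>2) + tseq j + (1 - Z j) * (u x)\<^sup>2\<bar>
          \<le> norm (mehler (\<tau> j) (P j) x - P j x) + \<bar>P j x - (u x)\<^sup>2\<bar> + tseq j + \<bar>1 - Z j\<bar> * (u x)\<^sup>2"
          using tseq_bounds(1)[of j] unfolding real_norm_def by linarith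
      qed (use Z_pos[of j] in simp)
      finally show "\<bar>g j x - (u x)\<^sup>2\<bar> \<le> (norm (mehler (\<tau> j) (P j) x - P j x) + \<bar>P j x - (u x)\<^sup>2\<bar> + tseq j + \<bar>1 - Z j\<bar> * (u x)\<^sup>2) / Z j" .
    qed (use i in auto)
    also have "\<dots> = ((LINT x|gauss. norm (mehler (\<tau> j) (P j) x - P j x)) + (LINT x|gauss. \<bar>P j x - (u x)\<^sup>2\<bar>) + tseq j + \<bar>1 - Z j\<bar>) / Z j"
      using i mass by simp
    also have "\<dots> \<le> (tseq j + (LINT x|gauss. \<bar>P j x - (u x)\<^sup>2\<bar>) + tseq j + \<bar>1 - Z j\<bar>) / Z j"
      using \<tau>[of j] Z_pos[of j] by (intro divide_right_mono) auto
    finally show "norm (LINT x|gauss. \<bar>g j x - (u x)\<^sup>2\<bar>)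
      \<le> (tseq j + (LINT x|gauss. \<bar>P j x - (u x)\<^sup>2\<bar>) + tseq j + \<bar>1 - Z j\<bar>) / Z j" by simp
  qed
  have "(\<lambda>j. (tseq j + (LINT x|gauss. \<bar>P j x - (u x)\<^sup>2\<bar>) + tseq j + \<bar>1 - Z j\<bar>) / Z j) \<longlonglongrightarrow> (0 + 0 + 0 + \<bar>1 - 1\<bar>) / 1"
    by (intro tendsto_intros tseq_tendsto P_L1 Z_tendsto) simp
  then show "(\<lambda>j. (tseq j + (LINT x|gauss. \<bar>P j x - (u x)\<^sup>2\<bar>) + tseq j + \<bar>1 - Z j\<bar>) / Z j) \<longlonglongrightarrow> 0" by simp
qed

lemma g_second_moment:
  "(LINT x|gauss. g j x * (norm x)\<^sup>2)
    \<le> (2 * (LINT x|gauss. (u x)\<^sup>2 * (norm x)\<^sup>2) + 2 * gauss_mom2 TYPE('n) + tseq j * gauss_mom2 TYPE('n)) / Z j"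
proof -
  note i = mehler_second_moment_integrable[OF cos_\<tau>' P_int P_nonneg P_mom_int, of j]
  have m: "integrable gauss (\<lambda>x :: real ^ 'n. tseq j * (norm x)\<^sup>2)" by (intro integrable_mult_right integrable_gauss_norm2)
  have "(LINT x|gauss. g j x * (norm x)\<^sup>2) = (LINT x|gauss. (mehler (\<tau> j) (P j) x * (norm x)\<^sup>2 + tseq j * (norm x)\<^sup>2) / Z j)"
    by (simp add: g_def algebra_simps)
  also have "\<dots> = ((LINT x|gauss. mehler (\<tau> j) (P j) x * (norm x)\<^sup>2) + (LINT x|(gauss :: (real ^ 'n) measure). tseq j * (norm x)\<^sup>2)) / Z j"
    unfolding integral_divide_zero Bochner_Integration.integral_add[OF i m] ..
  also have "\<dots> \<le> (2 * (LINT x|gauss. (u x)\<^sup>2 * (norm x)\<^sup>2) + 2 * gauss_mom2 TYPE('n) + tseq j * gauss_mom2 TYPE('n)) / Z j"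
  proof (intro divide_right_mono add_mono)
    have m2: "0 \<le> gauss_mom2 TYPE('n)" by (rule Bochner_Integration.integral_nonneg) simp
    have "(LINT x|gauss. P j x) \<le> 1" unfolding mass[symmetric] by (rule integral_mono[OF P_int u2 P_le])
    then have "2 * gauss_mom2 TYPE('n) * (LINT x|gauss. P j x) \<le> 2 * gauss_mom2 TYPE('n) * 1"
      using m2 by (intro mult_left_mono) auto
    moreover have "(LINT x|gauss. P j x * (norm x)\<^sup>2) \<le> (LINT x|gauss. (u x)\<^sup>2 * (norm x)\<^sup>2)"
      by (rule integral_mono[OF P_mom_int mom]) (simp add: P_le mult_right_mono)
    ultimately show "(LINT x|gauss. mehler (\<tau> j) (P j) x * (norm x)\<^sup>2)
      \<le> 2 * (LINT x|gauss. (u x)\<^sup>2 * (norm x)\<^sup>2) + 2 * gauss_mom2 TYPE('n)"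
      using mehler_second_moment[OF cos_\<tau>' P_int P_nonneg P_mom_int, of j j] by linarith
  qed (use Z_pos[of j] in auto)
  finally show ?thesis .
qed

text \<open>The added constant contributes nothing because the Gaussian is centered, and
  mollification only contracts the mean by a cosine.\<close>

lemma g_mean: "norm (LINT x|gauss. g j x *\<^sub>R x) \<le> norm (LINT x|gauss. P j x *\<^sub>R x) / Z j"
proof -
  note i = mehler_mean_integrable[OF cos_\<tau>' P_int P_nonneg P_mom_int, of j]
  have m: "integrable gauss (\<lambda>x :: real ^ 'n. tseq j *\<^sub>R x)"
    by (rule integrable_gauss_quadratic[of _ "\<bar>tseq j\<bar>" 0 0]) auto
  have "(LINT x|gauss. g j x *\<^sub>R x) = (LINT x|gauss. (1 / Z j) *\<^sub>R (mehler (\<tau> j) (P j) x *\<^sub>R x + tseq j *\<^sub>R x))"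
    by (intro Bochner_Integration.integral_cong refl) (simp add: g_def scaleR_add_left[symmetric])
  also have "\<dots> = (1 / Z j) *\<^sub>R (cos (\<tau> j) *\<^sub>R (LINT x|gauss. P j x *\<^sub>R x))"
    unfolding integral_scaleR_right Bochner_Integration.integral_add[OF i m] mehler_mean[OF cos_\<tau>' P_int P_nonneg P_mom_int]
    by (simp add: integral_gauss_id)
  finally have "norm (LINT x|gauss. g j x *\<^sub>R x) = \<bar>cos (\<tau> j)\<bar> * norm (LINT x|gauss. P j x *\<^sub>R x) / Z j"
    using Z_pos[of j] by simp
  also have "\<dots> \<le> 1 * norm (LINT x|gauss. P j x *\<^sub>R x) / Z j"
    using Z_pos[of j] by (intro divide_right_mono mult_right_mono) auto
  finally show ?thesis by simp
qed

text \<open>Cauchy-Schwarz under the mollifier bounds \<open>|mehler W|^2\<close> by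
  \<open>mehler H\<close> times \<open>mehler P\<close>. The additive \<open>tseq j\<close> enlarges
  the denominator and the cosine shrinks the numerator, so both help; \<open>mehler\<close>
  preserves the integral of \<open>H j\<close>.\<close>

lemma g_fisher: "(LINT x|gauss. (norm (A j x))\<^sup>2 / g j x) \<le> (LINT x|gauss. H j x) / Z j"
proof -
  have iH: "integrable gauss (\<lambda>x. mehler (\<tau> j) (H j) x / Z j)" using mehler_integrable[OF cos_\<tau>' H_int, of j j] by simp
  have AE: "AE x in gauss. (norm (A j x))\<^sup>2 / g j x \<le> mehler (\<tau> j) (H j) x / Z j"
    using AE_mehler_integrable[OF cos_\<tau>' H_int, of j j] AE_mehler_integrable[OF cos_\<tau>' P_int, of j j] AE_mehler_integrable[OF cos_\<tau>' W_int, of j j]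
  proof eventually_elim
    case (elim x)
    let ?w = "norm (mehler (\<tau> j) (W j) x)" and ?P = "mehler (\<tau> j) (P j) x" and ?H = "mehler (\<tau> j) (H j) x"
    have t: "0 < tseq j" by (rule tseq_bounds)
    have P0: "0 \<le> ?P" by (rule mehler_P_nonneg)
    have H0: "0 \<le> ?H" unfolding mehler_def by (rule Bochner_Integration.integral_nonneg) (rule H_nonneg)
    have "?w\<^sup>2 \<le> ?H * ?P" unfolding mehler_def
      by (rule norm_integral_square_le[OF elim(3,1,2)]) (auto intro: H_nonneg P_nonneg W_square)
    also have "\<dots> \<le> ?H * (?P + tseq j)" using t H0 by (intro mult_left_mono) auto
    finally have w: "?w\<^sup>2 \<le> ?H * (?P + tseq j)" .
    have "(cos (\<tau> j))\<^sup>2 * ?w\<^sup>2 \<le> 1 * ?w\<^sup>2" by (intro mult_right_mono) (auto simp: abs_square_le_1)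
    then have w': "(cos (\<tau> j))\<^sup>2 * ?w\<^sup>2 \<le> ?H * (?P + tseq j)" using w by simp
    have "(norm (A j x))\<^sup>2 / g j x = ((cos (\<tau> j))\<^sup>2 * ?w\<^sup>2 / (?P + tseq j)) / Z j"
      using Z_pos[of j] cos_\<tau>[of j] by (simp add: A_def g_def power_mult_distrib power_divide power2_eq_square mult_ac)
    also have "\<dots> \<le> ?H / Z j"
      using w' t P0 Z_pos[of j] by (intro divide_right_mono) (auto simp: pos_divide_le_eq add_nonneg_pos)
    finally show ?case .
  qed
  have nn: "0 \<le> (norm (A j x))\<^sup>2 / g j x" for x using g_pos[of j x] by simp
  have iA: "integrable gauss (\<lambda>x. (norm (A j x))\<^sup>2 / g j x)"
  proof (rule Bochner_Integration.integrable_bound[OF iH])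
    show "AE x in gauss. norm ((norm (A j x))\<^sup>2 / g j x) \<le> norm (mehler (\<tau> j) (H j) x / Z j)"
      using AE
    proof eventually_elim
      case (elim x)
      then show ?case using nn[of x] unfolding real_norm_def by linarith
    qed
  qed measurable
  have "(LINT x|gauss. (norm (A j x))\<^sup>2 / g j x) \<le> (LINT x|gauss. mehler (\<tau> j) (H j) x / Z j)"
    by (rule integral_mono_AE[OF iA iH AE])
  also have "\<dots> = (LINT x|gauss. H j x) / Z j" using mehler_integral[OF cos_\<tau>' H_int, of j j] by simp
  finally show ?thesis .
qed

end

lemma (in nice_density) g_ln_g_integrable: "integrable gauss (\<lambda>x. g x * ln (g x))"
proof (rule integrable_gauss_bounded[of _ "C * (\<bar>ln \<kappa>\<bar> + \<bar>ln C\<bar>)"])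
  show "norm (g x * ln (g x)) \<le> C * (\<bar>ln \<kappa>\<bar> + \<bar>ln C\<bar>)" for x
    unfolding real_norm_def abs_mult
    using abs_ln_mehler[of 0 x] g_bd[of x] C_nonneg by (intro mult_mono) (auto simp: mehler_def)
qed measurable

lemma x_ln_x_ge': "0 \<le> x \<Longrightarrow> - 1 \<le> x * ln (x :: real)"
  using x_ln_x_ge[of x] by (cases "x = 0") auto

section \<open>Lower semicontinuity of the entropy\<close>

context sobolev_root
begin

definition "E0 = (LINT x|gauss. (u x)\<^sup>2 * ln ((u x)\<^sup>2))"
definition "D j = (LINT x|gauss. g j x * ln (g j x))"

lemma D_int: "integrable gauss (\<lambda>x. g j x * ln (g j x))"
proof -
  obtain C where "nice_density (g j) (A j) C (tseq j / Z j)" using nice by blast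
  then show ?thesis by (rule nice_density.g_ln_g_integrable)
qed

text \<open>The logarithmic Sobolev inequality for the regular densities. It keeps their entropies
  bounded, and thereby makes the entropy of the limit finite.\<close>

lemma D_le: "D j \<le> (LINT x|gauss. H j x) / Z j / 2"
proof -
  obtain C where "nice_density (g j) (A j) C (tseq j / Z j)" using nice by blast
  then interpret n: nice_density "g j" "A j" C "tseq j / Z j" .
  have "D j \<le> (LINT x|gauss. (norm (A j x))\<^sup>2 / g j x) / 2"
    using n.deficit_nonneg unfolding n.deficit_def n.fisher_at_0 n.ent_0 D_def by simp
  also have "\<dots> \<le> (LINT x|gauss. H j x) / Z j / 2" by (rule divide_right_mono[OF g_fisher]) simp
  finally show ?thesis .
qed

text \<open>Fatou's lemma for the shifted integrand, which is bounded below, along a subsequence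
  that converges almost everywhere.\<close>

lemma entropy_liminf:
  obtains r :: "nat \<Rightarrow> nat" where "strict_mono r" "\<And>e. e > 0 \<Longrightarrow> eventually (\<lambda>j. E0 - e < D (r j)) sequentially"
proof -
  have i: "integrable gauss (\<lambda>x. g j x - (u x)\<^sup>2)" for j using g_int u2 by simp
  have "(\<lambda>j. LINT x|gauss. norm (g j x - (u x)\<^sup>2)) \<longlonglongrightarrow> 0" using g_L1 by simp
  from tendsto_L1_AE_subseq[OF i this] obtain r :: "nat \<Rightarrow> nat"
    where r: "strict_mono r" and lim: "AE x in gauss. (\<lambda>j. g (r j) x - (u x)\<^sup>2) \<longlonglongrightarrow> 0" by blast
  \<comment> \<open>The shift by 2 instead of 1 makes the integral of the limit strictly positive, so that
    \<^term>\<open>ennreal\<close> is strictly monotone near it.\<close>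
  have nn: "0 \<le> g j x * ln (g j x) + 2" for j x using x_ln_x_ge[OF g_pos, of j x] by simp
  have Dn: "(\<integral>\<^sup>+x. ennreal (g j x * ln (g j x) + 2) \<partial>gauss) = ennreal (D j + 2)" for j
    using D_int[of j] nn[of j] by (subst nn_integral_eq_integral) (auto simp: D_def)
  have "(\<integral>\<^sup>+x. ennreal ((u x)\<^sup>2 * ln ((u x)\<^sup>2) + 2) \<partial>gauss)
    = (\<integral>\<^sup>+x. liminf (\<lambda>j. ennreal (g (r j) x * ln (g (r j) x) + 2)) \<partial>gauss)"
  proof (rule nn_integral_cong_AE)
    show "AE x in gauss. ennreal ((u x)\<^sup>2 * ln ((u x)\<^sup>2) + 2) = liminf (\<lambda>j. ennreal (g (r j) x * ln (g (r j) x) + 2))"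
      using lim
    proof eventually_elim
      case (elim x)
      then have "(\<lambda>j. g (r j) x) \<longlonglongrightarrow> (u x)\<^sup>2" by (simp add: LIM_zero_iff)
      from x_ln_x_tendsto[OF this g_pos]
      have "(\<lambda>j. ennreal (g (r j) x * ln (g (r j) x) + 2)) \<longlonglongrightarrow> ennreal ((u x)\<^sup>2 * ln ((u x)\<^sup>2) + 2)"
        by (intro tendsto_ennrealI tendsto_add tendsto_const)
      then show ?case by (intro lim_imp_Liminf[symmetric]) simp_all
    qed
  qed
  also have "\<dots> \<le> liminf (\<lambda>j. \<integral>\<^sup>+x. ennreal (g (r j) x * ln (g (r j) x) + 2) \<partial>gauss)"
    by (rule nn_integral_liminf) measurable
  also have "\<dots> = liminf (\<lambda>j. ennreal (D (r j) + 2))" unfolding Dn ..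
  finally have fatou: "(\<integral>\<^sup>+x. ennreal ((u x)\<^sup>2 * ln ((u x)\<^sup>2) + 2) \<partial>gauss) \<le> liminf (\<lambda>j. ennreal (D (r j) + 2))" .
  \<comment> \<open>Integrability has to precede the conclusion: \<open>E0\<close> is a Bochner
    integral, with default value 0 for a nonintegrable integrand. The upper bound comes from
    \<open>D_le\<close>.\<close>
  have "liminf (\<lambda>j. ennreal (D (r j) + 2)) \<le> liminf (\<lambda>j. ennreal ((LINT x|gauss. H (r j) x) / Z (r j) / 2 + 2))"
    using D_le by (intro Liminf_mono always_eventually allI ennreal_leI add_right_mono)
  also have "\<dots> = ennreal (I0 / 1 / 2 + 2)"
  proof (rule lim_imp_Liminf)
    have "(\<lambda>j. (LINT x|gauss. H j x) / Z j / 2 + 2) \<longlonglongrightarrow> I0 / 1 / 2 + 2"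
      by (intro tendsto_intros H_tendsto Z_tendsto) simp_all
    from LIMSEQ_subseq_LIMSEQ[OF this r]
    show "(\<lambda>j. ennreal ((LINT x|gauss. H (r j) x) / Z (r j) / 2 + 2)) \<longlonglongrightarrow> ennreal (I0 / 1 / 2 + 2)"
      by (intro tendsto_ennrealI) (simp add: o_def)
  qed simp
  also have "\<dots> < \<infinity>" by simp
  finally have fin: "(\<integral>\<^sup>+x. ennreal ((u x)\<^sup>2 * ln ((u x)\<^sup>2) + 2) \<partial>gauss) < \<infinity>" using fatou by (simp add: le_less_trans)
  have nn0: "1 \<le> (u x)\<^sup>2 * ln ((u x)\<^sup>2) + 2" for x using x_ln_x_ge'[of "(u x)\<^sup>2"] by simp
  have int2: "integrable gauss (\<lambda>x. (u x)\<^sup>2 * ln ((u x)\<^sup>2) + 2)"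
    by (rule integrableI_nonneg[OF _ _ fin]) (use nn0 order_trans[OF zero_le_one nn0] in auto)
  have int: "integrable gauss (\<lambda>x. (u x)\<^sup>2 * ln ((u x)\<^sup>2))"
    using Bochner_Integration.integrable_diff[OF int2, of "\<lambda>_. 2"] by simp
  have E2: "(LINT x|gauss. (u x)\<^sup>2 * ln ((u x)\<^sup>2) + 2) = E0 + 2" using int by (simp add: E0_def)
  have "(LINT x|(gauss :: (real ^ 'n) measure). 1) \<le> (LINT x|gauss. (u x)\<^sup>2 * ln ((u x)\<^sup>2) + 2)"
    by (rule integral_mono[OF _ int2 nn0]) simp
  then have pos: "1 \<le> E0 + 2" unfolding E2 by simp
  have "(\<integral>\<^sup>+x. ennreal ((u x)\<^sup>2 * ln ((u x)\<^sup>2) + 2) \<partial>gauss) = ennreal (E0 + 2)"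
    unfolding E2[symmetric] by (rule nn_integral_eq_integral[OF int2]) (use order_trans[OF zero_le_one nn0] in auto)
  with fatou have le: "ennreal (E0 + 2) \<le> liminf (\<lambda>j. ennreal (D (r j) + 2))" by simp
  show thesis
  proof (rule that[OF r])
    fix e :: real assume e: "e > 0"
    have "ennreal (E0 + 2 - e) < ennreal (E0 + 2)" using e pos by (intro ennreal_lessI) auto
    then have "ennreal (E0 + 2 - e) < liminf (\<lambda>j. ennreal (D (r j) + 2))" using le by (rule less_le_trans)
    then have "eventually (\<lambda>j. ennreal (E0 + 2 - e) < ennreal (D (r j) + 2)) sequentially" by (rule less_LiminfD)
    then show "eventually (\<lambda>j. E0 - e < D (r j)) sequentially"
    proof eventually_elim
      case (elim j)
      show ?case
      proof (rule ccontr)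
        assume "\<not> E0 - e < D (r j)"
        then have "ennreal (D (r j) + 2) \<le> ennreal (E0 + 2 - e)" by (intro ennreal_leI) simp
        with elim show False by (simp add: not_le[symmetric])
      qed
    qed
  qed
qed

lemma nice_approximation:
  assumes e: "e > 0"
  obtains G :: "real ^ 'n \<Rightarrow> real" and A' C \<kappa> where "nice_density G A' C \<kappa>"
    "(LINT x|gauss. \<bar>G x - (u x)\<^sup>2\<bar>) \<le> e"
    "(LINT x|gauss. G x * (norm x)\<^sup>2) \<le> 4 * (LINT x|gauss. (u x)\<^sup>2 * (norm x)\<^sup>2) + 6 * gauss_mom2 TYPE('n)"
    "norm (LINT x|gauss. G x *\<^sub>R x) \<le> e"
    "(LINT x|gauss. (norm (A' x))\<^sup>2 / G x) / 2 - (LINT x|gauss. G x * ln (G x)) \<le> I0 / 2 - E0 + e"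
proof -
  obtain r :: "nat \<Rightarrow> nat" where r: "strict_mono r"
    and ent: "\<And>e. e > 0 \<Longrightarrow> eventually (\<lambda>j. E0 - e < D (r j)) sequentially" by (rule entropy_liminf) blast
  have sub: "eventually (\<lambda>j. Q (r j)) sequentially" if "eventually Q sequentially" for Q
    using filterlim_subseq[OF r] that by (rule eventually_compose_filterlim[rotated])
  have "(\<lambda>j. (LINT x|gauss. H j x) / Z j) \<longlonglongrightarrow> I0 / 1" by (intro tendsto_intros H_tendsto Z_tendsto) simp
  then have ev1: "eventually (\<lambda>j. (LINT x|gauss. H j x) / Z j < I0 + e) sequentially"
    by (rule order_tendstoD(2)) (use e in simp)
  have ev2: "eventually (\<lambda>j. (LINT x|gauss. \<bar>g j x - (u x)\<^sup>2\<bar>) < e) sequentially"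
    by (rule order_tendstoD(2)[OF g_L1 e])
  \<comment> \<open>This bound on \<open>Z\<close> doubles the estimate of
    \<open>g_second_moment\<close>: 2 becomes 4, and 2 + 1 becomes 6.\<close>
  have ev3: "eventually (\<lambda>j. 1 / 2 < Z j) sequentially" by (rule order_tendstoD(1)[OF Z_tendsto]) simp
  have "(\<lambda>j. norm (LINT x|gauss. P j x *\<^sub>R x) / Z j) \<longlonglongrightarrow> norm (0 :: real ^ 'n) / 1"
    by (intro tendsto_intros P_mean Z_tendsto) simp
  then have ev4: "eventually (\<lambda>j. norm (LINT x|gauss. P j x *\<^sub>R x) / Z j < e) sequentially"
    by (rule order_tendstoD(2)) (use e in simp)
  \<comment> \<open>The tolerance \<open>e\<close> is shared: half for this loss of entropy, half
    for the excess of Fisher information, which is itself halved in the deficit.\<close>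
  have ev5: "eventually (\<lambda>j. E0 - e / 2 < D (r j)) sequentially" by (rule ent) (use e in simp)
  have "eventually (\<lambda>j. (LINT x|gauss. H (r j) x) / Z (r j) < I0 + e \<and> (LINT x|gauss. \<bar>g (r j) x - (u x)\<^sup>2\<bar>) < e
    \<and> 1 / 2 < Z (r j) \<and> norm (LINT x|gauss. P (r j) x *\<^sub>R x) / Z (r j) < e \<and> E0 - e / 2 < D (r j)) sequentially"
    using sub[OF ev1] sub[OF ev2] sub[OF ev3] sub[OF ev4] ev5 by eventually_elim blast
  then obtain j' where j': "(LINT x|gauss. H (r j') x) / Z (r j') < I0 + e" "(LINT x|gauss. \<bar>g (r j') x - (u x)\<^sup>2\<bar>) < e"
    "1 / 2 < Z (r j')" "norm (LINT x|gauss. P (r j') x *\<^sub>R x) / Z (r j') < e" "E0 - e / 2 < D (r j')"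
    unfolding eventually_sequentially by blast
  define j where "j = r j'"
  note j = j'[folded j_def]
  obtain C where n: "nice_density (g j) (A j) C (tseq j / Z j)" using nice by blast
  show thesis
  proof (rule that[OF n])
    show "(LINT x|gauss. \<bar>g j x - (u x)\<^sup>2\<bar>) \<le> e" using j(2) by simp
    show "norm (LINT x|gauss. g j x *\<^sub>R x) \<le> e" using g_mean[of j] j(4) by simp
    have m0: "0 \<le> (LINT x|gauss. (u x)\<^sup>2 * (norm x)\<^sup>2)" and m2: "0 \<le> gauss_mom2 TYPE('n)"
      by (auto intro!: Bochner_Integration.integral_nonneg)
    have "tseq j \<le> 1" by (simp add: tseq_def inverse_le_1_iff)
    then have "tseq j * gauss_mom2 TYPE('n) \<le> 1 * gauss_mom2 TYPE('n)" using m2 by (intro mult_right_mono)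
    then have "(2 * (LINT x|gauss. (u x)\<^sup>2 * (norm x)\<^sup>2) + 2 * gauss_mom2 TYPE('n) + tseq j * gauss_mom2 TYPE('n)) / Z j
      \<le> (2 * (LINT x|gauss. (u x)\<^sup>2 * (norm x)\<^sup>2) + 3 * gauss_mom2 TYPE('n)) / (1 / 2)"
      using m0 m2 j(3) by (intro frac_le) auto
    then show "(LINT x|gauss. g j x * (norm x)\<^sup>2) \<le> 4 * (LINT x|gauss. (u x)\<^sup>2 * (norm x)\<^sup>2) + 6 * gauss_mom2 TYPE('n)"
      using g_second_moment[of j] by simp
    show "(LINT x|gauss. (norm (A j x))\<^sup>2 / g j x) / 2 - (LINT x|gauss. g j x * ln (g j x)) \<le> I0 / 2 - E0 + e"
      using g_fisher[of j] j(1,5) unfolding D_def by linarith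
  qed
qed

end

section \<open>From the given densities to roots, and the conclusion\<close>

lemma has_weak_gradient_cong_AE:
  assumes wg: "has_weak_gradient F G" and eq: "AE x in gauss. F x = F' x" and F' [measurable]: "F' \<in> borel_measurable borel"
  shows "has_weak_gradient F' G"
proof -
  have F [measurable]: "F \<in> borel_measurable borel"
    using wg unfolding has_weak_gradient_def by (auto intro: locally_integrable_measurable)
  have eq': "AE x in lborel. F x = F' x" using eq by (simp add: AE_gauss_iff)
  have "set_integrable lborel K F'" if "compact K" for K
  proof -
    have [measurable]: "K \<in> sets borel" using that by (simp add: borel_compact)
    have "integrable lborel (\<lambda>x. indicator K x *\<^sub>R F x)"
      using wg that unfolding has_weak_gradient_def locally_integrable_def set_integrable_def by blast
    then show ?thesis unfolding set_integrable_def
      by (subst integrable_cong_AE[where g = "\<lambda>x. indicator K x *\<^sub>R F x"]) (use eq' in \<open>auto elim: eventually_mono\<close>)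
  qed
  moreover have "(LINT x|lborel. F' x * partial_deriv i \<phi> x) = (LINT x|lborel. F x * partial_deriv i \<phi> x)"
    if "\<phi> \<in> test_functions" for \<phi> i
  proof (rule integral_cong_AE)
    have "continuous_on UNIV (partial_deriv i \<phi>)"
      using that unfolding test_functions_def by (auto dest: spec[of _ "Suc 0"])
    then have [measurable]: "partial_deriv i \<phi> \<in> borel_measurable borel" by (rule borel_measurable_continuous_onI)
    show "(\<lambda>x. F' x * partial_deriv i \<phi> x) \<in> borel_measurable lborel" "(\<lambda>x. F x * partial_deriv i \<phi> x) \<in> borel_measurable lborel"
      by measurable
  qed (use eq' in \<open>auto elim: eventually_mono\<close>)
  ultimately show ?thesis using wg unfolding has_weak_gradient_def locally_integrable_def by simp
qed

text \<open>Isabelle's square root is odd, so \<open>(sqrt (f x))\<^sup>2 = \<bar>f x\<bar>\<close>, and \<open>f\<close> is only nonnegative almost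
  everywhere: \<open>f\<close> and the square of its root have to be kept apart.\<close>

lemma sobolev_root_density:
  fixes f :: "real ^ 'n \<Rightarrow> real"
  assumes f: "gauss_prob_density f" and cen: "centered (density gauss (\<lambda>x. ennreal (f x)))"
    and W: "(\<lambda>x. sqrt (f x)) \<in> W12_gauss"
    and mom: "(\<integral>\<^sup>+x. ennreal (f x * (norm x)\<^sup>2) \<partial>gauss) \<le> ennreal M" and M: "0 \<le> M"
  obtains p where "sobolev_root (\<lambda>x. sqrt (f x)) p"
    "(LINT x|gauss. (sqrt (f x))\<^sup>2 * (norm x)\<^sup>2) \<le> M"
    "lsi_deficit f = sobolev_root.I0 (\<lambda>x. sqrt (f x)) p / 2 - sobolev_root.E0 (\<lambda>x. sqrt (f x))"
proof -
  have f_meas [measurable]: "f \<in> borel_measurable borel" and f0: "AE x in gauss. 0 \<le> f x"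
    and fp: "prob_space (density gauss (\<lambda>x. ennreal (f x)))"
    using f by (auto simp: gauss_prob_density_def)
  define u where "u x = sqrt (f x)" for x
  have u_meas [measurable]: "u \<in> borel_measurable borel" unfolding u_def[abs_def] by measurable
  have uf: "AE x in gauss. (u x)\<^sup>2 = f x" using f0 by eventually_elim (simp add: u_def)
  obtain p where p: "p \<in> L2_gauss" "has_weak_gradient u p" and u: "u \<in> L2_gauss"
    using W unfolding W12_gauss_def u_def[abs_def] by blast
  have p_meas [measurable]: "p \<in> borel_measurable borel" and p2: "integrable gauss (\<lambda>x. (norm (p x))\<^sup>2)"
    using p(1) by (auto simp: L2_gauss_def)
  have u2: "integrable gauss (\<lambda>x. (u x)\<^sup>2)" using u by (simp add: L2_gauss_def)
  have nn1: "(\<integral>\<^sup>+x. ennreal (f x) \<partial>gauss) = 1"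
    using prob_space.emeasure_space_1[OF fp] by (simp add: emeasure_density)
  have "(\<integral>\<^sup>+x. ennreal ((u x)\<^sup>2) \<partial>gauss) = 1"
    unfolding nn1[symmetric] by (rule nn_integral_cong_AE) (use uf in \<open>auto elim: eventually_mono\<close>)
  then have mass: "(LINT x|gauss. (u x)\<^sup>2) = 1"
    by (subst integral_eq_nn_integral) auto
  have mom': "(\<integral>\<^sup>+x. ennreal ((u x)\<^sup>2 * (norm x)\<^sup>2) \<partial>gauss) \<le> ennreal M"
  proof -
    have "(\<integral>\<^sup>+x. ennreal ((u x)\<^sup>2 * (norm x)\<^sup>2) \<partial>gauss) = (\<integral>\<^sup>+x. ennreal (f x * (norm x)\<^sup>2) \<partial>gauss)"
      by (rule nn_integral_cong_AE) (use uf in \<open>auto elim: eventually_mono\<close>)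
    then show ?thesis using mom by simp
  qed
  have mom_int: "integrable gauss (\<lambda>x. (u x)\<^sup>2 * (norm x)\<^sup>2)"
    by (rule integrableI_nonneg) (use mom' in \<open>auto intro: le_less_trans\<close>)
  have "ennreal (LINT x|gauss. (u x)\<^sup>2 * (norm x)\<^sup>2) \<le> ennreal M"
    using mom' by (subst nn_integral_eq_integral[symmetric, OF mom_int]) auto
  then have momM: "(LINT x|gauss. (u x)\<^sup>2 * (norm x)\<^sup>2) \<le> M" using M by (simp add: ennreal_le_iff)
  have mean: "(LINT x|gauss. (u x)\<^sup>2 *\<^sub>R x) = 0"
  proof -
    have "(LINT x|gauss. (u x)\<^sup>2 *\<^sub>R x) = (LINT x|gauss. f x *\<^sub>R x)"
      by (rule integral_cong_AE) (use uf in \<open>auto elim: eventually_mono\<close>)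
    also have "\<dots> = (LINT x|density gauss (\<lambda>x. ennreal (f x)). x)"
      by (rule integral_density[symmetric]) (use f0 in auto)
    also have "\<dots> = 0" using cen by (simp add: centered_def)
    finally show ?thesis .
  qed
  interpret s: sobolev_root u p
    by unfold_locales (use p2 p(2) u2 mass mom_int mean in simp_all)
  have wgf: "has_weak_gradient f (\<lambda>x. (2 * u x) *\<^sub>R p x)"
    by (rule has_weak_gradient_cong_AE[OF s.wg2 uf f_meas])
  \<comment> \<open>A weak gradient exists, so \<open>SOME\<close> picks one, and uniqueness
    identifies it almost everywhere with the chain rule expression.\<close>
  then have "has_weak_gradient f (weak_gradient f)" unfolding weak_gradient_def by (rule someI[of "has_weak_gradient f"])
  from weak_gradient_unique[OF this wgf] have wg: "AE x in gauss. weak_gradient f x = (2 * u x) *\<^sub>R p x" .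
  have wgm [measurable]: "weak_gradient f \<in> borel_measurable borel"
    using \<open>has_weak_gradient f (weak_gradient f)\<close> unfolding has_weak_gradient_def by (auto intro: locally_integrable_measurable)
  have "fisher_information f = s.I0"
    unfolding fisher_information_def s.I0_def
  proof (rule integral_cong_AE)
    show "AE x in gauss. (norm (weak_gradient f x))\<^sup>2 / f x = (if u x = 0 then 0 else 4 * (norm (p x))\<^sup>2)"
      using wg uf
    proof eventually_elim
      case (elim x)
      \<comment> \<open>Both sides vanish for \<open>u x = 0\<close>, the left one by division by
        zero.\<close>
      show ?case unfolding elim(1) elim(2)[symmetric] by (simp add: power_mult_distrib)
    qed
  qed measurable
  moreover have "relative_entropy f = s.E0"
    unfolding relative_entropy_def s.E0_def
    by (rule integral_cong_AE) (use uf in \<open>auto elim: eventually_mono\<close>)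
  ultimately have "lsi_deficit f = s.I0 / 2 - s.E0" by (simp add: lsi_deficit_def)
  then show thesis using that s.sobolev_root_axioms momM unfolding u_def[abs_def] by blast
qed

text \<open>With \<open>d = \<epsilon> / (4 pi)\<close>, the inequality
  \<open>d r \<le> exp (d r)\<close> at \<open>r = |x|^2\<close> trades the factor
  \<open>|x|^2\<close> for \<open>1 / d\<close> and an exponent weakened by \<open>d\<close>, which
  is the weight of the hypothesis.\<close>

lemma second_moment_le:
  fixes f :: "real ^ 'n \<Rightarrow> real"
  assumes f [measurable]: "f \<in> borel_measurable borel" and f0: "AE x in gauss. 0 \<le> f x" and eps: "\<epsilon> > 0"
    and exp: "(\<integral>\<^sup>+x. ennreal (f x * exp (- (1 / 2 - \<epsilon> / (4 * pi)) * (norm x)\<^sup>2)) \<partial>lborel) \<le> ennreal C"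
    and C: "0 \<le> C"
  shows "(\<integral>\<^sup>+x. ennreal (f x * (norm x)\<^sup>2) \<partial>gauss) \<le> ennreal ((2 * pi) powr (- real CARD('n) / 2) * (4 * pi / \<epsilon>) * C)"
proof -
  define d where "d = \<epsilon> / (4 * pi)"
  have d: "d > 0" "4 * pi / \<epsilon> = 1 / d" using eps by (auto simp: d_def)
  let ?c = "(2 * pi) powr (- real CARD('n) / 2)"
  have "(\<integral>\<^sup>+x. ennreal (f x * (norm x)\<^sup>2) \<partial>gauss) = (\<integral>\<^sup>+x. ennreal (gauss_pdf x) * ennreal (f x * (norm x)\<^sup>2) \<partial>lborel)"
    by (rule nn_integral_gauss) measurable
  also have "\<dots> \<le> (\<integral>\<^sup>+x. ennreal (?c * (1 / d)) * ennreal (f x * exp (- (1 / 2 - d) * (norm x)\<^sup>2)) \<partial>lborel)"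
  proof (rule nn_integral_mono_AE)
    have "AE x in lborel. 0 \<le> f x" using f0 by (simp add: AE_gauss_iff)
    then show "AE x in lborel. ennreal (gauss_pdf x) * ennreal (f x * (norm x)\<^sup>2)
      \<le> ennreal (?c * (1 / d)) * ennreal (f x * exp (- (1 / 2 - d) * (norm x)\<^sup>2))"
    proof eventually_elim
      case (elim x)
      have "d * (norm x)\<^sup>2 \<le> exp (d * (norm x)\<^sup>2)" using exp_ge_add_one_self[of "d * (norm x)\<^sup>2"] by linarith
      then have "(norm x)\<^sup>2 \<le> (1 / d) * exp (d * (norm x)\<^sup>2)" using d(1) by (simp add: field_simps)
      then have "exp (- (norm x)\<^sup>2 / 2) * (norm x)\<^sup>2 \<le> exp (- (norm x)\<^sup>2 / 2) * ((1 / d) * exp (d * (norm x)\<^sup>2))"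
        by (rule mult_left_mono) simp
      also have "\<dots> = (1 / d) * exp (- (norm x)\<^sup>2 / 2 + d * (norm x)\<^sup>2)" by (simp only: exp_add mult_ac)
      also have "- (norm x)\<^sup>2 / 2 + d * (norm x)\<^sup>2 = - (1 / 2 - d) * (norm x)\<^sup>2" by (simp add: algebra_simps)
      finally have "(?c * f x) * (exp (- (norm x)\<^sup>2 / 2) * (norm x)\<^sup>2) \<le> (?c * f x) * ((1 / d) * exp (- (1 / 2 - d) * (norm x)\<^sup>2))"
        using elim by (intro mult_left_mono) auto
      then have "gauss_pdf x * (f x * (norm x)\<^sup>2) \<le> (?c * (1 / d)) * (f x * exp (- (1 / 2 - d) * (norm x)\<^sup>2))"
        by (simp add: gauss_pdf_def mult_ac)
      then show ?case using elim d(1) gauss_pdf_pos[of x]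
        by (subst (1 2) ennreal_mult[symmetric]) (auto intro!: ennreal_leI)
    qed
  qed
  also have "\<dots> = ennreal (?c * (1 / d)) * (\<integral>\<^sup>+x. ennreal (f x * exp (- (1 / 2 - d) * (norm x)\<^sup>2)) \<partial>lborel)"
    by (rule nn_integral_cmult) measurable
  also have "\<dots> \<le> ennreal (?c * (1 / d)) * ennreal C" using exp unfolding d_def by (intro mult_left_mono) auto
  also have "\<dots> = ennreal (?c * (4 * pi / \<epsilon>) * C)" using d C by (simp add: ennreal_mult[symmetric])
  finally show ?thesis .
qed

theorem corollary1p10:
  fixes f :: "nat \<Rightarrow> real ^ 'n \<Rightarrow> real" and \<epsilon> C :: real
  assumes "\<epsilon> > 0" and "C > 0"
    and "\<And>k. k \<ge> 1 \<Longrightarrow> gauss_prob_density (f k)"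
    and "\<And>k. k \<ge> 1 \<Longrightarrow> centered (density gauss_measure (\<lambda>x. ennreal (f k x)))"
    and "\<And>k. k \<ge> 1 \<Longrightarrow> (\<lambda>x. sqrt (f k x)) \<in> W12_gauss"
    and "\<And>k. k \<ge> 1 \<Longrightarrow>
          (\<integral>\<^sup>+x. ennreal (f k x * exp (- (1 / 2 - \<epsilon> / (4 * pi)) * (norm x)\<^sup>2)) \<partial>lborel) \<le> ennreal C"
    and "(\<lambda>k. lsi_deficit (f k)) \<longlonglongrightarrow> 0"
  shows "(\<lambda>k. \<integral>\<^sup>+x. ennreal \<bar>f k x - 1\<bar> \<partial>gauss_measure) \<longlonglongrightarrow> 0"
proof -
  define M where "M = (2 * pi) powr (- real CARD('n) / 2) * (4 * pi / \<epsilon>) * C"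
  have M: "0 \<le> M" unfolding M_def using assms(1,2) by simp
  have meas: "f k \<in> borel_measurable borel" "AE x in gauss. 0 \<le> f k x" if "k \<ge> 1" for k
    using assms(3)[OF that] by (auto simp: gauss_prob_density_def)
  have mom: "(\<integral>\<^sup>+x. ennreal (f k x * (norm x)\<^sup>2) \<partial>gauss) \<le> ennreal M" if "k \<ge> 1" for k
    unfolding M_def using assms(2) by (intro second_moment_le[OF meas[OF that] assms(1) assms(6)[OF that]]) simp
  \<comment> \<open>The second moment bound that \<open>nice_approximation\<close> guarantees for
    the regular densities.\<close>
  define M' where "M' = 4 * M + 6 * gauss_mom2 TYPE('n)"
  have M': "0 \<le> M'" unfolding M'_def using M
    by (intro add_nonneg_nonneg mult_nonneg_nonneg Bochner_Integration.integral_nonneg) auto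
  have ev: "eventually (\<lambda>k. (\<integral>\<^sup>+x. ennreal \<bar>f k x - 1\<bar> \<partial>gauss) \<le> ennreal e) sequentially" if e: "e > 0" for e
  proof -
    have e2: "0 < e / 2" using e by simp
    obtain d where d: "0 < d" and nice: "\<And>(g :: real ^ 'n \<Rightarrow> real) A C \<kappa>. nice_density g A C \<kappa> \<Longrightarrow>
      (LINT x|gauss. g x * (norm x)\<^sup>2) \<le> M' \<Longrightarrow> norm (LINT x|gauss. g x *\<^sub>R x) \<le> d \<Longrightarrow>
      (LINT x|gauss. (norm (A x))\<^sup>2 / g x) / 2 - (LINT x|gauss. g x * ln (g x)) < d \<Longrightarrow>
      (LINT x|gauss. \<bar>g x - 1\<bar>) \<le> e / 2"
      by (rule nice_density_L1[where 'n = 'n, OF M' e2]) (rule that)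
    have "eventually (\<lambda>k. lsi_deficit (f k) < d / 2) sequentially"
      by (rule order_tendstoD(2)[OF assms(7)]) (use d in simp)
    with eventually_ge_at_top[of 1] show ?thesis
    proof eventually_elim
      case (elim k)
      \<comment> \<open>Half of \<open>e\<close> is spent on the distance from \<open>f k\<close> to
        \<open>G\<close>, the other half on that from \<open>G\<close> to 1. A deficit below
        \<open>d / 2\<close> becomes at most \<open>3 d / 4\<close>, still below
        \<open>d\<close>.\<close>
      define a where "a = min (e / 2) (d / 4)"
      have a: "a > 0" "a \<le> e / 2" "a \<le> d / 4" unfolding a_def using e d by auto
      obtain p where s: "sobolev_root (\<lambda>x. sqrt (f k x)) p"
        and m: "(LINT x|gauss. (sqrt (f k x))\<^sup>2 * (norm x)\<^sup>2) \<le> M"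
        and def: "lsi_deficit (f k) = sobolev_root.I0 (\<lambda>x. sqrt (f k x)) p / 2 - sobolev_root.E0 (\<lambda>x. sqrt (f k x))"
        using sobolev_root_density[OF assms(3,4,5)[OF elim(1)] mom[OF elim(1)] M] by blast
      interpret s: sobolev_root "\<lambda>x. sqrt (f k x)" p by (rule s)
      obtain G :: "real ^ 'n \<Rightarrow> real" and A C \<kappa> where n: "nice_density G A C \<kappa>"
        and G: "(LINT x|gauss. \<bar>G x - (sqrt (f k x))\<^sup>2\<bar>) \<le> a"
        "(LINT x|gauss. G x * (norm x)\<^sup>2) \<le> 4 * (LINT x|gauss. (sqrt (f k x))\<^sup>2 * (norm x)\<^sup>2) + 6 * gauss_mom2 TYPE('n)"
        "norm (LINT x|gauss. G x *\<^sub>R x) \<le> a"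
        "(LINT x|gauss. (norm (A x))\<^sup>2 / G x) / 2 - (LINT x|gauss. G x * ln (G x)) \<le> s.I0 / 2 - s.E0 + a"
        using s.nice_approximation[OF a(1)] by blast
      have GL: "(LINT x|gauss. \<bar>G x - 1\<bar>) \<le> e / 2"
      proof (rule nice[OF n])
        show "(LINT x|gauss. G x * (norm x)\<^sup>2) \<le> M'" using G(2) m unfolding M'_def by linarith
        show "norm (LINT x|gauss. G x *\<^sub>R x) \<le> d" using G(3) a(3) d by linarith
        show "(LINT x|gauss. (norm (A x))\<^sup>2 / G x) / 2 - (LINT x|gauss. G x * ln (G x)) < d"
          using G(4) def elim(2) a(3) d by linarith
      qed
      interpret n: nice_density G A C \<kappa> by (rule n)
      note i = n.g_int s.u2
      have "(\<integral>\<^sup>+x. ennreal \<bar>f k x - 1\<bar> \<partial>gauss) = (\<integral>\<^sup>+x. ennreal \<bar>(sqrt (f k x))\<^sup>2 - 1\<bar> \<partial>gauss)"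
        by (rule nn_integral_cong_AE) (use meas(2)[OF elim(1)] in \<open>auto elim: eventually_mono\<close>)
      also have "\<dots> = ennreal (LINT x|gauss. \<bar>(sqrt (f k x))\<^sup>2 - 1\<bar>)"
        by (rule nn_integral_eq_integral) (use i in auto)
      also have "\<dots> \<le> ennreal e"
      proof (rule ennreal_leI)
        have "(LINT x|gauss. \<bar>(sqrt (f k x))\<^sup>2 - 1\<bar>) \<le> (LINT x|gauss. \<bar>G x - (sqrt (f k x))\<^sup>2\<bar> + \<bar>G x - 1\<bar>)"
          by (rule integral_mono) (use i in auto)
        also have "\<dots> = (LINT x|gauss. \<bar>G x - (sqrt (f k x))\<^sup>2\<bar>) + (LINT x|gauss. \<bar>G x - 1\<bar>)"
          by (rule Bochner_Integration.integral_add) (use i in auto)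
        also have "\<dots> \<le> e" using G(1) GL a(2) by linarith
        finally show "(LINT x|gauss. \<bar>(sqrt (f k x))\<^sup>2 - 1\<bar>) \<le> e" .
      qed
      finally show ?case .
    qed
  qed
  show ?thesis
  proof (rule order_tendstoI)
    fix a :: ennreal assume a: "0 < a"
    obtain e where e: "e > 0" "ennreal e < a"
    proof (cases a)
      case (real r)
      then have "r > 0" using a by simp
      then show thesis using that[of "r / 2"] real by (simp add: ennreal_less_iff)
    next
      case top
      then show thesis using that[of 1] by simp
    qed
    show "eventually (\<lambda>k. (\<integral>\<^sup>+x. ennreal \<bar>f k x - 1\<bar> \<partial>gauss) < a) sequentially"
      using ev[OF e(1)] by eventually_elim (use e(2) in \<open>auto intro: le_less_trans\<close>)
  qed simp
qed

end
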